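(* Suppose $\eta>0$ (duality condition) and $N_R<N$. Define $$\beta_2=\max\left\{\min\left\{c^{-1}(\rho_{\min}/2),\,(c^\flat)^{-1}(\rho_{\min}^\flat/2)\right\},\ 2\frac{\omega_{\max}}{b_{\min}},\ 2\frac{\omega_{\max}^\flat}{b_{\min}^\flat}\right\}.$$ If $\beta>\beta_2$, then $\mathbb C^{2N}=H_{h\ell}(\beta)\oplus H_{\ell\ell,0}(\beta)\oplus H_{\ell\ell,1}(\beta)$ with $\dim H_{h\ell}(\beta)=\dim H_{\ell\ell,0}(\beta)=N_R$, $\dim H_{\ell\ell,1}(\beta)=2N-2N_R$, and $$\min_{\zeta\in\sigma(A(\beta)|_{H_{\ell\ell,1}(\beta)})}Q_\zeta>\frac12 .$$ In particular, $\operatorname{Re}\zeta\neq0$ for every $\zeta\in\sigma\big(A(\beta)|_{H_{\ell\ell,1}(\beta)}\big)$.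
   Context: Setting. $N\ge 1$; $\alpha,\eta,\theta,R$ are real $N\times N$ matrices with $\alpha^{\mathrm T}=\alpha>0$, $\eta^{\mathrm T}=\eta\ge0$, $\theta^{\mathrm T}=-\theta$, $R^{\mathrm T}=R\ge0$, and $N_R=\operatorname{rank}R>0$; $\beta\ge0$. $\sqrt{\cdot}$ denotes the positive semidefinite square root. On $H=\mathbb C^{2N}=\mathbb C^N\oplus\mathbb C^N$ set $$\Omega=\begin{bmatrix}-2\mathrm i\sqrt\alpha^{-1}\theta\sqrt\alpha^{-1} & -\mathrm i\Phi^{\mathrm T}\\ \mathrm i\Phi&0\end{bmatrix},\quad \Phi=\sqrt\eta\sqrt\alpha^{-1},\quad B=\begin{bmatrix}\sqrt\alpha^{-1}R\sqrt\alpha^{-1}&0\\0&0\end{bmatrix},\quad A(\beta)=\Omega-\mathrm i\beta B .$$ $\Omega$ is Hermitian, $B\ge0$, $\operatorname{rank}B=N_R$; all eigenvalues $\zeta$ of $A(\beta)$ satisfy $\operatorname{Im}\zeta\le0$. $P_B^\perp$ is the orthogonal projection onto $\operatorname{Ker}B$; when $\eta>0$ and $N_R<N$, $P_B^\perp\Omega P_B^\perp\ne0$ and $\rho_{\min}$ denotes its smallest positive eigenvalue. $\omega_{\max}$ is the largest eigenvalue of $\Omega$ ($=\|\Omega\|$); $\omega_{\min}=\min|\sigma(\Omega)|$, the smallest positive eigenvalue of $\Omega$ when $\eta>0$; $b_{\min}$ is the smallest nonzero eigenvalue of $B$ (equivalently of $\alpha^{-1}R$). Let $c^{-1}(y)=\frac{2\omega_{\max}^2}{b_{\min}}y^{-1}+\frac{2\omega_{\max}}{b_{\min}}$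 for $y>0$. The quality factor is $Q_\zeta=\frac12\frac{|\operatorname{Re}\zeta|}{-\operatorname{Im}\zeta}$, with $Q_\zeta=+\infty$ if $\operatorname{Im}\zeta=0\neq\operatorname{Re}\zeta$ and $Q_0=0$. Dual objects: when $\eta>0$, an object with superscript $\flat$ ($\omega_{\max}^\flat,b_{\min}^\flat,\rho_{\min}^\flat,(c^\flat)^{-1}$) is defined exactly as the one without it but with $\alpha$ and $\eta$ interchanged. Subspaces: for $\eta>0$ and $\beta>\max\{2\omega_{\max}/b_{\min},2\omega_{\max}^\flat/b_{\min}^\flat\}$, $H_{h\ell}(\beta)$, $H_{\ell\ell,0}(\beta)$, $H_{\ell\ell,1}(\beta)$ are the sums of the generalized eigenspaces of $A(\beta)$ for its eigenvalues with $|\zeta|>\omega_{\max}$, $|\zeta|<\omega_{\min}$, and $\omega_{\min}\le|\zeta|\le\omega_{\max}$, respectively. *)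

theory Defs
  imports "HOL-Analysis.Analysis"
begin

definition pos_semidef :: "real^'n^'n \<Rightarrow> bool" where
  "pos_semidef M \<longleftrightarrow> transpose M = M \<and> (\<forall>x. 0 \<le> x \<bullet> (M *v x))"

definition pos_def :: "real^'n^'n \<Rightarrow> bool" where
  "pos_def M \<longleftrightarrow> transpose M = M \<and> (\<forall>x. x \<noteq> 0 \<longrightarrow> 0 < x \<bullet> (M *v x))"

definition matrix_sqrt :: "real^'n^'n \<Rightarrow> real^'n^'n" where
  "matrix_sqrt M = (THE S. pos_semidef S \<and> S ** S = M)"

definition block_matrix ::
  "'a^'n^'n \<Rightarrow> 'a^'n^'n \<Rightarrow> 'a^'n^'n \<Rightarrow> 'a^'n^'n \<Rightarrow> 'a^('n + 'n)^('n + 'n)" where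
  "block_matrix P Q R S = (\<chi> i j.
     case i of
       Inl a \<Rightarrow> (case j of Inl b \<Rightarrow> P $ a $ b | Inr b \<Rightarrow> Q $ a $ b)
     | Inr a \<Rightarrow> (case j of Inl b \<Rightarrow> R $ a $ b | Inr b \<Rightarrow> S $ a $ b))"

(* Phi, Omega, B and everything derived from them take the matrices alpha, eta, theta, R as
   arguments; the dual (flat) objects are obtained by interchanging alpha and eta. *)

definition Phi_op :: "real^'n^'n \<Rightarrow> real^'n^'n \<Rightarrow> real^'n^'n" where
  "Phi_op \<alpha> \<eta> = matrix_sqrt \<eta> ** matrix_inv (matrix_sqrt \<alpha>)"

definition Omega_op ::
  "real^'n^'n \<Rightarrow> real^'n^'n \<Rightarrow> real^'n^'n \<Rightarrow> complex^('n + 'n)^('n + 'n)" where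
  "Omega_op \<alpha> \<eta> \<theta> =
     (let K = matrix_inv (matrix_sqrt \<alpha>); \<Phi> = Phi_op \<alpha> \<eta> in
      block_matrix
        (map_matrix (\<lambda>x. - 2 * \<i> * complex_of_real x) (K ** \<theta> ** K))
        (map_matrix (\<lambda>x. - \<i> * complex_of_real x) (transpose \<Phi>))
        (map_matrix (\<lambda>x. \<i> * complex_of_real x) \<Phi>)
        0)"

definition B_op :: "real^'n^'n \<Rightarrow> real^'n^'n \<Rightarrow> complex^('n + 'n)^('n + 'n)" where
  "B_op \<alpha> R =
     (let K = matrix_inv (matrix_sqrt \<alpha>) in
      block_matrix (map_matrix complex_of_real (K ** R ** K)) 0 0 0)"

definition A_op ::
  "real^'n^'n \<Rightarrow> real^'n^'n \<Rightarrow> real^'n^'n \<Rightarrow> real^'n^'n \<Rightarrow> real \<Rightarrow> complex^('n + 'n)^('n + 'n)" where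
  "A_op \<alpha> \<eta> \<theta> R \<beta> =
     Omega_op \<alpha> \<eta> \<theta> - map_matrix (\<lambda>z. \<i> * complex_of_real \<beta> * z) (B_op \<alpha> R)"

(* Spectrum of the restriction of M to an M-invariant subspace H. *)
definition spectrum_on :: "complex^'m^'m \<Rightarrow> (complex^'m) set \<Rightarrow> complex set" where
  "spectrum_on M H = {\<zeta>. \<exists>v\<in>H. v \<noteq> 0 \<and> M *v v = \<zeta> *s v}"

abbreviation spectrum :: "complex^'m^'m \<Rightarrow> complex set" where
  "spectrum M \<equiv> spectrum_on M UNIV"

definition gen_eigenspace :: "complex^'m^'m \<Rightarrow> complex \<Rightarrow> (complex^'m) set" where
  "gen_eigenspace M \<zeta> = {v. \<exists>k. ((\<lambda>w. M *v w - \<zeta> *s w) ^^ k) v = 0}"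

(* The prefix vec. selects the complex-linear span and dimension. *)
definition gen_eigenspace_sum :: "complex^'m^'m \<Rightarrow> complex set \<Rightarrow> (complex^'m) set" where
  "gen_eigenspace_sum M Z = vec.span (\<Union>\<zeta>\<in>spectrum M \<inter> Z. gen_eigenspace M \<zeta>)"

definition conj_transpose :: "complex^'m^'m \<Rightarrow> complex^'m^'m" where
  "conj_transpose M = map_matrix cnj (transpose M)"

definition orth_projection :: "(complex^'m) set \<Rightarrow> complex^'m^'m" where
  "orth_projection K =
     (THE P. conj_transpose P = P \<and> P ** P = P \<and> range (\<lambda>v. P *v v) = K)"

definition omega_max :: "real^'n^'n \<Rightarrow> real^'n^'n \<Rightarrow> real^'n^'n \<Rightarrow> real" where
  "omega_max \<alpha> \<eta> \<theta> = Max {x. complex_of_real x \<in> spectrum (Omega_op \<alpha> \<eta> \<theta>)}"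

definition omega_min :: "real^'n^'n \<Rightarrow> real^'n^'n \<Rightarrow> real^'n^'n \<Rightarrow> real" where
  "omega_min \<alpha> \<eta> \<theta> = Min (cmod ` spectrum (Omega_op \<alpha> \<eta> \<theta>))"

definition b_min :: "real^'n^'n \<Rightarrow> real^'n^'n \<Rightarrow> real" where
  "b_min \<alpha> R = Min {x. x \<noteq> 0 \<and> complex_of_real x \<in> spectrum (B_op \<alpha> R)}"

definition rho_min :: "real^'n^'n \<Rightarrow> real^'n^'n \<Rightarrow> real^'n^'n \<Rightarrow> real^'n^'n \<Rightarrow> real" where
  "rho_min \<alpha> \<eta> \<theta> R =
     (let P = orth_projection {v. B_op \<alpha> R *v v = 0} in
      Min {x. 0 < x \<and> complex_of_real x \<in> spectrum (P ** Omega_op \<alpha> \<eta> \<theta> ** P)})"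

definition c_inv ::
  "real^'n^'n \<Rightarrow> real^'n^'n \<Rightarrow> real^'n^'n \<Rightarrow> real^'n^'n \<Rightarrow> real \<Rightarrow> real" where
  "c_inv \<alpha> \<eta> \<theta> R y =
     2 * (omega_max \<alpha> \<eta> \<theta>)\<^sup>2 / b_min \<alpha> R * inverse y + 2 * omega_max \<alpha> \<eta> \<theta> / b_min \<alpha> R"

definition beta2 :: "real^'n^'n \<Rightarrow> real^'n^'n \<Rightarrow> real^'n^'n \<Rightarrow> real^'n^'n \<Rightarrow> real" where
  "beta2 \<alpha> \<eta> \<theta> R =
     Max {min (c_inv \<alpha> \<eta> \<theta> R (rho_min \<alpha> \<eta> \<theta> R / 2)) (c_inv \<eta> \<alpha> \<theta> R (rho_min \<eta> \<alpha> \<theta> R / 2)),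
          2 * (omega_max \<alpha> \<eta> \<theta> / b_min \<alpha> R),
          2 * (omega_max \<eta> \<alpha> \<theta> / b_min \<eta> R)}"

definition H_hl ::
  "real^'n^'n \<Rightarrow> real^'n^'n \<Rightarrow> real^'n^'n \<Rightarrow> real^'n^'n \<Rightarrow> real \<Rightarrow> (complex^('n + 'n)) set" where
  "H_hl \<alpha> \<eta> \<theta> R \<beta> =
     gen_eigenspace_sum (A_op \<alpha> \<eta> \<theta> R \<beta>) {\<zeta>. cmod \<zeta> > omega_max \<alpha> \<eta> \<theta>}"

definition H_ll0 ::
  "real^'n^'n \<Rightarrow> real^'n^'n \<Rightarrow> real^'n^'n \<Rightarrow> real^'n^'n \<Rightarrow> real \<Rightarrow> (complex^('n + 'n)) set" where
  "H_ll0 \<alpha> \<eta> \<theta> R \<beta> =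
     gen_eigenspace_sum (A_op \<alpha> \<eta> \<theta> R \<beta>) {\<zeta>. cmod \<zeta> < omega_min \<alpha> \<eta> \<theta>}"

definition H_ll1 ::
  "real^'n^'n \<Rightarrow> real^'n^'n \<Rightarrow> real^'n^'n \<Rightarrow> real^'n^'n \<Rightarrow> real \<Rightarrow> (complex^('n + 'n)) set" where
  "H_ll1 \<alpha> \<eta> \<theta> R \<beta> =
     gen_eigenspace_sum (A_op \<alpha> \<eta> \<theta> R \<beta>)
       {\<zeta>. omega_min \<alpha> \<eta> \<theta> \<le> cmod \<zeta> \<and> cmod \<zeta> \<le> omega_max \<alpha> \<eta> \<theta>}"

definition quality_factor :: "complex \<Rightarrow> ereal" where
  "quality_factor \<zeta> =
     (if Im \<zeta> = 0 then (if Re \<zeta> = 0 then 0 else \<infinity>)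
      else ereal (1 / 2 * (\<bar>Re \<zeta>\<bar> / (- Im \<zeta>))))"

end

theory Submission
  imports Defs "HOL-Computational_Algebra.Fundamental_Theorem_Algebra"
begin

text \<open>
  All eigenvalue counts come from discrete Lyapunov (Stein) inequalities: if a bounded quadratic form
  \<open>h\<close> satisfies \<open>h (A x) \<ge> r\<^sup>2 h x\<close>, then \<open>h \<le> 0\<close> on the root subspace of \<open>A\<close> belonging to
  \<open>|\<zeta>| < r\<close> and \<open>h \<ge> 0\<close> on that belonging to \<open>|\<zeta>| > r\<close>, so the signature of \<open>h\<close> bounds their
  dimensions and no continuity of eigenvalues in \<open>\<beta>\<close> is needed.

  With \<open>P\<close> and \<open>Q\<close> the orthogonal projections onto the range and the kernel of \<open>B\<close>, the form
  \<open>|P x|\<^sup>2 - |Q x|\<^sup>2\<close> with \<open>r\<close> slightly above \<open>\<omega>\<^sub>m\<^sub>a\<^sub>x\<close> gives \<open>N\<^sub>R\<close> high-loss eigenvalues as soon as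
  \<open>\<beta> b\<^sub>m\<^sub>i\<^sub>n > 2 \<omega>\<^sub>m\<^sub>a\<^sub>x\<close>. Interchanging \<open>\<alpha>\<close> and \<open>\<eta>\<close> replaces \<open>A\<close> by \<open>- A\<^sup>-\<^sup>1\<close> up to swapping the two
  blocks, which turns this into the count of the eigenvalues with \<open>|\<zeta>| < \<omega>\<^sub>m\<^sub>i\<^sub>n\<close>.

  A quality factor above \<open>1/2\<close> means \<open>Re \<zeta>\<^sup>2 > 0\<close>. A second Stein form,
  negative exactly on the kernel of the compression of \<open>\<Omega>\<close> to the kernel of \<open>B\<close>, shows that at most
  \<open>N\<^sub>R\<close> eigenvalues satisfy \<open>|\<zeta>| < \<rho>\<^sub>m\<^sub>i\<^sub>n / 2\<close>, while those with \<open>\<rho>\<^sub>m\<^sub>i\<^sub>n / 2 \<le> |\<zeta>| \<le> \<omega>\<^sub>m\<^sub>a\<^sub>x\<close> have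
  \<open>Re \<zeta>\<^sup>2 > 0\<close>. The eigenvalues below \<open>\<omega>\<^sub>m\<^sub>i\<^sub>n\<close> have \<open>Re \<zeta>\<^sup>2 < 0\<close> by duality, hence they are precisely
  these \<open>N\<^sub>R\<close> ones.
\<close>

section \<open>Self-adjoint operators\<close>

text \<open>A maximiser \<open>v\<close> of the Rayleigh quotient exists on the compact unit sphere
  of \<open>S\<close>. With \<open>\<mu>\<close> its value, the form
  \<open>\<mu> * (x \<bullet> x) - f x \<bullet> x\<close> is nonnegative on \<open>S\<close> and
  vanishes at \<open>v\<close>, so its first variation in the direction
  \<open>\<mu> *\<^sub>R v - f v\<close>, which lies in \<open>S\<close> by invariance, must
  vanish.\<close>

lemma selfadjoint_eigenvector:
  fixes f :: "'a::euclidean_space \<Rightarrow> 'a"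
  assumes lin: "linear f" and sa: "\<And>x y. f x \<bullet> y = x \<bullet> f y"
    and S: "subspace S" "S \<noteq> {0}" "f ` S \<subseteq> S"
  obtains v \<mu> where "v \<in> S" "norm v = 1" "f v = \<mu> *\<^sub>R v"
proof -
  let ?K = "S \<inter> sphere 0 1"
  from S obtain u where u: "u \<in> S" "u \<noteq> 0" using subspace_0 by blast
  then have "(1 / norm u) *\<^sub>R u \<in> ?K"
    using S(1) by (simp add: subspace_scale)
  then have ne: "?K \<noteq> {}" by blast
  have co: "compact ?K"
    using closed_subspace[OF S(1)] by (simp add: closed_Int_compact)
  have cont: "continuous_on ?K (\<lambda>x. f x \<bullet> x)"
    using lin by (intro continuous_intros linear_continuous_on) (simp add: linear_conv_bounded_linear)
  from continuous_attains_sup[OF co ne cont] obtain v where v: "v \<in> ?K"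
    and mx: "\<And>x. x \<in> ?K \<Longrightarrow> f x \<bullet> x \<le> f v \<bullet> v" by blast
  define \<mu> where "\<mu> = f v \<bullet> v"
  have nv: "v \<bullet> v = 1" using v by (simp add: norm_eq_1)
  have g: "0 \<le> \<mu> * (x \<bullet> x) - f x \<bullet> x" if x: "x \<in> S" for x
  proof (cases "x = 0")
    case True
    then show ?thesis using lin by (simp add: linear_0)
  next
    case False
    let ?y = "(1 / norm x) *\<^sub>R x"
    have "?y \<in> ?K" using x False S(1) by (simp add: subspace_scale)
    then have "f ?y \<bullet> ?y \<le> \<mu>" using mx \<mu>_def by blast
    moreover have "f ?y \<bullet> ?y = (f x \<bullet> x) / (x \<bullet> x)"
      unfolding linear_scale[OF lin] dot_square_norm power2_eq_square by simp
    ultimately have "(f x \<bullet> x) / (x \<bullet> x) \<le> \<mu>" by simp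
    then show ?thesis using False by (simp add: divide_simps)
  qed
  define z where "z = \<mu> *\<^sub>R v - f v"
  have zS: "z \<in> S" unfolding z_def using v S by (auto intro!: subspace_diff subspace_scale)
  \<comment> \<open>This is the nonnegative form at \<open>v + t *\<^sub>R z\<close>, where the
    constant term has dropped out.\<close>
  have pz: "0 \<le> t * (2 * (z \<bullet> z)) + t\<^sup>2 * (\<mu> * (z \<bullet> z) - f z \<bullet> z)" for t
  proof -
    have e1: "f (v + t *\<^sub>R z) = f v + t *\<^sub>R f z"
      using lin by (simp add: linear_add linear_scale)
    have e2: "f z \<bullet> v = f v \<bullet> z" using sa by (simp add: inner_commute)
    have "0 \<le> \<mu> * ((v + t *\<^sub>R z) \<bullet> (v + t *\<^sub>R z)) - f (v + t *\<^sub>R z) \<bullet> (v + t *\<^sub>R z)"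
      by (rule g) (use v zS S(1) in \<open>auto intro!: subspace_add subspace_scale\<close>)
    also have "\<dots> = t * (2 * ((\<mu> *\<^sub>R v - f v) \<bullet> z)) + t\<^sup>2 * (\<mu> * (z \<bullet> z) - f z \<bullet> z)"
      unfolding e1 using e2 nv
      by (simp add: algebra_simps inner_commute power2_eq_square \<mu>_def)
    finally show ?thesis by (simp add: z_def)
  qed
  have "z \<bullet> z = 0"
  proof (rule ccontr)
    assume "z \<bullet> z \<noteq> 0"
    then have zp: "z \<bullet> z > 0" by simp
    define c where "c = \<mu> * (z \<bullet> z) - f z \<bullet> z"
    have c0: "0 \<le> c" using g[OF zS] c_def by simp
    \<comment> \<open>For small negative \<open>t\<close> the linear term outweighs the quadratic
      one. The summand 1 keeps the quotient defined when \<open>c = 0\<close>.\<close>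
    define t where "t = - (z \<bullet> z) / (c + 1)"
    have "0 \<le> t * (2 * (z \<bullet> z) + t * c)" using pz[of t] by (simp add: c_def power2_eq_square algebra_simps)
    moreover have "t < 0" using zp c0 by (simp add: t_def field_simps)
    ultimately have "2 * (z \<bullet> z) + t * c \<le> 0" by (simp add: zero_le_mult_iff)
    moreover have "t * c \<ge> - (z \<bullet> z)" using c0 zp by (simp add: t_def field_simps)
    ultimately show False using zp by linarith
  qed
  then have "f v = \<mu> *\<^sub>R v" by (simp add: z_def)
  then show thesis using that v by auto
qed

text \<open>Induction on the dimension: the orthogonal complement of an eigenvector in
  \<open>S\<close> is again invariant, by symmetry of \<open>f\<close>.\<close>

lemma selfadjoint_eigenbasis_subspace:
  fixes f :: "'a::euclidean_space \<Rightarrow> 'a"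
  assumes lin: "linear f" and sa: "\<And>x y. f x \<bullet> y = x \<bullet> f y"
  shows "subspace S \<Longrightarrow> f ` S \<subseteq> S \<Longrightarrow>
    \<exists>B. finite B \<and> pairwise orthogonal B \<and> (\<forall>b\<in>B. norm b = 1 \<and> (\<exists>\<mu>. f b = \<mu> *\<^sub>R b)) \<and> span B = S"
proof (induction "dim S" arbitrary: S rule: less_induct)
  case less
  show ?case
  proof (cases "S = {0}")
    case True
    then show ?thesis by (intro exI[of _ "{}"]) auto
  next
    case False
    from selfadjoint_eigenvector[OF lin sa less.prems(1) False less.prems(2)] obtain v \<mu>
      where v: "v \<in> S" "norm v = 1" "f v = \<mu> *\<^sub>R v" .
    define T where "T = S \<inter> {x. v \<bullet> x = 0}"
    have subT: "subspace T"
      unfolding T_def using less.prems(1) by (intro subspace_inter subspace_hyperplane) auto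
    have "v \<notin> T" using v by (auto simp: T_def)
    moreover have "T \<subseteq> S" by (auto simp: T_def)
    ultimately have "T \<subset> S" using v by blast
    then have dimT: "dim T < dim S"
      by (metis dim_psubset less.prems(1) span_eq_iff subT)
    have invT: "f ` T \<subseteq> T"
    proof
      fix y assume "y \<in> f ` T"
      then obtain x where x: "x \<in> T" "y = f x" by blast
      have "v \<bullet> f x = f v \<bullet> x" using sa by simp
      then show "y \<in> T" using x less.prems(2) v by (auto simp: T_def)
    qed
    from less.hyps[OF dimT subT invT] obtain B where B: "finite B" "pairwise orthogonal B"
      "\<And>b. b \<in> B \<Longrightarrow> norm b = 1 \<and> (\<exists>\<mu>. f b = \<mu> *\<^sub>R b)" "span B = T" by blast
    have BT: "B \<subseteq> T" using B(4) span_superset by blast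
    have "span (insert v B) = S"
    proof
      show "span (insert v B) \<subseteq> S"
        using BT v less.prems(1) by (intro span_minimal) (auto simp: T_def)
      show "S \<subseteq> span (insert v B)"
      proof
        fix x assume x: "x \<in> S"
        have "x - (v \<bullet> x) *\<^sub>R v \<in> T"
          using x v less.prems(1)
          by (auto simp: T_def inner_diff_right norm_eq_1 intro!: subspace_diff subspace_scale)
        then show "x \<in> span (insert v B)"
          unfolding span_insert B(4) by blast
      qed
    qed
    moreover have "pairwise orthogonal (insert v B)"
      using B(2) BT by (auto simp: pairwise_insert T_def orthogonal_def inner_commute)
    ultimately show ?thesis
      using B v by (intro exI[of _ "insert v B"]) auto
  qed
qed

text \<open>An orthonormal eigenbasis recorded through its Parseval and expansion formulas, so that
  later arguments are coordinatewise sums. It is also applied to complex vectors, viewed as a real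
  Euclidean space.\<close>

definition eigenbasis :: "('a::euclidean_space \<Rightarrow> 'a) \<Rightarrow> 'a set \<Rightarrow> ('a \<Rightarrow> real) \<Rightarrow> bool" where
  "eigenbasis f B l \<longleftrightarrow> finite B \<and> (\<forall>x y. x \<bullet> y = (\<Sum>b\<in>B. (x \<bullet> b) * (y \<bullet> b))) \<and>
     (\<forall>x. x = (\<Sum>b\<in>B. (x \<bullet> b) *\<^sub>R b)) \<and>
     (\<forall>b\<in>B. f b = l b *\<^sub>R b \<and> norm b = 1 \<and> (\<forall>x. f x \<bullet> b = l b * (x \<bullet> b)))"

lemma eigenbasisD:
  assumes "eigenbasis f B l"
  shows "finite B" "x \<bullet> y = (\<Sum>b\<in>B. (x \<bullet> b) * (y \<bullet> b))" "x = (\<Sum>b\<in>B. (x \<bullet> b) *\<^sub>R b)"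
    "b \<in> B \<Longrightarrow> f b = l b *\<^sub>R b" "b \<in> B \<Longrightarrow> norm b = 1" "b \<in> B \<Longrightarrow> f x \<bullet> b = l b * (x \<bullet> b)"
  using assms unfolding eigenbasis_def by blast+

lemma selfadjoint_eigenbasis:
  fixes f :: "'a::euclidean_space \<Rightarrow> 'a"
  assumes lin: "linear f" and sa: "\<And>x y. f x \<bullet> y = x \<bullet> f y"
  obtains B l where "eigenbasis f B l"
proof -
  from selfadjoint_eigenbasis_subspace[OF assms, of UNIV]
  obtain B where B: "finite B" "pairwise orthogonal B"
    "\<And>b. b \<in> B \<Longrightarrow> norm b = 1 \<and> (\<exists>\<mu>. f b = \<mu> *\<^sub>R b)" "span B = UNIV" by auto
  then obtain l where l: "\<And>b. b \<in> B \<Longrightarrow> f b = l b *\<^sub>R b" by metis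
  have ex: "x = (\<Sum>b\<in>B. (x \<bullet> b) *\<^sub>R b)" for x
  proof -
    have "(\<Sum>b\<in>B. (b \<bullet> x) *\<^sub>R b) = x"
    proof -
      have ob: "orthogonal ((\<Sum>b\<in>B. (b \<bullet> x) *\<^sub>R b) - x) z" for z
      proof (rule orthogonal_to_span[of _ B])
        show "z \<in> span B" using B(4) by simp
        fix c assume c: "c \<in> B"
        have "(\<Sum>b\<in>B. (b \<bullet> x) * (b \<bullet> c)) = (\<Sum>b\<in>B. if b = c then c \<bullet> x else 0)"
          using B c by (intro sum.cong) (auto simp: pairwise_def orthogonal_def norm_eq_1)
        then show "orthogonal ((\<Sum>b\<in>B. (b \<bullet> x) *\<^sub>R b) - x) c"
          using B(1) c by (simp add: orthogonal_def inner_diff_left inner_sum_left inner_commute[of x])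
      qed
      from ob[of "(\<Sum>b\<in>B. (b \<bullet> x) *\<^sub>R b) - x"] show ?thesis by (simp add: orthogonal_def)
    qed
    then show ?thesis by (simp add: inner_commute)
  qed
  have pa: "x \<bullet> y = (\<Sum>b\<in>B. (x \<bullet> b) * (y \<bullet> b))" for x y
    using arg_cong[OF ex[of x], of "\<lambda>z. z \<bullet> y"] by (simp add: inner_sum_left inner_commute[of y])
  have "f b = l b *\<^sub>R b \<and> norm b = 1 \<and> (\<forall>x. f x \<bullet> b = l b * (x \<bullet> b))" if "b \<in> B" for b
    using B(3) l sa that by auto
  then have "eigenbasis f B l"
    unfolding eigenbasis_def using B(1) pa ex by blast
  then show thesis by (rule that)
qed

lemma selfadjoint_norm_le:
  fixes f :: "'a::euclidean_space \<Rightarrow> 'a"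
  assumes lin: "linear f" and sa: "\<And>x y. f x \<bullet> y = x \<bullet> f y"
    and ev: "\<And>v \<mu>. v \<noteq> 0 \<Longrightarrow> f v = \<mu> *\<^sub>R v \<Longrightarrow> \<bar>\<mu>\<bar> \<le> w" and w: "0 \<le> w"
  shows "norm (f x) \<le> w * norm x"
proof -
  from selfadjoint_eigenbasis[OF lin sa] obtain B l where eb: "eigenbasis f B l" .
  note B = eigenbasisD[OF eb]
  have "f x \<bullet> f x = (\<Sum>b\<in>B. (l b)\<^sup>2 * (x \<bullet> b)\<^sup>2)"
    by (subst B(2)) (auto simp: B(6) power2_eq_square intro!: sum.cong)
  also have "\<dots> \<le> (\<Sum>b\<in>B. w\<^sup>2 * (x \<bullet> b)\<^sup>2)"
  proof (intro sum_mono mult_right_mono)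
    fix b assume b: "b \<in> B"
    have "\<bar>l b\<bar> \<le> w" using ev[of b "l b"] B(4,5)[OF b] by force
    then show "(l b)\<^sup>2 \<le> w\<^sup>2" using w by (simp add: abs_le_square_iff[symmetric])
  qed auto
  also have "\<dots> = w\<^sup>2 * (x \<bullet> x)"
    by (subst B(2)[of x x]) (simp add: sum_distrib_left power2_eq_square)
  finally have "(norm (f x))\<^sup>2 \<le> (w * norm x)\<^sup>2" by (simp add: power2_norm_eq_inner power_mult_distrib)
  then show ?thesis by (rule power2_le_imp_le) (use w in simp)
qed

text \<open>Orthogonality to the kernel removes the coordinates with eigenvalue zero; in every other
  coordinate \<open>f\<close> stretches by at least \<open>w\<close>.\<close>

lemma selfadjoint_norm_ge:
  fixes f :: "'a::euclidean_space \<Rightarrow> 'a"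
  assumes lin: "linear f" and sa: "\<And>x y. f x \<bullet> y = x \<bullet> f y"
    and ev: "\<And>v \<mu>. v \<noteq> 0 \<Longrightarrow> f v = \<mu> *\<^sub>R v \<Longrightarrow> \<mu> \<noteq> 0 \<Longrightarrow> w \<le> \<bar>\<mu>\<bar>" and w: "0 \<le> w"
    and x: "\<And>k. f k = 0 \<Longrightarrow> x \<bullet> k = 0"
  shows "w * norm x \<le> norm (f x)"
proof -
  from selfadjoint_eigenbasis[OF lin sa] obtain B l where eb: "eigenbasis f B l" .
  note B = eigenbasisD[OF eb]
  have "w\<^sup>2 * (x \<bullet> x) = (\<Sum>b\<in>B. w\<^sup>2 * (x \<bullet> b)\<^sup>2)"
    by (subst B(2)) (simp add: sum_distrib_left power2_eq_square)
  also have "\<dots> \<le> (\<Sum>b\<in>B. (l b)\<^sup>2 * (x \<bullet> b)\<^sup>2)"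
  proof (intro sum_mono)
    fix b assume b: "b \<in> B"
    show "w\<^sup>2 * (x \<bullet> b)\<^sup>2 \<le> (l b)\<^sup>2 * (x \<bullet> b)\<^sup>2"
    proof (cases "l b = 0")
      case True
      then show ?thesis using x[of b] B(4)[OF b] by simp
    next
      case False
      then have "w \<le> \<bar>l b\<bar>" using ev[of b "l b"] B(4,5)[OF b] by force
      then have "w\<^sup>2 \<le> (l b)\<^sup>2" using w by (simp add: abs_le_square_iff[symmetric])
      then show ?thesis by (intro mult_right_mono) auto
    qed
  qed
  also have "\<dots> = f x \<bullet> f x"
    by (subst B(2)) (auto simp: B(6) power2_eq_square intro!: sum.cong)
  finally have "(w * norm x)\<^sup>2 \<le> (norm (f x))\<^sup>2" by (simp add: power2_norm_eq_inner power_mult_distrib)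
  then show ?thesis by (rule power2_le_imp_le) simp
qed

lemma selfadjoint_zero:
  fixes f :: "'a::euclidean_space \<Rightarrow> 'a"
  assumes "linear f" "\<And>x y. f x \<bullet> y = x \<bullet> f y"
    and "\<And>v \<mu>. v \<noteq> 0 \<Longrightarrow> f v = \<mu> *\<^sub>R v \<Longrightarrow> \<mu> = 0"
  shows "f x = 0"
proof -
  have "norm (f x) \<le> 0 * norm x"
  proof (rule selfadjoint_norm_le[OF assms(1,2)])
    fix v \<mu> assume "v \<noteq> 0" "f v = \<mu> *\<^sub>R v"
    from assms(3)[OF this] show "\<bar>\<mu>\<bar> \<le> 0" by simp
  qed simp
  then show ?thesis by simp
qed

section \<open>Matrix square roots\<close>

lemma matrix_selfadjoint:
  fixes M :: "real^'n^'n"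
  assumes "transpose M = M"
  shows "(M *v x) \<bullet> y = x \<bullet> (M *v y)"
  by (metis assms dot_lmul_matrix transpose_matrix_vector)

text \<open>The root scales each eigencoordinate by the square root of its eigenvalue.\<close>

lemma pos_semidef_sqrt_exists:
  fixes M :: "real^'n^'n"
  assumes "pos_semidef M"
  shows "\<exists>S. pos_semidef S \<and> S ** S = M"
proof -
  have tr: "transpose M = M" and ps: "\<And>x. 0 \<le> x \<bullet> (M *v x)"
    using assms by (auto simp: pos_semidef_def)
  from selfadjoint_eigenbasis[OF matrix_vector_mul_linear matrix_selfadjoint[OF tr]] obtain B l where eb: "eigenbasis ((*v) M) B l" .
  note B = eigenbasisD[OF eb]
  have l0: "0 \<le> l b" if "b \<in> B" for b
    using ps[of b] B(4,5)[OF that] by (simp add: norm_eq_1)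
  define g where "g = (\<lambda>x. \<Sum>b\<in>B. (sqrt (l b) * (x \<bullet> b)) *\<^sub>R b)"
  have lin: "linear g"
    unfolding g_def by (rule linearI) (auto simp: algebra_simps sum.distrib scaleR_sum_right)
  have gi: "g x \<bullet> y = (\<Sum>b\<in>B. sqrt (l b) * (x \<bullet> b) * (y \<bullet> b))" for x y
    unfolding g_def by (simp add: inner_sum_left inner_commute[of y])
  have gsa: "g x \<bullet> y = x \<bullet> g y" for x y
    by (subst inner_commute[of x]) (simp add: gi mult_ac)
  have gb: "g x \<bullet> b = sqrt (l b) * (x \<bullet> b)" if b: "b \<in> B" for x b
  proof -
    have "g b = sqrt (l b) *\<^sub>R b"
    proof -
      \<comment> \<open>Either the two eigenvalues agree or the eigenvectors are orthogonal.\<close>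
      have "(sqrt (l c) * (b \<bullet> c) = sqrt (l b) * (b \<bullet> c))" if "c \<in> B" for c
      proof -
        have "l b * (b \<bullet> c) = l c * (b \<bullet> c)"
          using B(6)[OF that, of b] B(4)[OF b] by simp
        then show ?thesis by auto
      qed
      then have "g b = (\<Sum>c\<in>B. (sqrt (l b) * (b \<bullet> c)) *\<^sub>R c)"
        unfolding g_def by (intro sum.cong) auto
      also have "\<dots> = sqrt (l b) *\<^sub>R (\<Sum>c\<in>B. (b \<bullet> c) *\<^sub>R c)" by (simp add: scaleR_sum_right)
      finally show ?thesis using B(3)[of b] by simp
    qed
    then show ?thesis using gsa[of x b] by simp
  qed
  let ?S = "matrix g"
  have Sv: "?S *v x = g x" for x using lin by (simp add: matrix_works)
  have "transpose ?S = ?S"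
  proof -
    have "(transpose ?S *v x) \<bullet> y = (?S *v x) \<bullet> y" for x y
      by (metis Sv dot_lmul_matrix gsa transpose_matrix_vector)
    then have "transpose ?S *v x = ?S *v x" for x by (meson vector_eq_rdot)
    then show ?thesis by (simp add: matrix_eq)
  qed
  moreover have "0 \<le> x \<bullet> (?S *v x)" for x
    unfolding Sv inner_commute[of x] gi by (intro sum_nonneg) (simp add: l0 mult.assoc)
  moreover have "?S ** ?S = M"
  proof -
    have "g (g x) \<bullet> y = (M *v x) \<bullet> y" for x y
      by (subst (1 2) B(2), intro sum.cong) (simp_all add: gb B(6) l0 flip: mult.assoc)
    then have "g (g x) = M *v x" for x by (meson vector_eq_rdot)
    then show ?thesis by (simp add: matrix_eq Sv flip: matrix_vector_mul_assoc)
  qed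
  ultimately show ?thesis by (auto simp: pos_semidef_def)
qed

text \<open>\<open>matrix_sqrt\<close> is a definite description, so uniqueness of the root has to
  be proved along with existence.\<close>

lemma pos_def_sqrt:
  fixes M :: "real^'n^'n"
  assumes M: "pos_def M"
  shows "pos_def (matrix_sqrt M)" and "matrix_sqrt M ** matrix_sqrt M = M"
proof -
  \<comment> \<open>With \<open>T\<close> a root of \<open>S\<close>,
    \<open>x \<bullet> (S *v x)\<close> is the squared norm of \<open>T *v x\<close>. If it
    vanishes, then \<open>S *v x\<close> and hence \<open>M *v x\<close> vanish too.\<close>
  have pd: "pos_def S" if S: "pos_semidef S" "S ** S = M" for S
  proof -
    have "x \<bullet> (S *v x) \<noteq> 0" if x: "x \<noteq> 0" for x
    proof
      assume z: "x \<bullet> (S *v x) = 0"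
      have trS: "transpose S = S" and ps: "\<And>x. 0 \<le> x \<bullet> (S *v x)" using S by (auto simp: pos_semidef_def)
      from pos_semidef_sqrt_exists[OF S(1)] obtain T where T: "pos_semidef T" "T ** T = S" by blast
      have "(T *v x) \<bullet> (T *v x) = x \<bullet> (S *v x)"
        using T matrix_selfadjoint[of T] by (metis matrix_vector_mul_assoc pos_semidef_def)
      then have "T *v x = 0" using z by simp
      then have "S *v x = 0" by (metis T(2) matrix_vector_mul_assoc matrix_vector_mult_0_right)
      then have "M *v x = 0" by (metis S(2) matrix_vector_mul_assoc matrix_vector_mult_0_right)
      then show False using M x by (auto simp: pos_def_def)
    qed
    then show ?thesis using S(1) unfolding pos_def_def pos_semidef_def
      by (metis order_le_less)
  qed
  have uniq: "S = T" if S: "pos_semidef S" "S ** S = M" and T: "pos_semidef T" "T ** T = M" for S T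
  proof -
    let ?D = "S - T"
    have trD: "transpose ?D = ?D"
      using S T by (simp add: pos_semidef_def transpose_def vec_eq_iff)
    note psd = pd[OF S] pd[OF T]
    have "?D *v x = 0" for x
    proof (rule selfadjoint_zero[of "(*v) ?D"])
      show "linear ((*v) ?D)" by simp
      show "(?D *v x) \<bullet> y = x \<bullet> (?D *v y)" for x y by (rule matrix_selfadjoint[OF trD])
      fix v \<mu> assume v: "v \<noteq> 0" "?D *v v = \<mu> *\<^sub>R v"
      \<comment> \<open>The identity S (S - T) + (S - T) T = S S - T T holds without commutativity.
        Pairing it with an eigenvector of \<open>?D\<close> gives the eigenvalue times a positive
        number.\<close>
      have "S *v (?D *v v) + ?D *v (T *v v) = (S ** S) *v v - (T ** T) *v v"
        by (simp only: matrix_vector_mult_diff_distrib matrix_vector_mult_diff_rdistrib flip: matrix_vector_mul_assoc) simp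
      also have "\<dots> = 0" using S T by simp
      finally have "v \<bullet> (S *v (?D *v v)) + v \<bullet> (?D *v (T *v v)) = 0"
        by (metis inner_add_right inner_zero_right)
      moreover have "v \<bullet> (?D *v (T *v v)) = (?D *v v) \<bullet> (T *v v)"
        by (simp only: matrix_selfadjoint[OF trD])
      ultimately have "\<mu> * (v \<bullet> (S *v v) + v \<bullet> (T *v v)) = 0"
        unfolding v(2) by (simp add: matrix_vector_mult_scaleR algebra_simps)
      moreover have "v \<bullet> (S *v v) + v \<bullet> (T *v v) > 0"
        using psd v by (simp add: pos_def_def add_pos_pos)
      ultimately show "\<mu> = 0" by simp
    qed
    then have "S *v x = T *v x" for x by (metis matrix_vector_mult_diff_rdistrib eq_iff_diff_eq_0)
    then show ?thesis by (simp add: matrix_eq)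
  qed
  have "pos_semidef M" using M unfolding pos_def_def pos_semidef_def
    by (metis inner_zero_left order_le_less)
  then have "\<exists>!S. pos_semidef S \<and> S ** S = M"
    using pos_semidef_sqrt_exists uniq by blast
  from theI'[OF this] have *: "pos_semidef (matrix_sqrt M)" "matrix_sqrt M ** matrix_sqrt M = M"
    by (auto simp: matrix_sqrt_def)
  show "matrix_sqrt M ** matrix_sqrt M = M" by (rule *(2))
  show "pos_def (matrix_sqrt M)" by (rule pd[OF *])
qed

lemma pos_def_inv:
  fixes M :: "real^'n^'n"
  assumes M: "pos_def M"
  shows "matrix_inv M ** M = mat 1" "M ** matrix_inv M = mat 1"
    "transpose (matrix_inv M) = matrix_inv M"
proof -
  have "M *v x = 0 \<Longrightarrow> x = 0" for x using M by (auto simp: pos_def_def)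
  then have inv: "invertible M"
    by (simp add: invertible_left_inverse matrix_left_invertible_ker)
  show 1: "matrix_inv M ** M = mat 1" and 2: "M ** matrix_inv M = mat 1"
  proof -
    obtain M' where "M ** M' = mat 1" "M' ** M = mat 1" using inv by (auto simp: invertible_def)
    then have "\<exists>A'. M ** A' = mat 1 \<and> A' ** M = mat 1" by blast
    from someI_ex[OF this] show "matrix_inv M ** M = mat 1" "M ** matrix_inv M = mat 1"
      by (simp_all add: matrix_inv_def)
  qed
  have "transpose (matrix_inv M) ** M = mat 1"
    using 2 M by (metis matrix_transpose_mul pos_def_def transpose_mat)
  then show "transpose (matrix_inv M) = matrix_inv M"
    by (metis 2 matrix_mul_assoc matrix_mul_lid matrix_mul_rid)
qed

section \<open>Root subspaces\<close>

definition shift :: "complex^'m^'m \<Rightarrow> complex \<Rightarrow> complex^'m \<Rightarrow> complex^'m" where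
  "shift A \<zeta> v = A *v v - \<zeta> *s v"

text \<open>Vectors annihilated by some product of factors A - z with z in \<open>Z\<close>. Listing
  the factors allows induction on one factor at a time;
  \<open>gen_eigenspace_sum_eq_root_space\<close> identifies these spaces with the sums of
  generalized eigenspaces.\<close>

definition root_space :: "complex^'m^'m \<Rightarrow> complex set \<Rightarrow> (complex^'m) set" where
  "root_space A Z = {v. \<exists>zs. set zs \<subseteq> Z \<and> fold (shift A) zs v = 0}"

lemma shift_simps [simp]:
  "shift A \<zeta> 0 = 0" "shift A \<zeta> (x + y) = shift A \<zeta> x + shift A \<zeta> y"
  "shift A \<zeta> (x - y) = shift A \<zeta> x - shift A \<zeta> y"
  "shift A \<zeta> (c *s x) = c *s shift A \<zeta> x"
  by (simp_all add: shift_def vec.add vec.diff vec.scale vec.scale_right_distrib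
      vec.scale_right_diff_distrib mult.commute)

lemma shift_commute: "shift A \<zeta> (shift A \<xi> v) = shift A \<xi> (shift A \<zeta> v)"
  by (simp add: shift_def vec.diff vec.scale vec.scale_right_diff_distrib mult.commute)

lemma fold_shift_simps [simp]:
  "fold (shift A) zs 0 = 0"
  "fold (shift A) zs (x + y) = fold (shift A) zs x + fold (shift A) zs y"
  "fold (shift A) zs (c *s x) = c *s fold (shift A) zs x"
  by (induction zs arbitrary: x y) simp_all

lemma fold_shift_commute: "fold (shift A) zs (shift A \<zeta> v) = shift A \<zeta> (fold (shift A) zs v)"
  by (induction zs arbitrary: v) (simp_all add: shift_commute[of A _ \<zeta>])

lemma fold_shift_swap: "fold (shift A) zs (fold (shift A) ws v) = fold (shift A) ws (fold (shift A) zs v)"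
  by (induction ws arbitrary: v) (simp_all add: fold_shift_commute)

lemma subspace_root_space: "vec.subspace (root_space A Z)"
proof (rule vec.subspaceI)
  show "0 \<in> root_space A Z" by (auto simp: root_space_def intro!: exI[of _ "[]"])
next
  fix x y assume "x \<in> root_space A Z" "y \<in> root_space A Z"
  then obtain xs ys where "set xs \<subseteq> Z" "fold (shift A) xs x = 0" "set ys \<subseteq> Z" "fold (shift A) ys y = 0"
    by (auto simp: root_space_def)
  then show "x + y \<in> root_space A Z"
    by (auto simp: root_space_def fold_shift_swap[of A ys xs] intro!: exI[of _ "xs @ ys"])
next
  fix c x assume "x \<in> root_space A Z"
  then show "c *s x \<in> root_space A Z" by (auto simp: root_space_def)
qed

lemma root_space_mono: "Z \<subseteq> W \<Longrightarrow> root_space A Z \<subseteq> root_space A W"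
  by (auto simp: root_space_def)

lemma root_space_shift: "v \<in> root_space A Z \<Longrightarrow> shift A \<zeta> v \<in> root_space A Z"
  by (auto simp: root_space_def fold_shift_commute)

lemma root_space_shiftD:
  assumes "shift A \<zeta> v \<in> root_space A Z" "\<zeta> \<in> Z"
  shows "v \<in> root_space A Z"
proof -
  obtain zs where "set zs \<subseteq> Z" "fold (shift A) zs (shift A \<zeta> v) = 0"
    using assms(1) by (auto simp: root_space_def)
  then have "set (\<zeta> # zs) \<subseteq> Z \<and> fold (shift A) (\<zeta> # zs) v = 0" using assms(2) by simp
  then show ?thesis unfolding root_space_def by blast
qed

lemma root_space_eigenvector:
  assumes "v \<in> root_space A Z" "A *v v = \<zeta> *s v" "v \<noteq> 0"
  shows "\<zeta> \<in> Z"
proof -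
  obtain zs where zs: "set zs \<subseteq> Z" "fold (shift A) zs v = 0"
    using assms(1) by (auto simp: root_space_def)
  have "fold (shift A) zs v = (\<Prod>z\<leftarrow>zs. \<zeta> - z) *s v" for zs
  proof (induction zs)
    case (Cons z zs)
    have sh: "shift A z v = (\<zeta> - z) *s v" by (simp add: shift_def assms vec.scale_left_diff_distrib)
    show ?case unfolding fold_Cons comp_apply sh fold_shift_simps Cons.IH by simp
  qed simp
  then have "\<zeta> \<in> set zs" using zs(2) assms(3) by (auto simp: prod_list_zero_iff)
  then show ?thesis using zs by blast
qed

text \<open>Removing one factor z, the induction hypothesis annihilates \<open>shift A z v\<close>.
  A nonzero \<open>v\<close> would then be an eigenvector whose eigenvalue lies in both
  sets.\<close>

lemma root_space_disjoint:
  assumes "v \<in> root_space A Z" "v \<in> root_space A W" "Z \<inter> W = {}"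
  shows "v = 0"
proof -
  obtain zs where zs: "set zs \<subseteq> Z" "fold (shift A) zs v = 0"
    using assms(1) by (auto simp: root_space_def)
  from zs assms(2) show "v = 0"
  proof (induction zs arbitrary: v)
    case (Cons z zs)
    then have "shift A z v = 0"
      using Cons.IH[of "shift A z v"] root_space_shift[OF Cons.prems(3), of z] by simp
    then have "A *v v = z *s v" by (simp add: shift_def)
    then show ?case
      using root_space_eigenvector[OF Cons.prems(3), of z] Cons.prems(1) assms(3) by auto
  qed simp
qed

lemma root_space_shift_surj:
  assumes "y \<in> root_space A Z" "\<zeta> \<notin> Z"
  shows "\<exists>x\<in>root_space A Z. shift A \<zeta> x = y"
proof -
  obtain zs where zs: "set zs \<subseteq> Z" "fold (shift A) zs y = 0"
    using assms(1) by (auto simp: root_space_def)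
  from zs assms(1) show ?thesis
  proof (induction zs arbitrary: y)
    case Nil
    then show ?case by (intro bexI[of _ 0]) simp_all
  next
    case (Cons z zs)
    then obtain w where w: "w \<in> root_space A Z" "shift A \<zeta> w = shift A z y"
      using Cons.IH[of "shift A z y"] root_space_shift[OF Cons.prems(3), of z] by auto
    have zn: "z - \<zeta> \<noteq> 0" using Cons.prems assms(2) by auto
    \<comment> \<open>Two shifts of \<open>y\<close> differ only by a multiple of \<open>y\<close>,
      so the preimage of \<open>shift A z y\<close> yields one of \<open>y\<close>.\<close>
    have "shift A \<zeta> (y - w) = (z - \<zeta>) *s y"
      by (simp add: w) (simp add: shift_def vec.scale_left_diff_distrib)
    then have "shift A \<zeta> ((1 / (z - \<zeta>)) *s (y - w)) = y"
      using zn by (simp only: shift_simps(4) vec.scale_scale) simp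
    moreover have "(1 / (z - \<zeta>)) *s (y - w) \<in> root_space A Z"
      using w Cons.prems subspace_root_space by (intro vec.subspace_scale vec.subspace_diff) auto
    ultimately show ?case by blast
  qed
qed

text \<open>Induction on the factors: the component of \<open>shift A z v\<close> in the space whose
  set misses z is lifted through the shift. Subtracting the lift from \<open>v\<close> leaves a
  vector of the other space.\<close>

lemma root_space_split:
  assumes "v \<in> root_space A (Z \<union> W)" "Z \<inter> W = {}"
  obtains x y where "x \<in> root_space A Z" "y \<in> root_space A W" "v = x + y"
proof -
  obtain zs where zs: "set zs \<subseteq> Z \<union> W" "fold (shift A) zs v = 0"
    using assms(1) by (auto simp: root_space_def)
  note sub = subspace_root_space
  from zs have "\<exists>x\<in>root_space A Z. \<exists>y\<in>root_space A W. v = x + y"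
  proof (induction zs arbitrary: v)
    case Nil
    then have "v = 0 + 0" by simp
    then show ?case using vec.subspace_0[OF sub] by blast
  next
    case (Cons z zs)
    then have "\<exists>x\<in>root_space A Z. \<exists>y\<in>root_space A W. shift A z v = x + y"
      by (intro Cons.IH) simp_all
    then obtain x y where xy: "x \<in> root_space A Z" "y \<in> root_space A W" "shift A z v = x + y"
      by blast
    show ?case
    proof (cases "z \<in> Z")
      case True
      then obtain u where u: "u \<in> root_space A W" "shift A z u = y"
        using root_space_shift_surj[OF xy(2)] assms(2) by blast
      have "shift A z (v - u) = x" using u xy by simp
      then have "v - u \<in> root_space A Z" using root_space_shiftD[of A z "v - u" Z] xy(1) True by simp
      moreover have "v = (v - u) + u" by simp
      ultimately show ?thesis using u(1) by blast
    next
      case False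
      then have zW: "z \<in> W" using Cons.prems by auto
      obtain u where u: "u \<in> root_space A Z" "shift A z u = x"
        using root_space_shift_surj[OF xy(1) False] by blast
      have "shift A z (v - u) = y" using u xy by simp
      then have "v - u \<in> root_space A W" using root_space_shiftD[of A z "v - u" W] xy(2) zW by simp
      moreover have "v = u + (v - u)" by simp
      ultimately show ?thesis using u(1) by blast
    qed
  qed
  then show thesis using that by blast
qed

lemma root_space_nonzero_spectrum:
  assumes "v \<in> root_space A Z" "v \<noteq> 0"
  shows "Z \<inter> spectrum A \<noteq> {}"
proof -
  obtain zs where zs: "set zs \<subseteq> Z" "fold (shift A) zs v = 0"
    using assms(1) by (auto simp: root_space_def)
  from zs assms(2) show ?thesis
  proof (induction zs arbitrary: v)
    case (Cons z zs)
    show ?case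
    proof (cases "shift A z v = 0")
      case True
      then show ?thesis using Cons.prems by (auto simp: shift_def spectrum_on_def)
    next
      case False
      then show ?thesis using Cons by auto
    qed
  qed simp
qed

text \<open>Points outside the spectrum contribute only the zero vector, so only the eigenvalues in
  \<open>Z\<close> matter.\<close>

lemma root_space_spectrum_cong:
  assumes "Z \<inter> spectrum A \<subseteq> W"
  shows "root_space A Z \<subseteq> root_space A W"
proof
  fix v assume "v \<in> root_space A Z"
  moreover have "(Z \<inter> spectrum A) \<union> (Z - spectrum A) = Z" by blast
  ultimately have "v \<in> root_space A ((Z \<inter> spectrum A) \<union> (Z - spectrum A))" by simp
  from root_space_split[OF this] obtain x y where xy: "x \<in> root_space A (Z \<inter> spectrum A)"
    "y \<in> root_space A (Z - spectrum A)" "v = x + y" by blast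
  have "y = 0" using root_space_nonzero_spectrum[OF xy(2)] by blast
  then show "v \<in> root_space A W" using xy root_space_mono[OF assms] by auto
qed

section \<open>Completeness of the root vectors\<close>

definition poly_act :: "complex^'m^'m \<Rightarrow> nat \<Rightarrow> complex poly \<Rightarrow> complex^'m \<Rightarrow> complex^'m" where
  "poly_act A n p v = (\<Sum>i<n. coeff p i *s ((*v) A ^^ i) v)"

lemma funpow_matrix_shift:
  "((*v) A ^^ i) (shift A \<zeta> v) = ((*v) A ^^ Suc i) v - \<zeta> *s ((*v) A ^^ i) v"
  by (induction i) (simp_all add: shift_def vec.diff vec.scale)

text \<open>\<open>poly_act A n p v\<close> is p(A) v as soon as \<open>n\<close> exceeds the
  degree. Multiplying by a linear factor needs one more term, and the vanishing coefficient closes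
  the shifted sum.\<close>

lemma poly_act_root_factor:
  assumes "coeff q n = 0"
  shows "poly_act A (Suc n) ([:- \<zeta>, 1:] * q) v = poly_act A n q (shift A \<zeta> v)"
proof -
  let ?T = "\<lambda>i. ((*v) A ^^ i) v"
  have c: "coeff ([:- \<zeta>, 1:] * q) i = (case i of 0 \<Rightarrow> 0 | Suc j \<Rightarrow> coeff q j) - \<zeta> * coeff q i" for i
    by (simp add: coeff_pCons)
  have "poly_act A (Suc n) ([:- \<zeta>, 1:] * q) v
      = (\<Sum>i<Suc n. (case i of 0 \<Rightarrow> 0 | Suc j \<Rightarrow> coeff q j) *s ?T i) - (\<Sum>i<Suc n. (\<zeta> * coeff q i) *s ?T i)"
    unfolding poly_act_def c by (simp only: vec.scale_left_diff_distrib sum_subtractf)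
  also have "(\<Sum>i<Suc n. (case i of 0 \<Rightarrow> 0 | Suc j \<Rightarrow> coeff q j) *s ?T i) = (\<Sum>i<n. coeff q i *s ?T (Suc i))"
    by (subst sum.lessThan_Suc_shift) simp
  also have "(\<Sum>i<Suc n. (\<zeta> * coeff q i) *s ?T i) = (\<Sum>i<n. (\<zeta> * coeff q i) *s ?T i)"
    using assms by simp
  finally show ?thesis
    unfolding poly_act_def funpow_matrix_shift
    by (simp add: vec.scale_right_diff_distrib sum_subtractf mult.commute)
qed

text \<open>The fundamental theorem of algebra supplies a root; splitting it off turns into one
  shift of \<open>v\<close> and lowers the degree.\<close>

lemma poly_act_annihilated:
  assumes "p \<noteq> 0" "degree p < n" "poly_act A n p v = 0"
  shows "v \<in> root_space A UNIV"
  using assms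
proof (induction n arbitrary: p v)
  case (Suc n)
  show ?case
  proof (cases "degree p = 0")
    case True
    then obtain a where a: "p = [:a:]" by (rule degree_eq_zeroE)
    have "poly_act A (Suc n) p v = a *s v"
      unfolding poly_act_def a by (subst sum.lessThan_Suc_shift) simp
    then have "v = 0" using Suc.prems a by simp
    then show ?thesis using vec.subspace_0[OF subspace_root_space] by simp
  next
    case False
    then have "\<not> constant (poly p)" by (simp add: constant_degree)
    then obtain \<zeta> where "poly p \<zeta> = 0" using fundamental_theorem_of_algebra by blast
    then obtain q where q: "p = [:- \<zeta>, 1:] * q" by (metis poly_eq_0_iff_dvd dvdE)
    have q0: "q \<noteq> 0" using q Suc.prems by auto
    have "degree p = Suc (degree q)" unfolding q using q0 by (subst degree_mult_eq) auto
    then have d: "degree q < n" using Suc.prems by simp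
    then have "poly_act A n q (shift A \<zeta> v) = 0"
      using Suc.prems(3) poly_act_root_factor[of q n A \<zeta> v] by (simp add: q coeff_eq_0)
    from Suc.IH[OF q0 d this] show ?thesis by (rule root_space_shiftD) simp
  qed
qed simp

text \<open>The iterates of \<open>v\<close> up to the dimension are linearly dependent, and the
  coefficients of a relation form a polynomial annihilating \<open>v\<close>.\<close>

lemma root_space_UNIV: "root_space (A :: complex^'m^'m) UNIV = UNIV"
proof -
  have "v \<in> root_space A UNIV" for v
  proof -
    let ?T = "\<lambda>i. ((*v) A ^^ i) v"
    let ?N = "Suc CARD('m)"
    have "\<exists>c. (\<exists>i<?N. c i \<noteq> 0) \<and> (\<Sum>i<?N. c i *s ?T i) = 0"
    \<comment> \<open>Dependence is a property of sets of vectors, so a repetition among the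
      iterates is treated separately; it is itself a relation.\<close>
    proof (cases "inj_on ?T {..<?N}")
      case True
      then have card: "card (?T ` {..<?N}) = ?N" by (simp add: card_image)
      have "vec.dependent (?T ` {..<?N})"
      proof (rule ccontr)
        assume "\<not> vec.dependent (?T ` {..<?N})"
        then have "card (?T ` {..<?N}) \<le> vec.dim (UNIV :: (complex^'m) set)"
          by (intro vec.independent_card_le_dim) auto
        then show False unfolding card vec_dim_card by simp
      qed
      then obtain u where u: "\<exists>w\<in>?T ` {..<?N}. u w \<noteq> 0" "(\<Sum>w\<in>?T ` {..<?N}. u w *s w) = 0"
        by (subst (asm) vec.dependent_finite) auto
      have "(\<Sum>i<?N. u (?T i) *s ?T i) = 0"
        using u(2) sum.reindex[OF True, of "\<lambda>w. u w *s w"] by simp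
      then show ?thesis using u(1) by (intro exI[of _ "\<lambda>i. u (?T i)"]) auto
    next
      case False
      then obtain i j where ij: "i < ?N" "j < ?N" "i \<noteq> j" "?T i = ?T j" by (auto simp: inj_on_def)
      define c where "c k = (if k = i then 1 else 0) - (if k = j then 1 else (0::complex))" for k
      have "(\<Sum>k<?N. c k *s ?T k) = (\<Sum>k<?N. if k = i then ?T k else 0) - (\<Sum>k<?N. if k = j then ?T k else 0)"
        unfolding sum_subtractf[symmetric] by (intro sum.cong) (auto simp: c_def)
      also have "\<dots> = 0" using ij by (simp add: sum.delta)
      finally show ?thesis using ij by (intro exI[of _ c]) (auto simp: c_def)
    qed
    then obtain c where c: "\<exists>i<?N. c i \<noteq> 0" "(\<Sum>i<?N. c i *s ?T i) = 0" by blast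
    define p where "p = Poly (map c [0..<?N])"
    have cp: "coeff p i = (if i < ?N then c i else 0)" for i
      unfolding p_def by (simp add: nth_default_def del: upt_Suc)
    have "p \<noteq> 0" using c(1) cp by (metis coeff_0)
    moreover have "degree p < ?N"
      using cp by (intro le_less_trans[OF degree_le[of "CARD('m)"]]) auto
    moreover have "poly_act A ?N p v = 0"
      unfolding poly_act_def using c(2) by (simp add: cp)
    ultimately show ?thesis by (rule poly_act_annihilated)
  qed
  then show ?thesis by blast
qed

text \<open>One list of factors annihilating the standard basis annihilates every vector, so all
  eigenvalues occur in that list.\<close>

lemma finite_spectrum [simp]: "finite (spectrum (A :: complex^'m^'m))"
proof -
  have "\<exists>zs. \<forall>b\<in>S. fold (shift A) zs b = 0" if "finite S" for S
    using that
  proof induction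
    case (insert b S)
    then obtain zs where zs: "\<forall>b\<in>S. fold (shift A) zs b = 0" by blast
    have "b \<in> root_space A UNIV" by (simp add: root_space_UNIV)
    then obtain ws where "fold (shift A) ws b = 0" by (auto simp: root_space_def)
    then show ?case using zs
      by (intro exI[of _ "zs @ ws"] ballI) (auto simp: fold_shift_swap[of A ws zs b])
  qed simp
  from this[OF finite_cart_basis] obtain zs where zs: "\<forall>b\<in>cart_basis. fold (shift A) zs b = 0" by blast
  have sub: "vec.subspace {v. fold (shift A) zs v = 0}" by (rule vec.subspaceI) auto
  have "vec.span cart_basis \<subseteq> {v. fold (shift A) zs v = 0}"
    using zs by (intro vec.span_minimal sub) auto
  then have "v \<in> root_space A (set zs)" for v
    by (auto simp: root_space_def span_cart_basis)
  then have "spectrum A \<subseteq> set zs" using root_space_eigenvector unfolding spectrum_on_def by blast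
  then show ?thesis using finite_subset by blast
qed

lemma spectrum_nonempty: "spectrum (A :: complex^'m^'m) \<noteq> {}"
proof -
  have "(1 :: complex^'m) \<in> root_space A UNIV" by (simp add: root_space_UNIV)
  from root_space_nonzero_spectrum[OF this] show ?thesis by simp
qed

lemma fold_shift_replicate: "fold (shift A) (replicate k \<zeta>) v = (shift A \<zeta> ^^ k) v"
  by (induction k arbitrary: v) (simp_all add: funpow_Suc_right del: funpow.simps(2))

section \<open>Generalized eigenspaces, spectra and dimensions of root subspaces\<close>

lemma gen_eigenspace_eq_root_space: "gen_eigenspace A \<zeta> = root_space A {\<zeta>}"
proof -
  have sh: "(\<lambda>w. A *v w - \<zeta> *s w) = shift A \<zeta>" by (simp add: fun_eq_iff shift_def)
  show ?thesis
  proof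
    show "gen_eigenspace A \<zeta> \<subseteq> root_space A {\<zeta>}"
    proof
      fix v assume "v \<in> gen_eigenspace A \<zeta>"
      then obtain k where "(shift A \<zeta> ^^ k) v = 0" by (auto simp: gen_eigenspace_def sh)
      then have "set (replicate k \<zeta>) \<subseteq> {\<zeta>} \<and> fold (shift A) (replicate k \<zeta>) v = 0"
        by (auto simp: fold_shift_replicate)
      then show "v \<in> root_space A {\<zeta>}" unfolding root_space_def by blast
    qed
    show "root_space A {\<zeta>} \<subseteq> gen_eigenspace A \<zeta>"
    proof
      fix v assume "v \<in> root_space A {\<zeta>}"
      then obtain zs where zs: "set zs \<subseteq> {\<zeta>}" "fold (shift A) zs v = 0" by (auto simp: root_space_def)
      have eq: "replicate (length zs) \<zeta> = zs"
        by (rule replicate_eqI[OF refl, symmetric]) (use zs(1) in blast)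
      have "(shift A \<zeta> ^^ length zs) v = 0"
        using fold_shift_replicate[of A "length zs" \<zeta> v] unfolding eq zs(2) by simp
      then show "v \<in> gen_eigenspace A \<zeta>"
        unfolding gen_eigenspace_def sh by blast
    qed
  qed
qed

text \<open>Since the spectrum is finite, root vectors can be split off one eigenvalue at a
  time.\<close>

lemma gen_eigenspace_sum_eq_root_space: "gen_eigenspace_sum A Z = root_space A Z"
proof
  show "gen_eigenspace_sum A Z \<subseteq> root_space A Z"
    unfolding gen_eigenspace_sum_def gen_eigenspace_eq_root_space
    using root_space_mono[of _ Z A]
    by (intro vec.span_minimal subspace_root_space) blast
  show "root_space A Z \<subseteq> gen_eigenspace_sum A Z"
  proof -
    have fin: "root_space A F \<subseteq> gen_eigenspace_sum A Z" if "finite F" "F \<subseteq> spectrum A \<inter> Z" for F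
      using that
    proof (induction)
      case empty
      show ?case using root_space_nonzero_spectrum[of _ A "{}"] vec.span_zero
        by (auto simp: gen_eigenspace_sum_def)
    next
      case (insert \<zeta> F)
      show ?case
      proof
        fix v assume "v \<in> root_space A (insert \<zeta> F)"
        then obtain x y where xy: "x \<in> root_space A {\<zeta>}" "y \<in> root_space A F" "v = x + y"
          using root_space_split[of v A "{\<zeta>}" F] insert.hyps by auto
        have "x \<in> gen_eigenspace_sum A Z"
          unfolding gen_eigenspace_sum_def gen_eigenspace_eq_root_space
          using xy(1) insert.prems by (intro vec.span_base) blast
        moreover have "y \<in> gen_eigenspace_sum A Z" using xy insert by blast
        ultimately show "v \<in> gen_eigenspace_sum A Z"
          unfolding xy(3) gen_eigenspace_sum_def by (rule vec.span_add)
      qed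
    qed
    have "root_space A Z \<subseteq> root_space A (spectrum A \<inter> Z)"
      by (rule root_space_spectrum_cong) blast
    then show ?thesis using fin[of "spectrum A \<inter> Z"] by auto
  qed
qed

lemma spectrum_on_root_space: "spectrum_on A (root_space A Z) = spectrum A \<inter> Z"
proof
  show "spectrum_on A (root_space A Z) \<subseteq> spectrum A \<inter> Z"
    using root_space_eigenvector unfolding spectrum_on_def by blast
  show "spectrum A \<inter> Z \<subseteq> spectrum_on A (root_space A Z)"
  proof
    fix \<zeta> assume z: "\<zeta> \<in> spectrum A \<inter> Z"
    then obtain v where v: "v \<noteq> 0" "A *v v = \<zeta> *s v" by (auto simp: spectrum_on_def)
    then have "v \<in> root_space A Z"
      using z by (auto simp: root_space_def shift_def intro!: exI[of _ "[\<zeta>]"])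
    then show "\<zeta> \<in> spectrum_on A (root_space A Z)" using v by (auto simp: spectrum_on_def)
  qed
qed

lemma dim_root_space_Un:
  assumes "Z \<inter> W = {}"
  shows "vec.dim (root_space A (Z \<union> W)) = vec.dim (root_space A Z) + vec.dim (root_space A W)"
proof -
  have "root_space A (Z \<union> W) = {x + y |x y. x \<in> root_space A Z \<and> y \<in> root_space A W}"
  proof
    show "root_space A (Z \<union> W) \<subseteq> {x + y |x y. x \<in> root_space A Z \<and> y \<in> root_space A W}"
      using root_space_split[OF _ assms] by blast
    show "{x + y |x y. x \<in> root_space A Z \<and> y \<in> root_space A W} \<subseteq> root_space A (Z \<union> W)"
      using root_space_mono[of Z "Z \<union> W" A] root_space_mono[of W "Z \<union> W" A]
        vec.subspace_add[OF subspace_root_space] by blast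
  qed
  moreover have "root_space A Z \<inter> root_space A W = {0}"
    using root_space_disjoint[OF _ _ assms] vec.subspace_0[OF subspace_root_space] by blast
  ultimately show ?thesis
    using vec.dim_sums_Int[OF subspace_root_space subspace_root_space, of A Z A W] by simp
qed

text \<open>The eigenvalue counts below use this form: a sign condition on a quadratic form makes a
  projection or \<open>B\<close> injective on a root subspace.\<close>

lemma dim_le_inj_image:
  fixes T :: "complex^'m^'k"
  assumes "vec.subspace V" "\<And>v. v \<in> V \<Longrightarrow> T *v v = 0 \<Longrightarrow> v = 0" "\<And>v. v \<in> V \<Longrightarrow> T *v v \<in> W"
  shows "vec.dim V \<le> vec.dim W"
proof -
  have "inj_on ((*v) T) (vec.span V)"
  proof (rule inj_onI)
    fix x y assume "x \<in> vec.span V" "y \<in> vec.span V" "T *v x = T *v y"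
    then have "x - y \<in> V" "T *v (x - y) = 0"
      using assms(1) by (auto simp: vec.span_eq_iff[THEN iffD2] vec.subspace_diff vec.diff)
    then show "x = y" using assms(2)[of "x - y"] by simp
  qed
  then have "vec.dim ((*v) T ` V) = vec.dim V"
    by (intro vec.dim_image_eq) (simp add: matrix_vector_mul_linear_gen)
  moreover have "vec.dim ((*v) T ` V) \<le> vec.dim W" using assms(3) by (intro vec.dim_subset) blast
  ultimately show ?thesis by simp
qed

section \<open>Growth of iterates on root subspaces\<close>

text \<open>This replaces the Jordan form: a factor A - z perturbs the geometric recursion by a term
  that already tends to zero.\<close>

lemma contracting_recursion_tendsto_0:
  fixes a e :: "nat \<Rightarrow> real"
  assumes step: "\<And>n. a (Suc n) \<le> c * a n + e n" and a: "\<And>n. 0 \<le> a n"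
    and c: "0 \<le> c" "c < 1" and e: "e \<longlonglongrightarrow> 0"
  shows "a \<longlonglongrightarrow> 0"
proof (rule LIMSEQ_I)
  fix \<epsilon> :: real assume \<epsilon>: "0 < \<epsilon>"
  define d where "d = \<epsilon> / 2"
  have d: "0 < d" using \<epsilon> by (simp add: d_def)
  then have "0 < d * (1 - c)" using c by simp
  \<comment> \<open>An error below \<open>d * (1 - c)\<close> is exactly what keeps the bound
    \<open>c ^ k * a N + d\<close> stable under the recursion.\<close>
  from LIMSEQ_D[OF e this] obtain N where N: "\<And>n. n \<ge> N \<Longrightarrow> \<bar>e n\<bar> < d * (1 - c)" by auto
  have bound: "a (N + k) \<le> c ^ k * a N + d" for k
  proof (induction k)
    case 0
    then show ?case using d by simp
  next
    case (Suc k)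
    have "a (N + Suc k) \<le> c * a (N + k) + e (N + k)" using step[of "N + k"] by simp
    also have "\<dots> \<le> c * (c ^ k * a N + d) + d * (1 - c)"
      using N[of "N + k"] Suc c by (intro add_mono mult_left_mono) auto
    finally show ?case by (simp add: algebra_simps)
  qed
  have "(\<lambda>k. c ^ k * a N) \<longlonglongrightarrow> 0 * a N"
    using c by (intro tendsto_mult LIMSEQ_power_zero tendsto_const) simp
  then have "(\<lambda>k. c ^ k * a N) \<longlonglongrightarrow> 0" by simp
  from LIMSEQ_D[OF this d] obtain K where K: "\<And>k. k \<ge> K \<Longrightarrow> \<bar>c ^ k * a N\<bar> < d" by auto
  have "norm (a n - 0) < \<epsilon>" if "n \<ge> N + K" for n
  proof -
    have "a n \<le> c ^ (n - N) * a N + d" using bound[of "n - N"] that by simp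
    also have "\<dots> < d + d"
    proof -
      have "K \<le> n - N" using that by linarith
      from K[OF this] show ?thesis by linarith
    qed
    finally show ?thesis using a[of n] by (simp add: d_def)
  qed
  then show "\<exists>no. \<forall>n\<ge>no. norm (a n - 0) < \<epsilon>" by blast
qed

lemma norm_scaleC: "norm (c *s x) = cmod c * norm (x :: complex^'m)"
proof -
  have "(norm (c *s x))\<^sup>2 = (cmod c * norm x)\<^sup>2"
    unfolding power_mult_distrib norm_vec_def L2_set_def
    by (simp add: sum_nonneg norm_mult power_mult_distrib sum_distrib_left)
  then show ?thesis by (simp add: power2_eq_iff_nonneg)
qed

text \<open>Induction on the factors: the next iterate of \<open>v\<close> is \<zeta> times the
  current one plus an iterate of \<open>shift A \<zeta> v\<close>, which decays by
  induction.\<close>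

lemma root_space_inside_decay:
  fixes A :: "complex^'m^'m"
  assumes "v \<in> root_space A Z" "\<And>\<zeta>. \<zeta> \<in> Z \<Longrightarrow> cmod \<zeta> < r" "0 < r"
  shows "(\<lambda>n. norm (((*v) A ^^ n) v) / r ^ n) \<longlonglongrightarrow> 0"
proof -
  obtain zs where "set zs \<subseteq> Z" "fold (shift A) zs v = 0"
    using assms(1) by (auto simp: root_space_def)
  then show ?thesis
  proof (induction zs arbitrary: v)
    case Nil
    have "((*v) A ^^ n) 0 = 0" for n by (induction n) auto
    then show ?case using Nil by simp
  next
    case (Cons \<zeta> zs)
    let ?e = "\<lambda>n. norm (((*v) A ^^ n) (shift A \<zeta> v)) / r ^ n"
    have e: "?e \<longlonglongrightarrow> 0" using Cons.IH Cons.prems by simp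
    show ?case
    proof (rule contracting_recursion_tendsto_0[where c = "cmod \<zeta> / r" and e = "\<lambda>n. ?e n / r"])
      fix n
      have "((*v) A ^^ Suc n) v = \<zeta> *s ((*v) A ^^ n) v + ((*v) A ^^ n) (shift A \<zeta> v)"
        by (simp add: funpow_matrix_shift)
      then have "norm (((*v) A ^^ Suc n) v)
          \<le> cmod \<zeta> * norm (((*v) A ^^ n) v) + norm (((*v) A ^^ n) (shift A \<zeta> v))"
        by (metis norm_scaleC norm_triangle_ineq)
      then show "norm (((*v) A ^^ Suc n) v) / r ^ Suc n
          \<le> cmod \<zeta> / r * (norm (((*v) A ^^ n) v) / r ^ n) + ?e n / r"
        using assms(3) by (simp add: divide_simps)
    next
      show "(\<lambda>n. ?e n / r) \<longlonglongrightarrow> 0" using tendsto_divide[OF e tendsto_const[of r]] assms(3) by simp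
    qed (use Cons.prems assms in auto)
  qed
qed

lemma root_space_outside_decay:
  fixes A C :: "complex^'m^'m"
  assumes "v \<in> root_space A Z" "\<And>\<zeta>. \<zeta> \<in> Z \<Longrightarrow> r < cmod \<zeta>" "0 < r"
    and C: "\<And>x. C *v (A *v x) = x"
  shows "(\<lambda>n. norm (((*v) C ^^ n) v) * r ^ n) \<longlonglongrightarrow> 0"
proof -
  obtain zs where "set zs \<subseteq> Z" "fold (shift A) zs v = 0"
    using assms(1) by (auto simp: root_space_def)
  then show ?thesis
  proof (induction zs arbitrary: v)
    case Nil
    have "((*v) C ^^ n) 0 = 0" for n by (induction n) auto
    then show ?case using Nil by simp
  next
    case (Cons \<zeta> zs)
    let ?e = "\<lambda>n. norm (((*v) C ^^ n) (shift A \<zeta> v)) * r ^ n"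
    have e: "?e \<longlonglongrightarrow> 0" using Cons.IH Cons.prems by simp
    have z: "r < cmod \<zeta>" using Cons.prems assms(2) by auto
    \<comment> \<open>Applying \<open>C\<close> to A v - \<zeta> v gives v - \<zeta> C v; further
      applications of \<open>C\<close> give the recursion.\<close>
    have rec: "\<zeta> *s ((*v) C ^^ Suc n) v = ((*v) C ^^ n) v - ((*v) C ^^ Suc n) (shift A \<zeta> v)" for n
    proof (induction n)
      case 0
      then show ?case by (simp add: shift_def vec.diff vec.scale C)
    next
      case (Suc n)
      from arg_cong[OF Suc, of "(*v) C"] show ?case by (simp add: vec.diff vec.scale)
    qed
    show ?case
    proof (rule contracting_recursion_tendsto_0[where c = "r / cmod \<zeta>" and e = "\<lambda>n. ?e (Suc n) / cmod \<zeta>"])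
      fix n
      have "cmod \<zeta> * norm (((*v) C ^^ Suc n) v)
          \<le> norm (((*v) C ^^ n) v) + norm (((*v) C ^^ Suc n) (shift A \<zeta> v))"
        unfolding norm_scaleC[symmetric] rec by (rule norm_triangle_ineq4)
      then have "cmod \<zeta> * norm (((*v) C ^^ Suc n) v) * r ^ Suc n
          \<le> (norm (((*v) C ^^ n) v) + norm (((*v) C ^^ Suc n) (shift A \<zeta> v))) * r ^ Suc n"
        using assms(3) by (intro mult_right_mono) auto
      then have "norm (((*v) C ^^ Suc n) v) * r ^ Suc n * cmod \<zeta>
          \<le> r * (norm (((*v) C ^^ n) v) * r ^ n) + ?e (Suc n)"
        by (simp add: algebra_simps)
      then have "norm (((*v) C ^^ Suc n) v) * r ^ Suc n
          \<le> (r * (norm (((*v) C ^^ n) v) * r ^ n) + ?e (Suc n)) / cmod \<zeta>"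
        using z assms(3) by (subst pos_le_divide_eq) auto
      then show "norm (((*v) C ^^ Suc n) v) * r ^ Suc n
          \<le> r / cmod \<zeta> * (norm (((*v) C ^^ n) v) * r ^ n) + ?e (Suc n) / cmod \<zeta>"
        by (simp add: add_divide_distrib)
    next
      have "(\<lambda>n. ?e (Suc n)) \<longlonglongrightarrow> 0" using e by (rule LIMSEQ_Suc)
      from tendsto_divide_zero[OF this] show "(\<lambda>n. ?e (Suc n) / cmod \<zeta>) \<longlonglongrightarrow> 0" .
    qed (use z assms(3) in \<open>auto simp: divide_simps\<close>)
  qed
qed

text \<open>Iterating the inequality bounds \<open>h v\<close> by \<open>h\<close> of the n-th
  iterate divided by \<open>(r ^ n)\<^sup>2\<close>, and this upper bound tends to zero by the decay
  of the iterates.\<close>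

lemma stein_inside:
  fixes A :: "complex^'m^'m" and h :: "complex^'m \<Rightarrow> real"
  assumes v: "v \<in> root_space A Z" and Z: "\<And>\<zeta>. \<zeta> \<in> Z \<Longrightarrow> cmod \<zeta> < r" and r: "0 < r"
    and h: "\<And>x. r\<^sup>2 * h x \<le> h (A *v x)" and bd: "\<And>x. \<bar>h x\<bar> \<le> k * (norm x)\<^sup>2"
  shows "h v \<le> 0"
proof -
  let ?a = "\<lambda>n. norm (((*v) A ^^ n) v) / r ^ n"
  have mono: "h v * (r ^ n)\<^sup>2 \<le> h (((*v) A ^^ n) v)" for n
  proof (induction n)
    case (Suc n)
    have "h v * (r ^ Suc n)\<^sup>2 = r\<^sup>2 * (h v * (r ^ n)\<^sup>2)" by (simp add: power_mult_distrib)
    also have "\<dots> \<le> r\<^sup>2 * h (((*v) A ^^ n) v)" using Suc by (intro mult_left_mono) auto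
    also have "\<dots> \<le> h (((*v) A ^^ Suc n) v)" using h by simp
    finally show ?case .
  qed simp
  have le: "h v \<le> k * (?a n)\<^sup>2" for n
  proof -
    have "h v * (r ^ n)\<^sup>2 \<le> k * (norm (((*v) A ^^ n) v))\<^sup>2"
      using mono[of n] bd[of "((*v) A ^^ n) v"] by linarith
    then show ?thesis using r by (simp add: power_divide pos_le_divide_eq)
  qed
  have "(\<lambda>n. k * (?a n)\<^sup>2) \<longlonglongrightarrow> k * 0\<^sup>2"
    by (intro tendsto_intros root_space_inside_decay[OF v Z r])
  then have "(\<lambda>n. k * (?a n)\<^sup>2) \<longlonglongrightarrow> 0" by simp
  then show ?thesis using le by (intro LIMSEQ_le_const) auto
qed

text \<open>The same argument run backwards: iterates of the inverse \<open>C\<close> bound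
  \<open>h v\<close> from below by a sequence tending to zero.\<close>

lemma stein_outside:
  fixes A C :: "complex^'m^'m" and h :: "complex^'m \<Rightarrow> real"
  assumes v: "v \<in> root_space A Z" and Z: "\<And>\<zeta>. \<zeta> \<in> Z \<Longrightarrow> r < cmod \<zeta>" and r: "0 < r"
    and CA: "\<And>x. C *v (A *v x) = x" and AC: "\<And>x. A *v (C *v x) = x"
    and h: "\<And>x. r\<^sup>2 * h x \<le> h (A *v x)" and bd: "\<And>x. \<bar>h x\<bar> \<le> k * (norm x)\<^sup>2"
  shows "0 \<le> h v"
proof -
  let ?a = "\<lambda>n. norm (((*v) C ^^ n) v) * r ^ n"
  have mono: "(r ^ n)\<^sup>2 * h (((*v) C ^^ n) v) \<le> h v" for n
  proof (induction n)
    case (Suc n)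
    have "(r ^ Suc n)\<^sup>2 * h (((*v) C ^^ Suc n) v) = (r ^ n)\<^sup>2 * (r\<^sup>2 * h (C *v ((*v) C ^^ n) v))"
      by (simp add: power_mult_distrib)
    also have "\<dots> \<le> (r ^ n)\<^sup>2 * h (((*v) C ^^ n) v)"
      using h[of "C *v ((*v) C ^^ n) v"] unfolding AC by (intro mult_left_mono) auto
    finally show ?case using Suc by simp
  qed simp
  have le: "- k * (?a n)\<^sup>2 \<le> h v" for n
  proof -
    have "(r ^ n)\<^sup>2 * (- k * (norm (((*v) C ^^ n) v))\<^sup>2) \<le> (r ^ n)\<^sup>2 * h (((*v) C ^^ n) v)"
      using bd[of "((*v) C ^^ n) v"] by (intro mult_left_mono) auto
    then show ?thesis using mono[of n] by (simp add: power_mult_distrib mult_ac)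
  qed
  have "(\<lambda>n. - k * (?a n)\<^sup>2) \<longlonglongrightarrow> - k * 0\<^sup>2"
    by (intro tendsto_intros root_space_outside_decay[OF v Z r CA])
  then have "(\<lambda>n. - k * (?a n)\<^sup>2) \<longlonglongrightarrow> 0" by simp
  then show ?thesis using le by (intro LIMSEQ_le_const2) auto
qed

section \<open>Hermitian matrices and orthogonal projections\<close>

text \<open>The product is the real one, the real part of the Hermitian product. For complex
  matrices symmetry with respect to it is the usual notion, see
  \<open>hermitian_iff\<close>.\<close>

definition hermitian :: "complex^'m^'m \<Rightarrow> bool" where
  "hermitian M \<longleftrightarrow> (\<forall>x y. (M *v x) \<bullet> y = x \<bullet> (M *v y))"

lemma inner_scaleC: "(c *s x) \<bullet> y = (x :: complex^'m) \<bullet> (cnj c *s y)"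
  unfolding inner_vec_def by (intro sum.cong) (auto simp: inner_complex_def algebra_simps)

lemma scaleC_of_real: "complex_of_real t *s x = t *\<^sub>R (x :: complex^'m)"
  by (simp add: vec_eq_iff scaleR_conv_of_real[where 'a=complex])

lemma inner_ii: "(\<i> *s x) \<bullet> (\<i> *s y) = x \<bullet> (y :: complex^'m)"
  by (simp add: inner_scaleC)

text \<open>Up to sign this is the imaginary part of the Hermitian quadratic form. It provides the
  orthogonality of real and imaginary contributions used below.\<close>

lemma hermitian_inner_ii:
  assumes "hermitian M"
  shows "(M *v x) \<bullet> (\<i> *s x) = 0"
proof -
  have "(M *v x) \<bullet> (\<i> *s x) = x \<bullet> (\<i> *s (M *v x))"
    using assms by (simp add: hermitian_def vec.scale)
  also have "\<dots> = - ((M *v x) \<bullet> (\<i> *s x))"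
    by (simp add: inner_commute[of x] inner_scaleC)
  finally show ?thesis by simp
qed

lemma inner_ii_self: "x \<bullet> (\<i> *s (x :: complex^'m)) = 0"
  using hermitian_inner_ii[of "mat 1" x] by (simp add: hermitian_def)

lemma inner_conj_transpose: "(M *v x) \<bullet> y = x \<bullet> (conj_transpose M *v (y :: complex^'m))"
proof -
  have "(M *v x) \<bullet> y = (\<Sum>i\<in>UNIV. \<Sum>j\<in>UNIV. (M $ i $ j * x $ j) \<bullet> (y $ i))"
    by (simp add: inner_vec_def matrix_vector_mult_def inner_sum_left)
  also have "\<dots> = (\<Sum>j\<in>UNIV. \<Sum>i\<in>UNIV. (M $ i $ j * x $ j) \<bullet> (y $ i))" by (rule sum.swap)
  also have "\<dots> = (\<Sum>j\<in>UNIV. \<Sum>i\<in>UNIV. (x $ j) \<bullet> (cnj (M $ i $ j) * y $ i))"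
    by (intro sum.cong refl) (simp add: inner_complex_def algebra_simps)
  also have "\<dots> = x \<bullet> (conj_transpose M *v y)"
    by (simp add: inner_vec_def matrix_vector_mult_def inner_sum_right conj_transpose_def transpose_def)
  finally show ?thesis .
qed

lemma hermitian_iff: "hermitian M \<longleftrightarrow> conj_transpose M = M"
proof
  assume h: "hermitian M"
  have "x \<bullet> (conj_transpose M *v y) = x \<bullet> (M *v y)" for x y
    using h inner_conj_transpose[of M x y] by (simp add: hermitian_def)
  then have "conj_transpose M *v y = M *v y" for y by (meson vector_eq_ldot)
  then show "conj_transpose M = M" by (simp add: matrix_eq)
next
  assume "conj_transpose M = M"
  then show "hermitian M" using inner_conj_transpose[of M] by (simp add: hermitian_def)
qed

lemma linear_matrix_complex: "linear ((*v) (M :: complex^'m^'k))"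
proof (rule linearI)
  show "M *v (c *\<^sub>R x) = c *\<^sub>R (M *v x)" for c x
    by (simp add: vec.scale flip: scaleC_of_real)
qed (simp add: vec.add)

lemma complex_subspace_real: "vec.subspace K \<Longrightarrow> subspace (K :: (complex^'m) set)"
  by (auto simp: vec.subspace_def subspace_def) (metis scaleC_of_real)

section \<open>Orthogonal projections\<close>

locale proj_onto =
  fixes P :: "complex^'m^'m" and K :: "(complex^'m) set"
  assumes herm: "hermitian P" and idem: "P ** P = P" and rng: "range (\<lambda>v. P *v v) = K"
begin

lemma mem: "P *v x \<in> K" using rng by blast

lemma idem_v: "P *v (P *v x) = P *v x" using idem by (simp add: matrix_vector_mul_assoc)

lemma fixed_iff: "x \<in> K \<longleftrightarrow> P *v x = x"
proof
  assume "x \<in> K"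
  then obtain y where "x = P *v y" using rng by auto
  then show "P *v x = x" by (simp add: idem_v)
qed (metis mem)

lemma inner_move: "(P *v x) \<bullet> y = x \<bullet> (P *v y)" using herm by (simp add: hermitian_def)

lemma orth: "k \<in> K \<Longrightarrow> (x - P *v x) \<bullet> k = 0"
  by (simp add: inner_diff_left inner_move fixed_iff)

lemma orth2: "(x - P *v x) \<bullet> (P *v y) = 0"
  by (simp add: orth mem)

lemma pythagoras: "(norm x)\<^sup>2 = (norm (x - P *v x))\<^sup>2 + (norm (P *v x))\<^sup>2"
proof -
  have "(norm ((x - P *v x) + P *v x))\<^sup>2 = (norm (x - P *v x))\<^sup>2 + (norm (P *v x))\<^sup>2"
    by (rule norm_add_Pythagorean) (simp add: orthogonal_def orth2)
  then show ?thesis by simp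
qed

lemma norm_le: "norm (P *v x) \<le> norm x"
  by (rule power2_le_imp_le) (use pythagoras[of x] in auto)

lemma norm_compl_le: "norm (x - P *v x) \<le> norm x"
  by (rule power2_le_imp_le) (use pythagoras[of x] in auto)

end

text \<open>The decomposition is taken over the reals; complex linearity follows from uniqueness of
  the foot point.\<close>

lemma proj_onto_exists:
  fixes K :: "(complex^'m) set"
  assumes K: "vec.subspace K"
  shows "\<exists>P. proj_onto P K"
proof -
  have rs: "subspace K" using K by (rule complex_subspace_real)
  have "\<exists>y. y \<in> K \<and> (\<forall>k\<in>K. (x - y) \<bullet> k = 0)" for x
  proof -
    obtain y z where "y \<in> span K" "\<And>k. k \<in> span K \<Longrightarrow> orthogonal z k" "x = y + z"
      by (rule orthogonal_subspace_decomp_exists[of K x]) blast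
    moreover have "span K = K" using rs by (simp add: span_eq_iff)
    ultimately show ?thesis by (intro exI[of _ y]) (auto simp: orthogonal_def)
  qed
  then obtain f where f: "\<And>x. f x \<in> K" "\<And>x k. k \<in> K \<Longrightarrow> (x - f x) \<bullet> k = 0" by metis
  have uniq: "f x = y" if y: "y \<in> K" "\<And>k. k \<in> K \<Longrightarrow> (x - y) \<bullet> k = 0" for x y
  proof -
    have d: "f x - y \<in> K" using f(1) y(1) rs by (simp add: subspace_diff)
    have "(f x - y) \<bullet> (f x - y) = (x - y) \<bullet> (f x - y) - (x - f x) \<bullet> (f x - y)"
      by (simp add: inner_diff_left)
    also have "\<dots> = 0" using y(2)[OF d] f(2)[OF d] by simp
    finally show ?thesis by simp
  qed
  have add: "f (x + y) = f x + f y" for x y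
  proof (rule uniq)
    show "f x + f y \<in> K" using f(1) rs by (simp add: subspace_add)
    fix k assume k: "k \<in> K"
    have "(x + y - (f x + f y)) \<bullet> k = (x - f x) \<bullet> k + (y - f y) \<bullet> k"
      by (simp add: inner_diff_left inner_add_left)
    then show "(x + y - (f x + f y)) \<bullet> k = 0" using f(2)[OF k] by simp
  qed
  have scale: "f (c *s x) = c *s f x" for c x
  proof (rule uniq)
    show "c *s f x \<in> K" using f(1) K by (simp add: vec.subspace_scale)
    fix k assume "k \<in> K"
    \<comment> \<open>Here \<open>K\<close> being a complex subspace enters: moving \<open>c\<close>
      across the real product conjugates it.\<close>
    then have "cnj c *s k \<in> K" using K by (simp add: vec.subspace_scale)
    then have "(c *s (x - f x)) \<bullet> k = 0" unfolding inner_scaleC by (rule f(2))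
    then show "(c *s x - c *s f x) \<bullet> k = 0" by (simp add: vec.scale_right_diff_distrib)
  qed
  have "Vector_Spaces.linear (*s) (*s) f"
    by unfold_locales (auto simp: add scale)
  then have Pf: "matrix f *v x = f x" for x by (simp add: matrix_works)
  have fixd: "f x = x" if "x \<in> K" for x by (rule uniq) (use that in auto)
  have "proj_onto (matrix f) K"
  proof
    show "hermitian (matrix f)"
      unfolding hermitian_def Pf
    proof (intro allI)
      fix x y
      have "f x \<bullet> y = f x \<bullet> f y + (y - f y) \<bullet> f x"
        by (simp add: inner_diff_left) (simp add: inner_commute)
      moreover have "x \<bullet> f y = f x \<bullet> f y + (x - f x) \<bullet> f y" by (simp add: inner_diff_left)
      ultimately show "f x \<bullet> y = x \<bullet> f y" using f by simp
    qed
    show "matrix f ** matrix f = matrix f"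
      by (simp add: matrix_eq Pf fixd f(1) flip: matrix_vector_mul_assoc)
    show "range (\<lambda>v. matrix f *v v) = K"
      unfolding Pf using f(1) fixd by (metis rangeI image_subsetI subsetI subset_antisym)
  qed
  then show ?thesis by blast
qed

lemma proj_onto_unique:
  assumes "proj_onto P K" "proj_onto P' K"
  shows "P = P'"
proof -
  interpret P: proj_onto P K by fact
  interpret P': proj_onto P' K by fact
  have "P *v x = P' *v x" for x
  proof -
    define d where "d = P *v x - P' *v x"
    have "P *v d = d" by (simp add: d_def vec.diff P.idem_v P.fixed_iff[THEN iffD1] P'.mem)
    then have dK: "d \<in> K" by (simp add: P.fixed_iff)
    have "d \<bullet> d = (x - P' *v x) \<bullet> d - (x - P *v x) \<bullet> d" by (simp add: d_def inner_diff_left)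
    also have "\<dots> = 0" using dK by (simp add: P.orth P'.orth)
    finally show ?thesis by (simp add: d_def)
  qed
  then show ?thesis by (simp add: matrix_eq)
qed

lemma orth_projection_proj_onto:
  assumes "vec.subspace K"
  shows "proj_onto (orth_projection K) K"
proof -
  have *: "(conj_transpose P = P \<and> P ** P = P \<and> range (\<lambda>v. P *v v) = K) = proj_onto P K" for P
    by (simp add: proj_onto_def hermitian_iff)
  have "\<exists>!P. proj_onto P K" using proj_onto_exists[OF assms] proj_onto_unique by blast
  then show ?thesis unfolding orth_projection_def * by (rule theI')
qed

section \<open>Modal dichotomy of a dissipative perturbation\<close>

text \<open>Expansion of the squared norm of a - 2 b. This is the source of the factor 1/2 in the
  Stein estimates.\<close>

lemma norm_diff_square_ge: "(norm a)\<^sup>2 / 2 \<le> (norm (b - a))\<^sup>2 + (norm b)\<^sup>2"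
  for a b :: "'a::real_inner"
proof -
  have "0 \<le> (norm (a - 2 *\<^sub>R b))\<^sup>2" by simp
  then show ?thesis
    by (simp add: power2_norm_eq_inner inner_diff_left inner_diff_right inner_commute algebra_simps)
qed

text \<open>\<open>w\<close> bounds the norm of \<open>Om\<close>, \<open>b\<close> bounds
  \<open>B\<close> from below off its kernel, \<open>C\<close> is the inverse of \<open>A\<close>,
  and \<open>gap\<close> is the high-loss threshold on \<beta>.\<close>

locale dissipative = proj_onto Q "{v. B *v v = 0}"
  for Q B :: "complex^'m^'m" +
  fixes Om A C :: "complex^'m^'m" and \<beta> w b :: real
  assumes hermOm: "hermitian Om" and hermB: "hermitian B"
    and A: "\<And>x. A *v x = Om *v x - (\<i> * complex_of_real \<beta>) *s (B *v x)"
    and CA: "\<And>x. C *v (A *v x) = x" and AC: "\<And>x. A *v (C *v x) = x"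
    and w0: "0 < w" and normOm: "\<And>x. norm (Om *v x) \<le> w * norm x"
    and normB: "\<And>x. b * norm (x - Q *v x) \<le> norm (B *v x)"
    and Bpos: "\<And>x. 0 \<le> x \<bullet> (B *v x)"
    and b0: "0 < b" and \<beta>0: "0 \<le> \<beta>" and gap: "2 * w < \<beta> * b"
begin

lemma BQ: "B *v (Q *v x) = 0" using mem by auto

text \<open>Since the damping term is invisible to \<open>Q\<close>, the kernel component of
  \<open>A *v x\<close> involves only \<open>Om\<close>.\<close>

lemma QB: "Q *v (B *v x) = 0"
proof -
  have "(Q *v (B *v x)) \<bullet> y = 0" for y
    using hermB by (simp add: inner_move hermitian_def BQ)
  then show ?thesis by (metis inner_eq_zero_iff)
qed

lemma QA: "Q *v (A *v x) = Q *v (Om *v x)"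
  by (simp add: A vec.diff vec.scale QB)

lemma compl_A: "A *v x - Q *v (A *v x) = (Om *v x - Q *v (Om *v x)) - (\<i> * complex_of_real \<beta>) *s (B *v x)"
  by (simp add: QA) (simp add: A)

lemma norm_damping: "norm ((\<i> * complex_of_real \<beta>) *s (B *v x)) = \<beta> * norm (B *v x)"
  using \<beta>0 by (simp add: norm_scaleC norm_mult)

lemma damping_ge: "(\<beta> * b) * norm (x - Q *v x) \<le> \<beta> * norm (B *v x)"
  using mult_left_mono[OF normB \<beta>0] by (simp add: mult.assoc)

lemma compl_A_ge:
  "(\<beta> * b)\<^sup>2 / 2 * (norm (x - Q *v x))\<^sup>2
     \<le> (norm (A *v x - Q *v (A *v x)))\<^sup>2 + (norm (Om *v x - Q *v (Om *v x)))\<^sup>2"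
proof -
  have "((\<beta> * b) * norm (x - Q *v x))\<^sup>2 \<le> (\<beta> * norm (B *v x))\<^sup>2"
    using damping_ge \<beta>0 b0 by (intro power_mono) auto
  then have "(\<beta> * b)\<^sup>2 / 2 * (norm (x - Q *v x))\<^sup>2 \<le> (\<beta> * norm (B *v x))\<^sup>2 / 2"
    by (simp add: power_mult_distrib)
  also have "\<dots> \<le> (norm (A *v x - Q *v (A *v x)))\<^sup>2 + (norm (Om *v x - Q *v (Om *v x)))\<^sup>2"
    using norm_diff_square_ge[of "(\<i> * complex_of_real \<beta>) *s (B *v x)" "Om *v x - Q *v (Om *v x)"]
    unfolding compl_A norm_damping .
  finally show ?thesis .
qed

lemma normOm_sq: "(norm (Om *v x))\<^sup>2 \<le> w\<^sup>2 * (norm x)\<^sup>2"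
  using power_mono[OF normOm norm_ge_zero, of x 2] by (simp add: power_mult_distrib)

section \<open>The signature form and the dimension of the high-loss subspace\<close>

definition sgn_form :: "complex^'m \<Rightarrow> real" where
  "sgn_form x = (norm (x - Q *v x))\<^sup>2 - (norm (Q *v x))\<^sup>2"

lemma sgn_form_bound: "\<bar>sgn_form x\<bar> \<le> 1 * (norm x)\<^sup>2"
  using pythagoras[of x] by (simp add: sgn_form_def abs_le_iff)

text \<open>The damped component gains half of \<open>(\<beta> * b)\<^sup>2\<close>. The losses in
  both components together are the squared norm of \<open>Om *v x\<close>, hence at most
  \<open>w\<^sup>2\<close> times that of \<open>x\<close>.\<close>

lemma sgn_form_stein:
  assumes "w \<le> r" "r\<^sup>2 \<le> (\<beta> * b)\<^sup>2 / 2 - w\<^sup>2"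
  shows "r\<^sup>2 * sgn_form x \<le> sgn_form (A *v x)"
proof -
  let ?p = "(norm (x - Q *v x))\<^sup>2" and ?q = "(norm (Q *v x))\<^sup>2"
  have "w\<^sup>2 \<le> r\<^sup>2" using assms w0 by (intro power_mono) auto
  then have 1: "w\<^sup>2 * ?q \<le> r\<^sup>2 * ?q" by (intro mult_right_mono) auto
  have 2: "r\<^sup>2 * ?p \<le> ((\<beta> * b)\<^sup>2 / 2 - w\<^sup>2) * ?p" using assms by (intro mult_right_mono) auto
  have 3: "(norm (Om *v x - Q *v (Om *v x)))\<^sup>2 + (norm (Q *v (Om *v x)))\<^sup>2 \<le> w\<^sup>2 * ?p + w\<^sup>2 * ?q"
    using normOm_sq[of x] pythagoras[of x] pythagoras[of "Om *v x"] by (simp add: algebra_simps)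
  show ?thesis
    using 1 2 3 compl_A_ge[of x] unfolding sgn_form_def QA[of x] by (simp add: algebra_simps)
qed

text \<open>\<open>stein_outside\<close> needs a strict separation. The spectrum is finite, so there
  is room above \<open>w\<close>, and the midpoint between \<open>w\<close> and the nearest
  obstruction serves.\<close>

lemma exists_separating_radius:
  obtains r where "w < r" "r\<^sup>2 \<le> (\<beta> * b)\<^sup>2 / 2 - w\<^sup>2" "\<And>\<zeta>. \<zeta> \<in> spectrum A \<Longrightarrow> w < cmod \<zeta> \<Longrightarrow> r < cmod \<zeta>"
proof -
  let ?s = "sqrt ((\<beta> * b)\<^sup>2 / 2 - w\<^sup>2)"
  have "(2 * w)\<^sup>2 < (\<beta> * b)\<^sup>2" using gap w0 by (intro power_strict_mono) auto
  then have lt: "w\<^sup>2 < (\<beta> * b)\<^sup>2 / 2 - w\<^sup>2" by (simp add: power_mult_distrib)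
  then have s: "w < ?s" by (rule real_less_rsqrt)
  let ?S = "insert ?s (cmod ` {\<zeta> \<in> spectrum A. w < cmod \<zeta>})"
  have fin: "finite ?S" by simp
  define m where "m = Min ?S"
  have m: "m \<in> ?S" unfolding m_def using fin by (intro Min_in) auto
  then have wm: "w < m" using s by auto
  have le: "m \<le> t" if "t \<in> ?S" for t unfolding m_def using fin that by (rule Min_le)
  show thesis
  proof
    show "w < (w + m) / 2" using wm by simp
    have "(w + m) / 2 \<le> ?s" using le[of ?s] wm by simp
    then have "((w + m) / 2)\<^sup>2 \<le> ?s\<^sup>2" using w0 wm by (intro power_mono) auto
    also have "\<dots> = (\<beta> * b)\<^sup>2 / 2 - w\<^sup>2"
      using lt zero_le_power2[of w] by (intro real_sqrt_pow2) linarith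
    finally show "((w + m) / 2)\<^sup>2 \<le> (\<beta> * b)\<^sup>2 / 2 - w\<^sup>2" .
    fix \<zeta> assume "\<zeta> \<in> spectrum A" "w < cmod \<zeta>"
    then have "m \<le> cmod \<zeta>" by (intro le) auto
    then show "(w + m) / 2 < cmod \<zeta>" using wm by simp
  qed
qed

lemma dim_ker_range: "vec.dim {v. B *v v = 0} + vec.dim (range (\<lambda>v. B *v v)) \<le> CARD('m)"
proof -
  have sub1: "vec.subspace {v. B *v v = 0}" by (rule vec.subspaceI) (auto simp: vec.add vec.scale)
  have sub2: "vec.subspace (range (\<lambda>v. B *v v))"
    by (rule vec.subspaceI) (auto simp: image_iff intro: exI[of _ 0] vec.add[symmetric] vec.scale[symmetric])
  have "{v. B *v v = 0} \<inter> range (\<lambda>v. B *v v) \<subseteq> {0}"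
    using QB fixed_iff by force
  then have "vec.dim ({v. B *v v = 0} \<inter> range (\<lambda>v. B *v v)) = 0"
    by simp
  then have "vec.dim {v. B *v v = 0} + vec.dim (range (\<lambda>v. B *v v))
      = vec.dim {x + y |x y. x \<in> {v. B *v v = 0} \<and> y \<in> range (\<lambda>v. B *v v)}"
    using vec.dim_sums_Int[OF sub1 sub2] by linarith
  also have "\<dots> \<le> CARD('m)" by (rule dim_subset_UNIV_cart_gen)
  finally show ?thesis .
qed

text \<open>\<open>B\<close> is injective on the high-loss space and \<open>Q\<close> on the
  low-loss space, by the sign of the form. The two bounds add up to at most the full dimension, so
  both are equalities.\<close>

lemma dim_high_loss: "vec.dim (root_space A {\<zeta>. w < cmod \<zeta>}) = vec.dim (range (\<lambda>v. B *v v))" (is ?A)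
  and dim_low_loss: "vec.dim (root_space A {\<zeta>. cmod \<zeta> \<le> w}) + vec.dim (range (\<lambda>v. B *v v)) = CARD('m)" (is ?B)
proof -
  obtain r where r: "w < r" "r\<^sup>2 \<le> (\<beta> * b)\<^sup>2 / 2 - w\<^sup>2"
    "\<And>\<zeta>. \<zeta> \<in> spectrum A \<Longrightarrow> w < cmod \<zeta> \<Longrightarrow> r < cmod \<zeta>"
    by (rule exists_separating_radius) blast
  have r0: "0 < r" using r w0 by simp
  note st = sgn_form_stein[OF less_imp_le[OF r(1)] r(2)]
  have 1: "vec.dim (root_space A {\<zeta>. w < cmod \<zeta>}) \<le> vec.dim (range (\<lambda>v. B *v v))"
  proof (rule dim_le_inj_image[of _ B])
    fix v assume v: "v \<in> root_space A {\<zeta>. w < cmod \<zeta>}" "B *v v = 0"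
    have "v \<in> root_space A {\<zeta>. r < cmod \<zeta>}"
      using v(1) root_space_spectrum_cong[of "{\<zeta>. w < cmod \<zeta>}" A "{\<zeta>. r < cmod \<zeta>}"] r(3) by blast
    from stein_outside[OF this _ r0 CA AC st sgn_form_bound] have "0 \<le> sgn_form v" by simp
    moreover have "Q *v v = v" using v(2) fixed_iff[of v] by simp
    ultimately show "v = 0" by (simp add: sgn_form_def)
  qed (auto intro: subspace_root_space)
  have 2: "vec.dim (root_space A {\<zeta>. cmod \<zeta> \<le> w}) \<le> vec.dim {v. B *v v = 0}"
  proof (rule dim_le_inj_image[of _ Q])
    fix v assume v: "v \<in> root_space A {\<zeta>. cmod \<zeta> \<le> w}" "Q *v v = 0"
    have "\<zeta> \<in> {\<zeta>. cmod \<zeta> \<le> w} \<Longrightarrow> cmod \<zeta> < r" for \<zeta> using r(1) by simp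
    from stein_inside[OF v(1) this r0 st sgn_form_bound] have "sgn_form v \<le> 0" .
    then show "v = 0" using v(2) by (simp add: sgn_form_def)
  qed (use mem in \<open>auto intro: subspace_root_space\<close>)
  have "{\<zeta>. w < cmod \<zeta>} \<union> {\<zeta>. cmod \<zeta> \<le> w} = UNIV" "{\<zeta>. w < cmod \<zeta>} \<inter> {\<zeta>. cmod \<zeta> \<le> w} = {}" by auto
  then have "vec.dim (root_space A {\<zeta>. w < cmod \<zeta>}) + vec.dim (root_space A {\<zeta>. cmod \<zeta> \<le> w}) = CARD('m)"
    using dim_root_space_Un[of "{\<zeta>. w < cmod \<zeta>}" "{\<zeta>. cmod \<zeta> \<le> w}" A]
    by (simp add: root_space_UNIV del: vec.dim_UNIV) (simp only: vec_dim_card)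
  then show ?A ?B using 1 2 dim_ker_range by linarith+
qed

lemma Om_eigenvector:
  assumes "A *v v = \<zeta> *s v"
  shows "Om *v v = Re \<zeta> *\<^sub>R v + \<i> *s (Im \<zeta> *\<^sub>R v + \<beta> *\<^sub>R (B *v v))"
proof -
  have "Om *v v = \<zeta> *s v + (\<i> * complex_of_real \<beta>) *s (B *v v)" using A[of v] assms by simp
  also have "\<dots> = Re \<zeta> *\<^sub>R v + \<i> *s (Im \<zeta> *\<^sub>R v + \<beta> *\<^sub>R (B *v v))"
    by (subst complex_eq[of \<zeta>], unfold scaleC_of_real[symmetric])
      (simp add: vec.scale_left_distrib vec.scale_right_distrib mult_ac)
  finally show ?thesis .
qed

text \<open>Pairing \<open>Om *v v\<close> with \<open>\<i> *s v\<close> isolates the imaginary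
  part, where positivity of \<open>B\<close> decides the sign.\<close>

lemma Im_eigenvalue_le_0:
  assumes "\<zeta> \<in> spectrum A"
  shows "Im \<zeta> \<le> 0"
proof -
  obtain v where v: "v \<noteq> 0" "A *v v = \<zeta> *s v" using assms by (auto simp: spectrum_on_def)
  have "0 = (Om *v v) \<bullet> (\<i> *s v)" using hermitian_inner_ii[OF hermOm] by simp
  also have "\<dots> = Re \<zeta> * (v \<bullet> (\<i> *s v)) + (Im \<zeta> *\<^sub>R v + \<beta> *\<^sub>R (B *v v)) \<bullet> v"
    unfolding Om_eigenvector[OF v(2)] inner_add_left inner_ii by simp
  also have "\<dots> = Im \<zeta> * (v \<bullet> v) + \<beta> * (v \<bullet> (B *v v))"
    by (simp add: inner_ii_self inner_add_left inner_commute[of "B *v v" v])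
  finally have "Im \<zeta> * (v \<bullet> v) \<le> 0" using Bpos[of v] \<beta>0 by (smt (verit) mult_nonneg_nonneg)
  moreover have "0 < v \<bullet> v" using v by simp
  ultimately show ?thesis by (simp add: mult_le_0_iff)
qed

text \<open>With \<open>u\<close> denoting (c + \<beta> B) v, \<open>Om *v v\<close> is the
  orthogonal sum of a v and \<i> u, so |a| is at most \<open>w\<close>. If |c| were also at most
  \<open>w\<close>, the gap would make |u| at least |c| |v| and force |\<zeta>| to be at most
  \<open>w\<close>. Hence |c| exceeds |a|.\<close>

lemma high_loss_overdamped:
  assumes "\<zeta> \<in> spectrum A" "w < cmod \<zeta>"
  shows "Re (\<zeta>\<^sup>2) < 0"
proof -
  obtain v where v: "v \<noteq> 0" "A *v v = \<zeta> *s v" using assms by (auto simp: spectrum_on_def)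
  have nv: "0 < (norm v)\<^sup>2" using v by simp
  define a c u where "a = Re \<zeta>" and "c = Im \<zeta>" and "u = c *\<^sub>R v + \<beta> *\<^sub>R (B *v v)"
  have "v \<bullet> (\<i> *s u) = 0"
  proof -
    have "(\<i> *s u) \<bullet> v = - ((c *\<^sub>R v) \<bullet> (\<i> *s v)) - \<beta> * ((B *v v) \<bullet> (\<i> *s v))"
      unfolding inner_scaleC u_def by (simp add: inner_add_left)
    also have "\<dots> = 0" using hermitian_inner_ii[OF hermB] by (simp add: inner_ii_self)
    finally show ?thesis by (simp add: inner_commute)
  qed
  then have nOm: "(norm (Om *v v))\<^sup>2 = a\<^sup>2 * (norm v)\<^sup>2 + (norm u)\<^sup>2"
    unfolding Om_eigenvector[OF v(2)] a_def[symmetric] c_def[symmetric] u_def[symmetric]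
    by (subst norm_add_Pythagorean) (simp_all add: orthogonal_def norm_scaleC power_mult_distrib)
  have up: "(norm (Om *v v))\<^sup>2 \<le> w\<^sup>2 * (norm v)\<^sup>2" by (rule normOm_sq)
  have z: "(cmod \<zeta>)\<^sup>2 = a\<^sup>2 + c\<^sup>2" by (simp add: cmod_power2 a_def c_def)
  have "w < \<bar>c\<bar>"
  proof (rule ccontr)
    assume "\<not> w < \<bar>c\<bar>"
    then have cw: "\<bar>c\<bar> \<le> w" by simp
    have Qu: "Q *v u = c *\<^sub>R (Q *v v)"
      by (simp add: u_def vec.add linear_scale[OF linear_matrix_complex] QB)
    have Pu: "u - Q *v u = c *\<^sub>R (v - Q *v v) + \<beta> *\<^sub>R (B *v v)"
      unfolding Qu by (simp add: u_def algebra_simps)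
    \<comment> \<open>Since |c| is at most \<open>w\<close>, \<open>gap\<close> gives
      \<open>\<beta> * b\<close> more than twice |c|.\<close>
    have "\<bar>c\<bar> * norm (v - Q *v v) \<le> (\<beta> * b - \<bar>c\<bar>) * norm (v - Q *v v)"
      using cw gap by (intro mult_right_mono) auto
    also have "\<dots> \<le> \<beta> * norm (B *v v) - \<bar>c\<bar> * norm (v - Q *v v)"
      using damping_ge[of v] by (simp add: algebra_simps)
    also have "\<dots> = norm (\<beta> *\<^sub>R (B *v v)) - norm (- (c *\<^sub>R (v - Q *v v)))"
      using \<beta>0 by simp
    also have "\<dots> \<le> norm (\<beta> *\<^sub>R (B *v v) - (- (c *\<^sub>R (v - Q *v v))))" by (rule norm_triangle_ineq2)
    also have "\<dots> = norm (u - Q *v u)" unfolding Pu by (simp add: add.commute)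
    finally have "(\<bar>c\<bar> * norm (v - Q *v v))\<^sup>2 \<le> (norm (u - Q *v u))\<^sup>2" by (intro power_mono) auto
    then have "c\<^sup>2 * (norm v)\<^sup>2 \<le> (norm u)\<^sup>2"
      unfolding pythagoras[of v] pythagoras[of u] Qu by (simp add: power_mult_distrib algebra_simps)
    then have "(cmod \<zeta>)\<^sup>2 * (norm v)\<^sup>2 \<le> w\<^sup>2 * (norm v)\<^sup>2"
      using nOm up z by (simp add: algebra_simps)
    then have "(cmod \<zeta>)\<^sup>2 \<le> w\<^sup>2" using nv by simp
    then have "cmod \<zeta> \<le> w" by (rule power2_le_imp_le) (use w0 in simp)
    then show False using assms(2) by simp
  qed
  then have "w\<^sup>2 < \<bar>c\<bar>\<^sup>2" using w0 by (intro power_strict_mono) auto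
  then have "w\<^sup>2 < c\<^sup>2" by simp
  moreover have "a\<^sup>2 \<le> w\<^sup>2"
  proof -
    have "a\<^sup>2 * (norm v)\<^sup>2 \<le> w\<^sup>2 * (norm v)\<^sup>2" using nOm up zero_le_power2[of "norm u"] by linarith
    then show ?thesis using nv by simp
  qed
  ultimately show ?thesis by (simp add: a_def c_def power2_eq_square)
qed

end

text \<open>\<open>\<rho>\<close> bounds the compression of \<open>Om\<close> from below off its
  kernel. The condition \<open>gap2\<close> is the bound \<beta> at least \<open>c_inv\<close> at
  \<open>\<rho> / 2\<close>, multiplied by \<open>b\<close>.\<close>

locale dissipative_gap = dissipative +
  fixes \<rho> :: real
  assumes \<rho>0: "0 < \<rho>" and \<rho>w: "\<rho> \<le> w"
    and compression: "\<And>v. (\<And>k. Q *v (Om *v (Q *v k)) = 0 \<Longrightarrow> v \<bullet> k = 0) \<Longrightarrow>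
      \<rho> * norm v \<le> norm (Q *v (Om *v (Q *v v)))"
    and Om_inj: "\<And>v. Om *v v = 0 \<Longrightarrow> v = 0"
    and gap2: "2 * w + 4 * w\<^sup>2 / \<rho> \<le> \<beta> * b"
begin

text \<open>The kernel of the compression within the kernel of \<open>B\<close>. Vectors are split
  into the damped part \<open>x - Q *v x\<close>, the middle part \<open>Y x\<close> and the part
  \<open>Z0 *v x\<close> in \<open>K0\<close>.\<close>

definition K0 :: "(complex^'a) set" where
  "K0 = {v. B *v v = 0 \<and> Q *v (Om *v v) = 0}"

definition Z0 :: "complex^'a^'a" where "Z0 = (SOME P. proj_onto P K0)"

lemma subspace_K0: "vec.subspace K0"
  unfolding K0_def by (rule vec.subspaceI) (auto simp: vec.add vec.scale)

sublocale Z: proj_onto Z0 K0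
  unfolding Z0_def using proj_onto_exists[OF subspace_K0] by (rule someI_ex)

lemma QZ: "Q *v (Z0 *v x) = Z0 *v x"
  using Z.mem[of x] fixed_iff[of "Z0 *v x"] by (simp add: K0_def)

lemma ZQ: "Z0 *v (Q *v x) = Z0 *v x"
proof -
  have "(Z0 *v (Q *v x)) \<bullet> y = (Z0 *v x) \<bullet> y" for y
    by (simp add: Z.inner_move inner_move QZ)
  then show ?thesis by (meson vector_eq_rdot)
qed

text \<open>The middle component: orthogonal to both the range of \<open>B\<close> and the kernel of the compression.\<close>

definition Y :: "complex^'a \<Rightarrow> complex^'a" where "Y x = Q *v x - Z0 *v x"

lemma QY: "Q *v Y x = Y x" by (simp add: Y_def vec.diff idem_v QZ)

lemma norm_Q: "(norm (Q *v x))\<^sup>2 = (norm (Y x))\<^sup>2 + (norm (Z0 *v x))\<^sup>2"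
  using Z.pythagoras[of "Q *v x"] by (simp add: ZQ Y_def)

lemma compression_herm:
  "(Q *v (Om *v (Q *v x))) \<bullet> y = x \<bullet> (Q *v (Om *v (Q *v y)))"
  using hermOm by (simp add: inner_move hermitian_def)

lemma compression_Y: "\<rho> * norm (Y x) \<le> norm (Q *v (Om *v Y x))"
proof -
  have "\<rho> * norm (Y x) \<le> norm (Q *v (Om *v (Q *v Y x)))"
  proof (rule compression)
    fix k assume k: "Q *v (Om *v (Q *v k)) = 0"
    then have "Q *v k \<in> K0" using BQ by (simp add: K0_def)
    then have "(Q *v x - Z0 *v (Q *v x)) \<bullet> (Q *v k) = 0" by (rule Z.orth)
    then show "Y x \<bullet> k = 0"
      by (metis QY Y_def ZQ inner_move)
  qed
  then show ?thesis by (simp add: QY)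
qed

lemma QOmZ: "Q *v (Om *v (Z0 *v x)) = 0" using Z.mem[of x] by (simp add: K0_def)

text \<open>The compression is self-adjoint, so it does not couple its kernel to the orthogonal
  complement. Hence \<open>Y\<close> and \<open>K0\<close> interact only through the damped
  part.\<close>

lemma ZOmY: "Z0 *v (Om *v Y x) = 0"
proof -
  have "(Z0 *v (Om *v Y x)) \<bullet> y = 0" for y
  proof -
    have "(Z0 *v (Om *v Y x)) \<bullet> y = Y x \<bullet> (Om *v (Z0 *v y))"
      using hermOm by (simp add: Z.inner_move hermitian_def)
    also have "\<dots> = Y x \<bullet> (Q *v (Om *v (Z0 *v y)))" by (metis QY inner_move)
    finally show ?thesis by (simp add: QOmZ)
  qed
  then show ?thesis by (metis inner_eq_zero_iff)
qed

lemma Q_decomp: "Q *v x = Y x + Z0 *v x" by (simp add: Y_def)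

lemma QOm: "Q *v (Om *v x) = Q *v (Om *v (x - Q *v x)) + Q *v (Om *v Y x)"
proof -
  have "x = (x - Q *v x) + (Y x + Z0 *v x)" by (simp add: Y_def)
  then have "Q *v (Om *v x) = Q *v (Om *v ((x - Q *v x) + (Y x + Z0 *v x)))" by simp
  then show ?thesis by (simp only: vec.add QOmZ add_0_right)
qed

lemma ZOm: "Z0 *v (Om *v x) = Z0 *v (Om *v (x - Q *v x))"
proof -
  have "Z0 *v (Om *v x) = Z0 *v (Q *v (Om *v x))" by (simp add: ZQ)
  also have "\<dots> = Z0 *v (Q *v (Om *v (x - Q *v x))) + Z0 *v (Q *v (Om *v Y x))"
    by (subst QOm) (simp only: vec.add)
  finally show ?thesis by (simp add: ZQ ZOmY)
qed

lemma YOm: "Y (Om *v x) = Y (Om *v (x - Q *v x)) + Q *v (Om *v Y x)"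
  unfolding Y_def[of "Om *v x"] QOm[of x] ZOm[of x] by (simp add: Y_def)

text \<open>The weight of the damped component balances the coupling through \<open>Om\<close>;
  the form is negative exactly on the kernel of the compression.\<close>

definition gap_form :: "complex^'a \<Rightarrow> real" where
  "gap_form x = \<rho>\<^sup>2 / (4 * w\<^sup>2) * (norm (x - Q *v x))\<^sup>2 + (norm (Y x))\<^sup>2 - (norm (Z0 *v x))\<^sup>2"

lemma weight_le_1: "\<rho>\<^sup>2 / (4 * w\<^sup>2) \<le> 1"
proof -
  have "\<rho>\<^sup>2 \<le> w\<^sup>2" using \<rho>0 \<rho>w by (intro power_mono) auto
  then have "\<rho>\<^sup>2 \<le> 4 * w\<^sup>2" using zero_le_power2[of w] by linarith
  then show ?thesis using w0 by (simp add: divide_simps)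
qed

lemma gap_form_bound: "\<bar>gap_form x\<bar> \<le> 1 * (norm x)\<^sup>2"
proof -
  have "\<rho>\<^sup>2 / (4 * w\<^sup>2) * (norm (x - Q *v x))\<^sup>2 \<le> 1 * (norm (x - Q *v x))\<^sup>2"
    using weight_le_1 by (intro mult_right_mono) auto
  moreover have "0 \<le> \<rho>\<^sup>2 / (4 * w\<^sup>2) * (norm (x - Q *v x))\<^sup>2" by simp
  ultimately show ?thesis
    using pythagoras[of x] norm_Q[of x] zero_le_power2[of "norm (Y x)"] zero_le_power2[of "norm (Z0 *v x)"]
    unfolding gap_form_def by linarith
qed

text \<open>The balance for the damped part in \<open>gap_form_stein\<close>:
  \<open>w\<^sup>2\<close> pays for its coupling into \<open>Y\<close> and \<open>K0\<close>,
  \<open>\<rho>\<^sup>2 / 4\<close> for the loss through \<open>Om\<close>, and the last summand is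
  the left side of the Stein inequality.\<close>

lemma weight_estimate: "w\<^sup>2 + \<rho>\<^sup>2 / 4 + (\<rho> / 2)\<^sup>2 * (\<rho>\<^sup>2 / (4 * w\<^sup>2)) \<le> \<rho>\<^sup>2 / (4 * w\<^sup>2) * ((\<beta> * b)\<^sup>2 / 2)"
proof -
  have p: "0 < 2 * w + 4 * w\<^sup>2 / \<rho>" using w0 \<rho>0 by (simp add: add_pos_pos)
  have "(2 * w + 4 * w\<^sup>2 / \<rho>)\<^sup>2 \<le> (\<beta> * b)\<^sup>2" using gap2 p by (intro power_mono) auto
  then have "\<rho>\<^sup>2 / (4 * w\<^sup>2) * ((2 * w + 4 * w\<^sup>2 / \<rho>)\<^sup>2 / 2) \<le> \<rho>\<^sup>2 / (4 * w\<^sup>2) * ((\<beta> * b)\<^sup>2 / 2)"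
    by (intro mult_left_mono) auto
  moreover have "\<rho>\<^sup>2 / (4 * w\<^sup>2) * ((2 * w + 4 * w\<^sup>2 / \<rho>)\<^sup>2 / 2) = \<rho>\<^sup>2 / 2 + 2 * \<rho> * w + 2 * w\<^sup>2"
    using w0 \<rho>0 by (simp add: field_simps power2_eq_square)
  moreover have "(\<rho> / 2)\<^sup>2 * (\<rho>\<^sup>2 / (4 * w\<^sup>2)) \<le> \<rho>\<^sup>2 / 4"
    using mult_left_mono[OF weight_le_1, of "(\<rho> / 2)\<^sup>2"] by (simp add: power_divide)
  moreover have "0 \<le> \<rho> * w" using w0 \<rho>0 by simp
  moreover have "0 \<le> w\<^sup>2" by simp
  ultimately show ?thesis by linarith
qed

text \<open>The middle part gains \<open>\<rho>\<^sup>2 / 2\<close> and loses half of it, the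
  \<open>K0\<close> part balances exactly, and all couplings are charged to the damped part, where
  \<beta> is large.\<close>

lemma gap_form_stein: "(\<rho> / 2)\<^sup>2 * gap_form x \<le> gap_form (A *v x)"
proof -
  define h where "h = \<rho>\<^sup>2 / (4 * w\<^sup>2)"
  have h0: "0 \<le> h" by (simp add: h_def)
  \<comment> \<open>This fixes the weight: the loss of the damped part through \<open>Om\<close>,
    weighted by \<open>h\<close>, equals the squared radius
    \<open>(\<rho> / 2)\<^sup>2\<close>.\<close>
  have hw: "h * w\<^sup>2 = \<rho>\<^sup>2 / 4" using w0 by (simp add: h_def)
  let ?p = "x - Q *v x"
  define p y z where "p = (norm ?p)\<^sup>2" and "y = (norm (Y x))\<^sup>2" and "z = (norm (Z0 *v x))\<^sup>2"
  have nx: "(norm x)\<^sup>2 = p + y + z"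
    using pythagoras[of x] norm_Q[of x] by (simp add: p_def y_def z_def)
  have 1: "(\<beta> * b)\<^sup>2 / 2 * p - w\<^sup>2 * (p + y + z) \<le> (norm (A *v x - Q *v (A *v x)))\<^sup>2"
  proof -
    have "(norm (Om *v x - Q *v (Om *v x)))\<^sup>2 \<le> w\<^sup>2 * (p + y + z)"
      using normOm_sq[of x] pythagoras[of "Om *v x"] zero_le_power2[of "norm (Q *v (Om *v x))"]
      unfolding nx by linarith
    then show ?thesis using compl_A_ge[of x] unfolding p_def by linarith
  qed
  have YA: "Y (A *v x) = Q *v (Om *v Y x) - (- Y (Om *v ?p))"
    and ZA: "Z0 *v (A *v x) = Z0 *v (Om *v ?p)"
  proof -
    have e: "Z0 *v (A *v x) = Z0 *v (Om *v x)"
      using ZQ[of "A *v x"] ZQ[of "Om *v x"] QA[of x] by simp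
    then show "Z0 *v (A *v x) = Z0 *v (Om *v ?p)" by (simp only: ZOm[of x])
    have "Y (A *v x) = Y (Om *v x)" by (simp add: Y_def QA e)
    then show "Y (A *v x) = Q *v (Om *v Y x) - (- Y (Om *v ?p))" by (simp add: YOm[of x])
  qed
  have 2: "\<rho>\<^sup>2 / 2 * y \<le> (norm (Y (A *v x)))\<^sup>2 + (norm (Y (Om *v ?p)))\<^sup>2"
  proof -
    have "(\<rho> * norm (Y x))\<^sup>2 \<le> (norm (Q *v (Om *v Y x)))\<^sup>2"
      using compression_Y \<rho>0 by (intro power_mono) auto
    moreover have "(norm (Q *v (Om *v Y x)))\<^sup>2 / 2 \<le> (norm (Y (A *v x)))\<^sup>2 + (norm (Y (Om *v ?p)))\<^sup>2"
      using norm_diff_square_ge[of "Q *v (Om *v Y x)" "- Y (Om *v ?p)"]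
      unfolding YA by (simp add: norm_minus_commute add.commute)
    ultimately show ?thesis by (simp add: y_def power_mult_distrib)
  qed
  \<comment> \<open>The couplings into \<open>Y\<close> and into \<open>K0\<close> are orthogonal,
    so they share a single bound.\<close>
  have 3: "(norm (Y (Om *v ?p)))\<^sup>2 + (norm (Z0 *v (A *v x)))\<^sup>2 \<le> w\<^sup>2 * p"
    using norm_Q[of "Om *v ?p"] power_mono[OF norm_le norm_ge_zero, of "Om *v ?p" 2] normOm_sq[of ?p]
    unfolding ZA p_def by linarith
  have 4: "h * ((\<beta> * b)\<^sup>2 / 2 * p - w\<^sup>2 * (p + y + z)) \<le> h * (norm (A *v x - Q *v (A *v x)))\<^sup>2"
    using 1 h0 by (rule mult_left_mono)
  have 5: "(w\<^sup>2 + \<rho>\<^sup>2 / 4 + (\<rho> / 2)\<^sup>2 * h) * p \<le> (h * ((\<beta> * b)\<^sup>2 / 2)) * p"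
    using weight_estimate unfolding h_def[symmetric] by (intro mult_right_mono) (auto simp: p_def)
  have 6: "h * ((\<beta> * b)\<^sup>2 / 2 * p - w\<^sup>2 * (p + y + z)) = (h * ((\<beta> * b)\<^sup>2 / 2)) * p - \<rho>\<^sup>2 / 4 * (p + y + z)"
    unfolding hw[symmetric] by (simp add: algebra_simps)
  have "(\<rho> / 2)\<^sup>2 * (h * p + y - z) = (\<rho> / 2)\<^sup>2 * h * p + \<rho>\<^sup>2 / 4 * y - \<rho>\<^sup>2 / 4 * z"
    by (simp add: power2_eq_square field_simps)
  also have "\<dots> \<le> h * (norm (A *v x - Q *v (A *v x)))\<^sup>2 + (norm (Y (A *v x)))\<^sup>2 - (norm (Z0 *v (A *v x)))\<^sup>2"
    using 2 3 4 5 6 by (simp add: algebra_simps)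
  finally show ?thesis unfolding gap_form_def h_def p_def y_def z_def .
qed

text \<open>The form is positive on nonzero vectors with vanishing \<open>Z0\<close> component, so
  \<open>Z0\<close> is injective on this root subspace.\<close>

lemma dim_near_zero:
  "vec.dim (root_space A {\<zeta>. cmod \<zeta> < \<rho> / 2}) \<le> vec.dim (range (\<lambda>v. B *v v))"
proof -
  have "vec.dim (root_space A {\<zeta>. cmod \<zeta> < \<rho> / 2}) \<le> vec.dim K0"
  proof (rule dim_le_inj_image[of _ Z0])
    fix v assume v: "v \<in> root_space A {\<zeta>. cmod \<zeta> < \<rho> / 2}" "Z0 *v v = 0"
    from stein_inside[OF v(1) _ _ gap_form_stein gap_form_bound] have "gap_form v \<le> 0" using \<rho>0 by simp
    then have "\<rho>\<^sup>2 / (4 * w\<^sup>2) * (norm (v - Q *v v))\<^sup>2 + (norm (Y v))\<^sup>2 \<le> 0"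
      using v(2) by (simp add: gap_form_def)
    moreover have "0 \<le> \<rho>\<^sup>2 / (4 * w\<^sup>2) * (norm (v - Q *v v))\<^sup>2" "0 \<le> (norm (Y v))\<^sup>2" by simp_all
    ultimately have "\<rho>\<^sup>2 / (4 * w\<^sup>2) * (norm (v - Q *v v))\<^sup>2 = 0" "(norm (Y v))\<^sup>2 = 0"
      by linarith+
    moreover have "\<rho>\<^sup>2 / (4 * w\<^sup>2) \<noteq> 0" using w0 \<rho>0 by simp
    ultimately have "(norm (v - Q *v v))\<^sup>2 = 0" "(norm (Y v))\<^sup>2 = 0" by auto
    then have "v = Q *v v" "Y v = 0" by simp_all
    then show "v = 0" using v(2) Q_decomp[of v] by simp
  qed (auto intro: subspace_root_space Z.mem)
  also have "vec.dim K0 \<le> vec.dim (range (\<lambda>v. B *v v))"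
  \<comment> \<open>For \<open>v\<close> in \<open>K0\<close>, \<open>Om *v v\<close> has no
    component in the kernel of \<open>B\<close>. If \<open>B\<close> kills it as well, it is zero,
    and \<open>Om\<close> is injective.\<close>
  proof (rule dim_le_inj_image[OF subspace_K0, of "B ** Om"])
    fix v assume v: "v \<in> K0" "(B ** Om) *v v = 0"
    then have "B *v (Om *v v) = 0" by (simp add: matrix_vector_mul_assoc)
    then have "Q *v (Om *v v) = Om *v v" using fixed_iff[of "Om *v v"] by simp
    then show "v = 0" using v(1) Om_inj by (simp add: K0_def)
  qed (auto simp flip: matrix_vector_mul_assoc)
  finally show ?thesis .
qed

text \<open>If |Re \<zeta>| were at most |Im \<zeta>|, the damped part of an eigenvector would be
  small relative to its kernel part by the strong damping, while the kernel equation bounds the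
  kernel part by the damped part. Under \<open>gap2\<close> both estimates hold only for the zero
  vector.\<close>

lemma low_loss_underdamped:
  assumes "\<zeta> \<in> spectrum A" "cmod \<zeta> \<le> w" "\<rho> / 2 \<le> cmod \<zeta>"
  shows "0 < Re (\<zeta>\<^sup>2)"
proof (rule ccontr)
  assume "\<not> 0 < Re (\<zeta>\<^sup>2)"
  define a c where "a = Re \<zeta>" and "c = Im \<zeta>"
  have "a\<^sup>2 \<le> c\<^sup>2" using \<open>\<not> 0 < Re (\<zeta>\<^sup>2)\<close> by (simp add: a_def c_def power2_eq_square)
  then have ac: "\<bar>a\<bar> \<le> \<bar>c\<bar>" by (simp add: abs_le_square_iff)
  obtain v where v: "v \<noteq> 0" "A *v v = \<zeta> *s v" using assms by (auto simp: spectrum_on_def)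
  let ?p = "v - Q *v v"
  have P: "(\<beta> * b - 2 * w) * norm ?p \<le> w * norm (Q *v v)"
  proof -
    have "(\<i> * complex_of_real \<beta>) *s (B *v v) = (Om *v v - Q *v (Om *v v)) - \<zeta> *s ?p"
      using compl_A[of v] unfolding v(2) by (simp add: vec.scale vec.scale_right_diff_distrib)
    then have "\<beta> * norm (B *v v) = norm ((Om *v v - Q *v (Om *v v)) - \<zeta> *s ?p)"
      using norm_damping[of v] by simp
    also have "\<dots> \<le> norm (Om *v v - Q *v (Om *v v)) + cmod \<zeta> * norm ?p"
      by (metis norm_scaleC norm_triangle_ineq4)
    also have "\<dots> \<le> norm (Om *v v) + w * norm ?p"
      using assms(2) by (intro add_mono norm_compl_le mult_right_mono) auto
    also have "norm (Om *v v) \<le> w * (norm ?p + norm (Q *v v))"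
    proof -
      have "norm v \<le> norm ?p + norm (Q *v v)" using norm_triangle_ineq[of ?p "Q *v v"] by simp
      then show ?thesis using normOm[of v] w0 by (meson mult_left_mono less_imp_le order_trans)
    qed
    finally show ?thesis using damping_ge[of v] by (simp add: algebra_simps)
  qed
  have Zeq: "Z0 *v (Om *v ?p) = \<zeta> *s (Z0 *v v)" and Yeq: "Y (Om *v ?p) = \<zeta> *s Y v - Q *v (Om *v Y v)"
  proof -
    have e: "Q *v (Om *v v) = \<zeta> *s (Q *v v)" using QA[of v] unfolding v(2) by (simp add: vec.scale)
    have e2: "Z0 *v (Om *v v) = \<zeta> *s (Z0 *v v)"
      using ZQ[of "Om *v v"] unfolding e by (simp add: vec.scale ZQ)
    then show "Z0 *v (Om *v ?p) = \<zeta> *s (Z0 *v v)" by (simp only: ZOm[of v, symmetric])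
    have "Y (Om *v v) = \<zeta> *s Y v" by (simp add: Y_def e e2 vec.scale_right_diff_distrib)
    then show "Y (Om *v ?p) = \<zeta> *s Y v - Q *v (Om *v Y v)" using YOm[of v] by (simp add: algebra_simps)
  qed
  let ?M = "Q *v (Om *v Y v)"
  have zz: "\<zeta> *s Y v - ?M = (a *\<^sub>R Y v - ?M) + \<i> *s (c *\<^sub>R Y v)"
    by (subst complex_eq[of \<zeta>], unfold scaleC_of_real[symmetric])
      (simp add: a_def c_def vec.scale_left_distrib)
  have orth0: "(a *\<^sub>R Y v - ?M) \<bullet> (\<i> *s (c *\<^sub>R Y v)) = 0"
  proof -
    have "hermitian (Q ** Om ** Q)"
      unfolding hermitian_def by (simp add: compression_herm flip: matrix_vector_mul_assoc)
    from hermitian_inner_ii[OF this, of "Y v"] have "?M \<bullet> (\<i> *s Y v) = 0"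
      by (simp add: QY flip: matrix_vector_mul_assoc)
    moreover have "\<i> *s (c *\<^sub>R Y v) = c *\<^sub>R (\<i> *s Y v)"
      by (simp add: mult.commute flip: scaleC_of_real)
    ultimately show ?thesis by (simp add: inner_diff_left inner_ii_self)
  qed
  have Ysq: "(norm (\<zeta> *s Y v - ?M))\<^sup>2 = (norm (a *\<^sub>R Y v - ?M))\<^sup>2 + c\<^sup>2 * (norm (Y v))\<^sup>2"
    unfolding zz by (subst norm_add_Pythagorean)
      (use orth0 in \<open>simp_all add: orthogonal_def norm_scaleC power_mult_distrib\<close>)
  \<comment> \<open>The distance from \<zeta> to the nonzero spectrum of the compression is at least
    \<open>\<rho> / 2\<close>: either |Im \<zeta>| provides it, or |Re \<zeta>| is below
    \<open>\<rho> / 2\<close> while that spectrum starts at \<open>\<rho>\<close>.\<close>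
  have Yge: "(\<rho> / 2)\<^sup>2 * (norm (Y v))\<^sup>2 \<le> (norm (Y (Om *v ?p)))\<^sup>2"
  proof (cases "\<rho> / 2 \<le> \<bar>c\<bar>")
    case True
    then have "(\<rho> / 2)\<^sup>2 \<le> c\<^sup>2" using \<rho>0 power_mono[OF True, of 2] by simp
    then have "(\<rho> / 2)\<^sup>2 * (norm (Y v))\<^sup>2 \<le> c\<^sup>2 * (norm (Y v))\<^sup>2" by (intro mult_right_mono) auto
    then show ?thesis unfolding Yeq Ysq using zero_le_power2[of "norm (a *\<^sub>R Y v - ?M)"] by linarith
  next
    case False
    have "(\<rho> / 2) * norm (Y v) \<le> (\<rho> - \<bar>a\<bar>) * norm (Y v)"
      using False ac by (intro mult_right_mono) auto
    also have "\<dots> \<le> norm ?M - norm (a *\<^sub>R Y v)" using compression_Y[of v] by (simp add: algebra_simps)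
    also have "\<dots> \<le> norm (a *\<^sub>R Y v - ?M)" by (metis norm_minus_commute norm_triangle_ineq2)
    finally have "((\<rho> / 2) * norm (Y v))\<^sup>2 \<le> (norm (a *\<^sub>R Y v - ?M))\<^sup>2"
      using \<rho>0 by (intro power_mono) auto
    then show ?thesis unfolding Yeq Ysq power_mult_distrib
      using mult_nonneg_nonneg[OF zero_le_power2[of c] zero_le_power2[of "norm (Y v)"]] by linarith
  qed
  \<comment> \<open>On \<open>K0\<close> the compression vanishes, so the lower bound on |\<zeta>|
    itself is used.\<close>
  have Zge: "(\<rho> / 2)\<^sup>2 * (norm (Z0 *v v))\<^sup>2 \<le> (norm (Z0 *v (Om *v ?p)))\<^sup>2"
    unfolding Zeq norm_scaleC power_mult_distrib
    using assms(3) \<rho>0 power_mono[OF assms(3), of 2] by (intro mult_right_mono) auto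
  have "((\<rho> / 2) * norm (Q *v v))\<^sup>2 \<le> (norm (Q *v (Om *v ?p)))\<^sup>2"
    unfolding power_mult_distrib norm_Q[of v] norm_Q[of "Om *v ?p"] distrib_left
    using Yge Zge by (rule add_mono)
  then have "(\<rho> / 2) * norm (Q *v v) \<le> norm (Q *v (Om *v ?p))" by (rule power2_le_imp_le) simp
  also have "\<dots> \<le> w * norm ?p" using norm_le normOm order_trans by blast
  finally have q: "(\<rho> / 2) * norm (Q *v v) \<le> w * norm ?p" .
  have g: "4 * w\<^sup>2 / \<rho> \<le> \<beta> * b - 2 * w" using gap2 by simp
  have "4 * w\<^sup>2 / \<rho> * norm ?p \<le> w * norm (Q *v v)"
    using P mult_right_mono[OF g, of "norm ?p"] by simp
  then have "w * (4 * (w * norm ?p)) \<le> w * (\<rho> * norm (Q *v v))"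
    using \<rho>0 by (simp add: field_simps power2_eq_square)
  then have "4 * (w * norm ?p) \<le> \<rho> * norm (Q *v v)" using w0 by simp
  then have "w * norm ?p \<le> 0" using q by linarith
  then have p0: "norm ?p = 0" using w0 by (simp add: mult_le_0_iff)
  then have "norm (Q *v v) = 0" using q \<rho>0 by (simp add: mult_le_0_iff)
  then show False using p0 v(1) by simp
qed

end

section \<open>Spectral duality\<close>

text \<open>The hypothesis says that \<open>S\<close> intertwines \<open>A\<close> with the negative
  inverse of \<open>D\<close>. A factor A - \<zeta> thus becomes D + 1/\<zeta>, up to the scalar
  -\<zeta> and one application of \<open>D\<close>.\<close>

lemma root_space_dual:
  fixes A D S :: "complex^'m^'m"
  assumes dual: "\<And>x. D *v (S *v (A *v x)) = - (S *v x)"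
    and x: "x \<in> root_space A Z" and Z: "0 \<notin> Z"
  shows "S *v x \<in> root_space D ((\<lambda>\<zeta>. - 1 / \<zeta>) ` Z)"
proof -
  obtain zs where zs: "set zs \<subseteq> Z" "fold (shift A) zs x = 0"
    using x by (auto simp: root_space_def)
  from zs have "fold (shift D) (map (\<lambda>\<zeta>. - 1 / \<zeta>) zs) (S *v x) = 0"
  proof (induction zs arbitrary: x)
    case (Cons \<zeta> zs)
    let ?ws = "map (\<lambda>\<zeta>. - 1 / \<zeta>) zs"
    have \<zeta>: "\<zeta> \<noteq> 0" using Cons.prems Z by auto
    have "D *v (S *v shift A \<zeta> x) = - (S *v x) - \<zeta> *s (D *v (S *v x))"
      by (simp add: shift_def vec.diff vec.scale dual)
    also have "\<dots> = (- \<zeta>) *s shift D (- 1 / \<zeta>) (S *v x)"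
      using \<zeta> by (simp add: shift_def vec.scale_right_diff_distrib)
    \<comment> \<open>\<open>D\<close> is written as a shift by 0 so that it commutes past the
      remaining factors.\<close>
    finally have e: "shift D 0 (S *v shift A \<zeta> x) = (- \<zeta>) *s shift D (- 1 / \<zeta>) (S *v x)"
      by (simp add: shift_def)
    have "fold (shift D) ?ws (S *v shift A \<zeta> x) = 0"
      using Cons.IH[of "shift A \<zeta> x"] Cons.prems by simp
    then have "fold (shift D) ?ws (shift D 0 (S *v shift A \<zeta> x)) = 0"
      by (simp only: fold_shift_commute shift_simps)
    then have "(- \<zeta>) *s fold (shift D) ?ws (shift D (- 1 / \<zeta>) (S *v x)) = 0"
      unfolding e fold_shift_simps .
    then show ?case using \<zeta> by simp
  qed simp
  moreover have "set (map (\<lambda>\<zeta>. - 1 / \<zeta>) zs) \<subseteq> (\<lambda>\<zeta>. - 1 / \<zeta>) ` Z" using zs by auto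
  ultimately show ?thesis unfolding root_space_def by blast
qed

section \<open>Block and complexified matrices\<close>

definition join :: "'a^'n \<Rightarrow> 'a^'n \<Rightarrow> 'a^('n + 'n)" where
  "join u v = (\<chi> i. case i of Inl a \<Rightarrow> u $ a | Inr a \<Rightarrow> v $ a)"

lemma join_nth [simp]: "join u v $ Inl a = u $ a" "join u v $ Inr a = v $ a"
  by (simp_all add: join_def)

lemma vec_sum_eq_iff: "x = y \<longleftrightarrow> (\<forall>a. x $ Inl a = y $ Inl a) \<and> (\<forall>a. x $ Inr a = y $ Inr a)"
  for x y :: "'a^('n::finite + 'n)"
  unfolding vec_eq_iff by (metis sum.exhaust_sel)

lemma join_surj: obtains u v where "x = join u v"
proof
  show "x = join (\<chi> a. x $ Inl a) (\<chi> a. x $ Inr a)" by (simp add: vec_sum_eq_iff)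
qed

lemma join_eq_iff [simp]: "join u v = join u' v' \<longleftrightarrow> u = u' \<and> v = v'"
  by (simp add: vec_sum_eq_iff vec_eq_iff)

lemma join_eq_0_iff [simp]: "join u v = 0 \<longleftrightarrow> u = 0 \<and> v = 0"
  by (simp add: vec_sum_eq_iff vec_eq_iff)

lemma join_arith:
  "join u v + join u' v' = join (u + u') (v + v' :: 'a::ring_1^'n)"
  "join u v - join u' v' = join (u - u') (v - v')"
  "- join u v = join (- u) (- v)"
  "c *s join u v = join (c *s u) (c *s v)"
  by (simp_all add: vec_sum_eq_iff)

lemma sum_UNIV_Plus: "(\<Sum>i\<in>UNIV. f i) = (\<Sum>a\<in>UNIV. f (Inl a)) + (\<Sum>a\<in>UNIV. f (Inr (a::'n)))"
  for f :: "'n::finite + 'n \<Rightarrow> 'b::comm_monoid_add"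
  by (simp add: sum.Plus flip: UNIV_Plus_UNIV)

lemma inner_join: "join u v \<bullet> join u' v' = u \<bullet> u' + v \<bullet> v'"
  by (simp add: inner_vec_def sum_UNIV_Plus)

lemma block_matrix_join:
  "block_matrix P Q R S *v join u v = join (P *v u + Q *v v) (R *v u + S *v (v :: 'a::ring_1^'n))"
  by (simp add: vec_sum_eq_iff matrix_vector_mult_def block_matrix_def sum_UNIV_Plus)

section \<open>Complexification of real matrices\<close>

definition cm :: "real^'n^'m \<Rightarrow> complex^'n^'m" where
  "cm M = map_matrix complex_of_real M"

definition cv :: "real^'n \<Rightarrow> complex^'n" where
  "cv x = (\<chi> i. complex_of_real (x $ i))"

definition cnjv :: "complex^'n \<Rightarrow> complex^'n" where
  "cnjv x = (\<chi> i. cnj (x $ i))"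

lemma cm_mult: "cm (M ** N) = cm M ** cm N"
  by (simp add: cm_def matrix_matrix_mult_def map_matrix_def vec_eq_iff)

lemma cm_mat1: "cm (mat 1) = mat 1"
  by (simp add: cm_def mat_def map_matrix_def vec_eq_iff)

lemma map_matrix_scale_of_real:
  "map_matrix (\<lambda>x. c * complex_of_real x) M *v u = c *s (cm M *v u)"
  by (simp add: cm_def matrix_vector_mult_def vec_eq_iff sum_distrib_left mult.assoc)

lemma map_matrix_scale: "map_matrix (\<lambda>z. c * z) (M :: complex^'n^'m) *v u = c *s (M *v u)"
  by (simp add: matrix_vector_mult_def vec_eq_iff sum_distrib_left mult.assoc)

lemma cm_inner:
  fixes M :: "real^'n^'n"
  shows "(cm M *v x) \<bullet> y = x \<bullet> (cm (transpose M) *v y)"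
proof -
  have "conj_transpose (cm M) = cm (transpose M)"
    by (simp add: conj_transpose_def cm_def transpose_def vec_eq_iff)
  then show ?thesis using inner_conj_transpose[of "cm M" x y] by simp
qed

lemma cm_cv: "cm M *v cv x = cv (M *v x)"
  by (simp add: cm_def cv_def matrix_vector_mult_def vec_eq_iff)

lemma cm_cnjv: "cm M *v cnjv x = cnjv (cm M *v x)"
  by (simp add: cm_def cnjv_def matrix_vector_mult_def vec_eq_iff)

lemma cnjv_simps [simp]:
  "cnjv (x + y) = cnjv x + cnjv y" "cnjv (x - y) = cnjv x - cnjv y" "cnjv (- x) = - cnjv x"
  "cnjv (c *s x) = cnj c *s cnjv x" "cnjv (cnjv x) = x" "cnjv 0 = 0"
  by (simp_all add: cnjv_def vec_eq_iff)

lemma cnjv_join [simp]: "cnjv (join u v) = join (cnjv u) (cnjv v)"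
  by (simp add: vec_sum_eq_iff) (simp add: cnjv_def)

lemma cnjv_eq_0 [simp]: "cnjv x = 0 \<longleftrightarrow> x = 0"
  by (metis cnjv_simps(5) cnjv_simps(6))

lemma inner_cnjv: "cnjv x \<bullet> cnjv y = x \<bullet> y"
  by (simp add: inner_vec_def cnjv_def inner_complex_def)

lemma cv_simps:
  "cv (x + y) = cv x + cv y" "cv (c *\<^sub>R x) = complex_of_real c *s cv x" "cv 0 = 0"
  by (simp_all add: cv_def vec_eq_iff)

lemma cv_inject [simp]: "cv x = cv y \<longleftrightarrow> x = y"
  by (simp add: cv_def vec_eq_iff)

lemma cv_Re_Im: obtains a c where "z = cv a + \<i> *s cv c"
proof
  show "z = cv (\<chi> i. Re (z $ i)) + \<i> *s cv (\<chi> i. Im (z $ i))"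
    by (simp add: cv_def vec_eq_iff complex_eq[symmetric])
qed

text \<open>A real basis of the range of \<open>R\<close> stays a basis over the complex numbers;
  this links the real rank to complex dimensions.\<close>

lemma dim_range_cm:
  fixes R :: "real^'n^'m"
  shows "vec.dim (range (\<lambda>x. cm R *v x)) = rank R"
proof -
  let ?V = "range (\<lambda>x. R *v x)"
  obtain D where D: "D \<subseteq> ?V" "independent D" "?V \<subseteq> span D" "card D = dim ?V"
    by (rule basis_exists[of ?V])
  have fin: "finite D" using D(2) by (rule independent_imp_finite)
  have inj: "inj_on cv D" by (rule inj_onI) simp
  have sub: "cv ` D \<subseteq> range (\<lambda>x. cm R *v x)"
  proof
    fix y assume "y \<in> cv ` D"
    then obtain x where "y = cv (R *v x)" using D(1) by auto
    then show "y \<in> range (\<lambda>x. cm R *v x)" by (auto simp flip: cm_cv)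
  qed
  have cvspan: "cv x \<in> vec.span (cv ` D)" if "x \<in> span D" for x
    using that
  proof (induction rule: span_induct_alt)
    case base
    then show ?case by (simp add: cv_simps vec.span_zero)
  next
    case (step c d y)
    then show ?case unfolding cv_simps
      by (intro vec.span_add vec.span_scale[OF vec.span_base] imageI step)
  qed
  have sp: "range (\<lambda>x. cm R *v x) \<subseteq> vec.span (cv ` D)"
  proof
    fix y assume "y \<in> range (\<lambda>x. cm R *v x)"
    then obtain z where z: "y = cm R *v z" by auto
    obtain a c where "z = cv a + \<i> *s cv c" by (rule cv_Re_Im)
    then have "y = cv (R *v a) + \<i> *s cv (R *v c)" using z by (simp add: vec.add vec.scale cm_cv)
    moreover have "R *v a \<in> span D" "R *v c \<in> span D" using D(3) by auto
    ultimately show "y \<in> vec.span (cv ` D)"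
      by (simp add: cvspan vec.span_add vec.span_scale)
  qed
  have ind: "vec.independent (cv ` D)"
  proof
    assume "vec.dependent (cv ` D)"
    then obtain u where u: "\<exists>w\<in>cv ` D. u w \<noteq> 0" "(\<Sum>w\<in>cv ` D. u w *s w) = 0"
      using fin by (subst (asm) vec.dependent_finite) auto
    have eq0: "(\<Sum>d\<in>D. u (cv d) *s cv d) = 0"
      using u(2) sum.reindex[OF inj, of "\<lambda>w. u w *s w"] by simp
    \<comment> \<open>The vectors are real, so the real and imaginary parts of the coefficients
      satisfy the relation separately.\<close>
    have re: "(\<Sum>d\<in>D. Re (u (cv d)) *\<^sub>R d) = 0"
      using arg_cong[OF eq0, of "\<lambda>z. \<chi> i. Re (z $ i)"]
      by (simp add: vec_eq_iff cv_def)
    have im: "(\<Sum>d\<in>D. Im (u (cv d)) *\<^sub>R d) = 0"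
      using arg_cong[OF eq0, of "\<lambda>z. \<chi> i. Im (z $ i)"]
      by (simp add: vec_eq_iff cv_def)
    have "Re (u (cv d)) = 0 \<and> Im (u (cv d)) = 0" if "d \<in> D" for d
      using independentD[OF D(2) fin order_refl, where u = "\<lambda>d. Re (u (cv d))", OF re that]
        independentD[OF D(2) fin order_refl, where u = "\<lambda>d. Im (u (cv d))", OF im that] by (rule conjI)
    then show False using u(1) by (auto simp: complex_eq_iff)
  qed
  have "card (cv ` D) = vec.dim (range (\<lambda>x. cm R *v x))"
    by (rule vec.basis_card_eq_dim[OF sub sp ind])
  then show ?thesis using D(4) card_image[OF inj] by (simp add: rank_dim_range)
qed

section \<open>Hermitian spectra\<close>

lemma hermitian_spectrum_real:
  assumes "hermitian M" "\<zeta> \<in> spectrum M"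
  shows "\<zeta> = complex_of_real (Re \<zeta>)"
proof -
  obtain v where v: "v \<noteq> 0" "M *v v = \<zeta> *s v" using assms by (auto simp: spectrum_on_def)
  have "\<zeta> *s v = Re \<zeta> *\<^sub>R v + Im \<zeta> *\<^sub>R (\<i> *s v)"
    by (subst complex_eq[of \<zeta>], unfold scaleC_of_real[symmetric]) (simp add: vec.scale_left_distrib mult.commute)
  moreover have "(\<zeta> *s v) \<bullet> (\<i> *s v) = 0" using hermitian_inner_ii[OF assms(1), of v] v by simp
  ultimately have "Im \<zeta> * (v \<bullet> v) = 0" by (simp add: inner_add_left inner_ii_self inner_ii)
  then show ?thesis using v by (simp add: complex_eq_iff)
qed

lemma real_eigenvalue_in_spectrum:
  "v \<noteq> 0 \<Longrightarrow> M *v v = \<mu> *\<^sub>R v \<Longrightarrow> complex_of_real \<mu> \<in> spectrum M"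
  by (auto simp: spectrum_on_def scaleC_of_real)

lemma finite_real_spectrum: "finite {x. complex_of_real x \<in> spectrum M}"
proof -
  have "{x. complex_of_real x \<in> spectrum M} = complex_of_real -` spectrum M" by auto
  then show ?thesis by (simp add: finite_vimageI inj_of_real)
qed

lemma hermitian_spectrum_trivial:
  assumes "hermitian M" "\<And>\<zeta>. \<zeta> \<in> spectrum M \<Longrightarrow> \<zeta> = 0"
  shows "M *v x = 0"
proof (rule selfadjoint_zero[OF linear_matrix_complex])
  show "(M *v x) \<bullet> y = x \<bullet> (M *v y)" for x y using assms(1) by (simp add: hermitian_def)
  fix v \<mu> assume "v \<noteq> 0" "M *v v = \<mu> *\<^sub>R v"
  then show "\<mu> = 0" using assms(2) real_eigenvalue_in_spectrum by fastforce
qed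

lemma spectrum_antisymmetric:
  assumes M: "\<And>x. M *v cnjv x = - cnjv (M *v x)" and "complex_of_real \<mu> \<in> spectrum M"
  shows "complex_of_real (- \<mu>) \<in> spectrum M"
proof -
  obtain v where v: "v \<noteq> 0" "M *v v = complex_of_real \<mu> *s v" using assms(2) by (auto simp: spectrum_on_def)
  have "M *v cnjv v = complex_of_real (- \<mu>) *s cnjv v" using M[of v] v(2) by simp
  then show ?thesis using v(1) unfolding spectrum_on_def by (metis (mono_tags, lifting) UNIV_I cnjv_eq_0 mem_Collect_eq)
qed

text \<open>Conjugation makes the spectrum symmetric about zero, so the largest eigenvalue is also
  the largest modulus and therefore bounds the operator norm.\<close>

lemma hermitian_norm_le_Max:
  assumes h: "hermitian M" and anti: "\<And>x. M *v cnjv x = - cnjv (M *v x)"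
  defines "w \<equiv> Max {x. complex_of_real x \<in> spectrum M}"
  shows "norm (M *v x) \<le> w * norm x" "\<And>\<zeta>. \<zeta> \<in> spectrum M \<Longrightarrow> cmod \<zeta> \<le> w"
    "complex_of_real w \<in> spectrum M" "0 \<le> w"
proof -
  let ?S = "{x. complex_of_real x \<in> spectrum M}"
  have fin: "finite ?S" by (rule finite_real_spectrum)
  obtain \<zeta> where "\<zeta> \<in> spectrum M" using spectrum_nonempty by blast
  then have "Re \<zeta> \<in> ?S" using hermitian_spectrum_real[OF h] by (metis mem_Collect_eq)
  then have ne: "?S \<noteq> {}" by blast
  show w: "complex_of_real w \<in> spectrum M" using Max_in[OF fin ne] by (simp add: w_def)
  have le: "\<bar>x\<bar> \<le> w" if "x \<in> ?S" for x
  proof -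
    have "- x \<in> ?S" using that spectrum_antisymmetric[OF anti] by simp
    then show ?thesis using that fin Max_ge unfolding w_def by (metis abs_le_iff)
  qed
  then show w0: "0 \<le> w" using w abs_ge_zero order_trans by (metis mem_Collect_eq)
  show "cmod \<zeta> \<le> w" if "\<zeta> \<in> spectrum M" for \<zeta>
  proof -
    have e: "\<zeta> = complex_of_real (Re \<zeta>)" by (rule hermitian_spectrum_real[OF h that])
    then have "Re \<zeta> \<in> ?S" using that by simp
    from le[OF this] show ?thesis by (subst e) simp
  qed
  show "norm (M *v x) \<le> w * norm x"
  proof (rule selfadjoint_norm_le[OF linear_matrix_complex _ _ w0])
    show "(M *v x) \<bullet> y = x \<bullet> (M *v y)" for x y using h by (simp add: hermitian_def)
    show "\<bar>\<mu>\<bar> \<le> w" if "v \<noteq> 0" "M *v v = \<mu> *\<^sub>R v" for v \<mu>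
      using le real_eigenvalue_in_spectrum[OF that] by simp
  qed
qed

section \<open>The damped system\<close>

definition swap_blocks :: "complex^('n::finite + 'n)^('n + 'n)" where
  "swap_blocks = block_matrix 0 (mat 1) (mat 1) 0"

lemma swap_join [simp]: "swap_blocks *v join u v = join v u"
  by (simp add: swap_blocks_def block_matrix_join)

lemma swap_swap [simp]: "swap_blocks *v (swap_blocks *v x) = (x :: complex^('n::finite + 'n))"
  by (rule join_surj[of x]) simp

locale damped_system =
  fixes \<alpha> \<eta> \<theta> R :: "real^'n^'n"
  assumes pd: "pos_def \<alpha>" "pos_def \<eta>" and th: "transpose \<theta> = - \<theta>" and psR: "pos_semidef R"
    and rk: "0 < rank R" "rank R < CARD('n)"
begin

abbreviation "a \<equiv> cm (matrix_sqrt \<alpha>)"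
abbreviation "e \<equiv> cm (matrix_sqrt \<eta>)"
abbreviation "K \<equiv> cm (matrix_inv (matrix_sqrt \<alpha>))"
abbreviation "L \<equiv> cm (matrix_inv (matrix_sqrt \<eta>))"
abbreviation "T \<equiv> cm \<theta>"
abbreviation "Rc \<equiv> cm R"
abbreviation "Om \<equiv> Omega_op \<alpha> \<eta> \<theta>"
abbreviation "B \<equiv> B_op \<alpha> R"
abbreviation "A \<equiv> A_op \<alpha> \<eta> \<theta> R"
abbreviation "D \<equiv> A_op \<eta> \<alpha> \<theta> R"

lemma cancel [simp]:
  "K *v (a *v x) = x" "a *v (K *v x) = x" "L *v (e *v x) = x" "e *v (L *v x) = x"
proof -
  note i = pos_def_inv[OF pos_def_sqrt(1)[OF pd(1)]] pos_def_inv[OF pos_def_sqrt(1)[OF pd(2)]]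
  have "K ** a = mat 1" "a ** K = mat 1" "L ** e = mat 1" "e ** L = mat 1"
    unfolding cm_mult[symmetric] by (simp_all add: i cm_mat1)
  then show "K *v (a *v x) = x" "a *v (K *v x) = x" "L *v (e *v x) = x" "e *v (L *v x) = x"
    by (simp_all add: matrix_vector_mul_assoc)
qed

lemma inner_K: "(K *v x) \<bullet> y = x \<bullet> (K *v y)"
  by (simp add: cm_inner pos_def_inv(3)[OF pos_def_sqrt(1)[OF pd(1)]])

lemma inner_e: "(e *v x) \<bullet> y = x \<bullet> (e *v y)"
  using pos_def_sqrt(1)[OF pd(2)] by (simp add: cm_inner pos_def_def)

lemma inner_T: "(T *v x) \<bullet> y = - (x \<bullet> (T *v y))"
proof -
  have "cm (- \<theta>) *v y = - (T *v y)"
    by (simp add: cm_def matrix_vector_mult_def vec_eq_iff sum_negf)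
  then show ?thesis by (simp add: cm_inner th)
qed

lemma inner_R: "(Rc *v x) \<bullet> y = x \<bullet> (Rc *v y)"
  using psR by (simp add: cm_inner pos_semidef_def)

lemma R_nonneg: "0 \<le> x \<bullet> (Rc *v x)"
proof -
  obtain S where S: "pos_semidef S" "S ** S = R" using pos_semidef_sqrt_exists[OF psR] by blast
  have "x \<bullet> (Rc *v x) = (cm S *v x) \<bullet> (cm S *v x)"
    using S(1) unfolding S(2)[symmetric]
    by (simp add: cm_inner cm_mult pos_semidef_def flip: matrix_vector_mul_assoc)
  then show ?thesis by simp
qed

lemma Om_join: "Om *v join u v =
    join ((- 2 * \<i>) *s (K *v (T *v (K *v u))) + (- \<i>) *s (K *v (e *v v))) (\<i> *s (e *v (K *v u)))"
proof -
  have tr: "transpose (Phi_op \<alpha> \<eta>) = matrix_inv (matrix_sqrt \<alpha>) ** matrix_sqrt \<eta>"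
    using pos_def_sqrt(1)[OF pd(2)] pos_def_inv(3)[OF pos_def_sqrt(1)[OF pd(1)]]
    by (simp add: Phi_op_def matrix_transpose_mul pos_def_def)
  show ?thesis
    unfolding Omega_op_def Let_def block_matrix_join map_matrix_scale_of_real tr
    unfolding Phi_op_def
    by (simp add: cm_mult flip: matrix_vector_mul_assoc)
qed

lemma B_join: "B *v join u v = join (K *v (Rc *v (K *v u))) 0"
  unfolding B_op_def Let_def block_matrix_join
  by (simp add: cm_mult flip: cm_def matrix_vector_mul_assoc)

lemma A_apply: "A \<beta> *v x = Om *v x - (\<i> * complex_of_real \<beta>) *s (B *v x)"
  unfolding A_op_def by (simp add: matrix_vector_mult_diff_rdistrib map_matrix_scale)

lemma A_join: "A \<beta> *v join u v =
    join ((- 2 * \<i>) *s (K *v (T *v (K *v u))) + (- \<i>) *s (K *v (e *v v))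
            - (\<i> * complex_of_real \<beta>) *s (K *v (Rc *v (K *v u))))
      (\<i> *s (e *v (K *v u)))"
  unfolding A_apply Om_join B_join join_arith by simp

lemma A_0: "A 0 = Om"
  by (simp add: matrix_eq A_apply)

lemma herm_Om: "hermitian Om"
  unfolding hermitian_def
proof (intro allI)
  fix x y :: "complex^('n + 'n)"
  obtain u v u' v' where xy: "x = join u v" "y = join u' v'" by (metis join_surj)
  show "(Om *v x) \<bullet> y = x \<bullet> (Om *v y)"
    unfolding xy Om_join inner_join inner_add_left inner_add_right inner_scaleC inner_K inner_e inner_T
    by (simp add: vec.scale vec.neg)
qed

lemma herm_B: "hermitian B"
  unfolding hermitian_def
proof (intro allI)
  fix x y :: "complex^('n + 'n)"
  obtain u v u' v' where xy: "x = join u v" "y = join u' v'" by (metis join_surj)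
  show "(B *v x) \<bullet> y = x \<bullet> (B *v y)"
    unfolding xy B_join inner_join inner_K inner_R by simp
qed

lemma B_nonneg: "0 \<le> x \<bullet> (B *v x)"
proof -
  obtain u v where x: "x = join u v" by (metis join_surj)
  have "x \<bullet> (B *v x) = (K *v u) \<bullet> (Rc *v (K *v u))"
    unfolding x B_join inner_join inner_K by simp
  then show ?thesis by (simp add: R_nonneg)
qed

lemma Om_cnjv: "Om *v cnjv x = - cnjv (Om *v x)"
proof -
  obtain u v where x: "x = join u v" by (metis join_surj)
  show ?thesis unfolding x cnjv_join Om_join cm_cnjv by (simp add: join_arith)
qed

lemma B_cnjv: "B *v cnjv x = cnjv (B *v x)"
proof -
  obtain u v where x: "x = join u v" by (metis join_surj)
  show ?thesis unfolding x cnjv_join B_join cm_cnjv by simp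
qed

text \<open>The range of \<open>B\<close> is the injective image of the range of \<open>Rc\<close>
  under \<open>K\<close> in the first block.\<close>

lemma dim_range_B: "vec.dim (range (\<lambda>x. B *v x)) = rank R"
proof -
  let ?f = "\<lambda>u. join (K *v u) 0"
  have lin: "Vector_Spaces.linear (*s) (*s) ?f"
    by unfold_locales (simp_all add: join_arith vec.add vec.scale)
  have "range (\<lambda>x. B *v x) = ?f ` range (\<lambda>u. Rc *v u)"
  proof
    show "range (\<lambda>x. B *v x) \<subseteq> ?f ` range (\<lambda>u. Rc *v u)"
    proof
      fix y assume "y \<in> range (\<lambda>x. B *v x)"
      then obtain u v where "y = B *v join u v" by (metis join_surj imageE)
      then show "y \<in> ?f ` range (\<lambda>u. Rc *v u)" unfolding B_join by blast
    qed
    show "?f ` range (\<lambda>u. Rc *v u) \<subseteq> range (\<lambda>x. B *v x)"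
    proof
      fix y assume "y \<in> ?f ` range (\<lambda>u. Rc *v u)"
      then obtain u where "y = ?f (Rc *v u)" by blast
      then have "y = B *v join (a *v u) 0" by (simp add: B_join)
      then show "y \<in> range (\<lambda>x. B *v x)" by blast
    qed
  qed
  moreover have "inj_on ?f X" for X
    by (rule inj_onI) (metis cancel(2) join_eq_iff)
  ultimately show ?thesis using vec.dim_image_eq[OF lin] by (metis dim_range_cm)
qed

section \<open>Interchange of the two positive definite matrices\<close>

lemma dual_system: "damped_system \<eta> \<alpha> \<theta> R"
  by unfold_locales (use pd th psR rk in auto)

text \<open>Block computation: the gyroscopic terms from the two factors cancel each other, and so
  do the damping terms.\<close>

lemma A_dual_inverse: "A \<beta> *v (swap_blocks *v (D \<beta> *v (swap_blocks *v x))) = - x"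
proof -
  interpret flat: damped_system \<eta> \<alpha> \<theta> R by (rule dual_system)
  obtain u v where x: "x = join u v" by (metis join_surj)
  show ?thesis unfolding x swap_join flat.A_join A_join
    by (simp add: join_arith vec.add vec.diff vec.scale vec.neg vec.scale_right_distrib
        vec.scale_right_diff_distrib mult.commute)
qed

lemma D_swap_A: "D \<beta> *v (swap_blocks *v (A \<beta> *v x)) = - (swap_blocks *v x)"
proof -
  interpret flat: damped_system \<eta> \<alpha> \<theta> R by (rule dual_system)
  show ?thesis using flat.A_dual_inverse[of \<beta> "swap_blocks *v x"] by simp
qed

lemma A_injective: "A \<beta> *v x = 0 \<Longrightarrow> x = 0"
  using D_swap_A[of \<beta> x] swap_swap[of x] by simp

lemma Om_injective: "Om *v x = 0 \<Longrightarrow> x = 0"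
  using A_injective[of 0 x] by (simp add: A_0)

definition A_inv :: "real \<Rightarrow> complex^('n + 'n)^('n + 'n)" where
  "A_inv \<beta> = - (swap_blocks ** D \<beta> ** swap_blocks)"

lemma A_inv: "A_inv \<beta> *v (A \<beta> *v x) = x" "A \<beta> *v (A_inv \<beta> *v x) = x"
proof -
  have i: "A_inv \<beta> *v y = - (swap_blocks *v (D \<beta> *v (swap_blocks *v y)))" for y
  proof -
    have "(- M) *v y = - (M *v y)" for M :: "complex^('n + 'n)^('n + 'n)"
      by (simp add: vec_eq_iff matrix_vector_mult_def sum_negf)
    then show ?thesis by (simp add: A_inv_def flip: matrix_vector_mul_assoc)
  qed
  show "A_inv \<beta> *v (A \<beta> *v x) = x" unfolding i D_swap_A by (simp add: vec.neg)
  show "A \<beta> *v (A_inv \<beta> *v x) = x" unfolding i by (simp add: vec.neg A_dual_inverse)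
qed

lemma spectrum_A_nonzero: "0 \<notin> spectrum (A \<beta>)"
  using A_injective by (auto simp: spectrum_on_def)

lemma spectrum_dual:
  assumes "\<zeta> \<in> spectrum (A \<beta>)"
  shows "- 1 / \<zeta> \<in> spectrum (D \<beta>)"
proof -
  have \<zeta>: "\<zeta> \<noteq> 0" using assms spectrum_A_nonzero by blast
  obtain v where v: "v \<noteq> 0" "A \<beta> *v v = \<zeta> *s v" using assms by (auto simp: spectrum_on_def)
  have "\<zeta> *s (D \<beta> *v (swap_blocks *v v)) = - (swap_blocks *v v)"
    using D_swap_A[of \<beta> v] v(2) by (simp add: vec.scale)
  then have "(1 / \<zeta>) *s (\<zeta> *s (D \<beta> *v (swap_blocks *v v))) = (1 / \<zeta>) *s (- (swap_blocks *v v))" by simp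
  then have "D \<beta> *v (swap_blocks *v v) = (- 1 / \<zeta>) *s (swap_blocks *v v)"
    using \<zeta> by (simp only: vec.scale_scale) simp
  moreover have "swap_blocks *v v \<noteq> 0" using v(1) swap_swap[of v] by (metis vec.zero)
  ultimately show ?thesis by (auto simp: spectrum_on_def)
qed

section \<open>Spectral constants of the system\<close>

abbreviation "\<omega> \<equiv> omega_max \<alpha> \<eta> \<theta>"
abbreviation "\<omega>' \<equiv> omega_max \<eta> \<alpha> \<theta>"
abbreviation "\<mu> \<equiv> omega_min \<alpha> \<eta> \<theta>"
abbreviation "b \<equiv> b_min \<alpha> R"
abbreviation "b' \<equiv> b_min \<eta> R"
abbreviation "\<rho> \<equiv> rho_min \<alpha> \<eta> \<theta> R"

lemmas omega_max_facts = hermitian_norm_le_Max[OF herm_Om Om_cnjv, folded omega_max_def]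

lemma omega_max_pos: "0 < \<omega>"
proof -
  have "complex_of_real \<omega> \<noteq> 0" using omega_max_facts(3) spectrum_A_nonzero[of 0] by (metis A_0)
  then show ?thesis using omega_max_facts(4) by simp
qed

lemma omega_min_le: "\<zeta> \<in> spectrum Om \<Longrightarrow> \<mu> \<le> cmod \<zeta>"
  by (simp add: omega_min_def)

lemma omega_min_attained: obtains \<zeta> where "\<zeta> \<in> spectrum Om" "cmod \<zeta> = \<mu>"
proof -
  have "\<mu> \<in> cmod ` spectrum Om"
    unfolding omega_min_def using spectrum_nonempty[of Om] by (intro Min_in) auto
  then show thesis using that by auto
qed

text \<open>At \<beta> = 0 the duality sends eigenvalues of \<open>Om\<close> to eigenvalues
  -1/\<zeta> of the dual operator, so least and greatest moduli are reciprocal.\<close>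

lemma omega_min_eq: "\<mu> = 1 / \<omega>'"
proof (rule antisym)
  interpret flat: damped_system \<eta> \<alpha> \<theta> R by (rule dual_system)
  have "- 1 / complex_of_real \<omega>' \<in> spectrum Om"
    using flat.spectrum_dual[of "complex_of_real \<omega>'" 0] flat.omega_max_facts(3)
    by (simp add: A_0 flat.A_0)
  from omega_min_le[OF this] show "\<mu> \<le> 1 / \<omega>'" using flat.omega_max_pos by (simp add: norm_divide)
next
  interpret flat: damped_system \<eta> \<alpha> \<theta> R by (rule dual_system)
  obtain \<zeta> where z: "\<zeta> \<in> spectrum Om" "cmod \<zeta> = \<mu>" by (rule omega_min_attained)
  have "\<zeta> \<noteq> 0" using z(1) spectrum_A_nonzero[of 0] by (metis A_0)
  then have p: "0 < \<mu>" unfolding z(2)[symmetric] by simp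
  have "- 1 / \<zeta> \<in> spectrum (Omega_op \<eta> \<alpha> \<theta>)"
    using spectrum_dual[of \<zeta> 0] z(1) by (simp add: A_0 flat.A_0)
  from flat.omega_max_facts(2)[OF this] have "1 / \<mu> \<le> \<omega>'" using z(2) by (simp add: norm_divide)
  then show "1 / \<omega>' \<le> \<mu>" using p flat.omega_max_pos by (simp add: field_simps)
qed

lemma omega_min_le_max: "\<mu> \<le> \<omega>"
  using omega_min_le[OF omega_max_facts(3)] omega_max_pos by simp

abbreviation "Q \<equiv> orth_projection {v. B *v v = 0}"

lemma proj_Q: "proj_onto Q {v. B *v v = 0}"
  by (rule orth_projection_proj_onto, rule vec.subspaceI) (auto simp: vec.add vec.scale)

lemma b_min_facts: "0 < b" "b * norm (x - Q *v x) \<le> norm (B *v x)"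
proof -
  interpret P: proj_onto Q "{v. B *v v = 0}" by (rule proj_Q)
  let ?S = "{x. x \<noteq> 0 \<and> complex_of_real x \<in> spectrum B}"
  have fin: "finite ?S" by (rule finite_subset[OF _ finite_real_spectrum[of B]]) auto
  have pos: "0 < x" if "x \<in> ?S" for x
  proof -
    have "complex_of_real x \<in> spectrum B" using that by simp
    then obtain v where v: "v \<noteq> 0" "B *v v = complex_of_real x *s v" by (auto simp: spectrum_on_def)
    have "0 \<le> x * (v \<bullet> v)" using B_nonneg[of v] v(2) by (simp add: scaleC_of_real)
    moreover have "x * (v \<bullet> v) < 0" if "x < 0" using that v(1) by (simp add: mult_neg_pos)
    ultimately have "\<not> x < 0" by linarith
    then show ?thesis using that by simp
  qed
  \<comment> \<open>Positive rank gives \<open>B\<close> a nonzero eigenvalue; without one the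
    minimum defining \<open>b\<close> would be unspecified.\<close>
  have "?S \<noteq> {}"
  proof
    assume em: "?S = {}"
    have "\<zeta> = 0" if "\<zeta> \<in> spectrum B" for \<zeta>
    proof -
      have z: "\<zeta> = complex_of_real (Re \<zeta>)" by (rule hermitian_spectrum_real[OF herm_B that])
      have "complex_of_real (Re \<zeta>) \<in> spectrum B" unfolding z[symmetric] by (rule that)
      then have "Re \<zeta> = 0" using em by blast
      then show ?thesis by (subst z) simp
    qed
    then have "B *v x = 0" for x by (rule hermitian_spectrum_trivial[OF herm_B])
    then have "range (\<lambda>x. B *v x) = {0}" by auto
    then have "vec.dim (range (\<lambda>x. B *v x)) = 0" by simp
    then show False using dim_range_B rk(1) by simp
  qed
  then have "b \<in> ?S" unfolding b_min_def using fin by (rule Min_in[rotated])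
  then show b0: "0 < b" by (rule pos)
  have le: "b \<le> x" if "x \<in> ?S" for x unfolding b_min_def using fin that by (rule Min_le)
  have "b * norm (x - Q *v x) \<le> norm (B *v (x - Q *v x))"
  proof (rule selfadjoint_norm_ge[OF linear_matrix_complex])
    show "(B *v x) \<bullet> y = x \<bullet> (B *v y)" for x y using herm_B by (simp add: hermitian_def)
    show "b \<le> \<bar>m\<bar>" if "v \<noteq> 0" "B *v v = m *\<^sub>R v" "m \<noteq> 0" for v m
      using le[of m] real_eigenvalue_in_spectrum[OF that(1,2)] that(3) by simp
    show "(x - Q *v x) \<bullet> k = 0" if "B *v k = 0" for k using P.orth that by simp
  qed (use b0 in simp)
  moreover have "B *v (Q *v x) = 0" using P.mem by auto
  ultimately show "b * norm (x - Q *v x) \<le> norm (B *v x)" by (simp add: vec.diff)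
qed

lemma dissipative_A:
  assumes "0 \<le> \<beta>" "2 * (\<omega> / b) < \<beta>"
  shows "dissipative Q B Om (A \<beta>) (A_inv \<beta>) \<beta> \<omega> b"
proof (intro dissipative.intro[OF proj_Q] dissipative_axioms.intro)
  show "2 * \<omega> < \<beta> * b" using assms(2) b_min_facts(1) by (simp add: field_simps)
qed (use assms herm_Om herm_B A_apply A_inv omega_max_pos omega_max_facts(1) b_min_facts B_nonneg in auto)

text \<open>\<open>B\<close> is real, so the entrywise conjugate of \<open>Q\<close> is an
  orthogonal projection onto the same kernel and equals \<open>Q\<close>. This gives the compression
  a symmetric spectrum.\<close>

lemma Q_cnjv: "Q *v cnjv x = cnjv (Q *v x)"
proof -
  interpret P: proj_onto Q "{v. B *v v = 0}" by (rule proj_Q)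
  let ?P = "map_matrix cnj Q"
  have Pv: "?P *v x = cnjv (Q *v cnjv x)" for x
    by (simp add: matrix_vector_mult_def cnjv_def vec_eq_iff)
  have "proj_onto ?P {v. B *v v = 0}"
  proof
    show "hermitian ?P" unfolding hermitian_def Pv
    proof (intro allI)
      fix x y
      have "cnjv (Q *v cnjv x) \<bullet> y = (Q *v cnjv x) \<bullet> cnjv y" by (metis inner_cnjv cnjv_simps(5))
      also have "\<dots> = cnjv x \<bullet> (Q *v cnjv y)" by (rule P.inner_move)
      also have "\<dots> = x \<bullet> cnjv (Q *v cnjv y)" by (metis inner_cnjv cnjv_simps(5))
      finally show "cnjv (Q *v cnjv x) \<bullet> y = x \<bullet> cnjv (Q *v cnjv y)" .
    qed
    show "?P ** ?P = ?P" by (simp add: matrix_eq Pv P.idem_v flip: matrix_vector_mul_assoc)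
    show "range (\<lambda>v. ?P *v v) = {v. B *v v = 0}"
    proof
      show "range (\<lambda>v. ?P *v v) \<subseteq> {v. B *v v = 0}" using P.mem by (auto simp: Pv B_cnjv)
      show "{v. B *v v = 0} \<subseteq> range (\<lambda>v. ?P *v v)"
      proof
        fix v assume "v \<in> {v. B *v v = 0}"
        then have "cnjv v \<in> {v. B *v v = 0}" by (simp add: B_cnjv)
        then have "Q *v cnjv v = cnjv v" by (simp only: P.fixed_iff)
        then have "v = ?P *v v" by (simp add: Pv)
        then show "v \<in> range (\<lambda>v. ?P *v v)" by blast
      qed
    qed
  qed
  then have "?P = Q" using proj_Q by (rule proj_onto_unique)
  then show ?thesis using Pv[of "cnjv x"] by simp
qed

abbreviation "M \<equiv> Q ** Om ** Q"

lemma M_apply: "M *v x = Q *v (Om *v (Q *v x))"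
  by (simp flip: matrix_vector_mul_assoc)

lemma herm_M: "hermitian M"
  using herm_Om proj_onto.herm[OF proj_Q] unfolding hermitian_def M_apply by simp

text \<open>A real vector in the kernel of \<open>R\<close> yields one vector in each block, both in
  the kernel of \<open>B\<close>, with nonzero pairing through the off-diagonal block of
  \<open>Om\<close>.\<close>

lemma M_nontrivial: "\<exists>x. M *v x \<noteq> 0"
proof -
  interpret P: proj_onto Q "{v. B *v v = 0}" by (rule proj_Q)
  have "rank R \<noteq> CARD('n)" using rk by simp
  then obtain x :: "real^'n" where x: "x \<noteq> 0" "R *v x = 0"
    using matrix_nonfull_linear_equations_eq[of R] by blast
  define u where "u = a *v cv x"
  define w where "w = \<i> *s (e *v cv x)"
  have "e *v cv x \<noteq> 0"
  proof
    assume "e *v cv x = 0"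
    then have "cv x = 0" using cancel(3)[of "cv x"] by simp
    then have "cv x = cv 0" by (simp add: cv_simps)
    then show False using x(1) by simp
  qed
  then have w0: "w \<noteq> 0" by (simp add: w_def)
  have Ku: "K *v u = cv x" by (simp add: u_def)
  have k1: "Q *v join u 0 = join u 0"
    using P.fixed_iff[of "join u 0"] x(2) by (simp add: B_join Ku cm_cv cv_simps)
  have k2: "Q *v join 0 w = join 0 w"
    using P.fixed_iff[of "join 0 w"] by (simp add: B_join)
  have "(M *v join u 0) \<bullet> join 0 w = (Om *v join u 0) \<bullet> join 0 w"
    unfolding M_apply P.inner_move k1 k2 ..
  also have "\<dots> = w \<bullet> w" by (simp add: Om_join inner_join Ku w_def)
  finally show ?thesis using w0 by (metis inner_eq_zero_iff inner_zero_left)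
qed

text \<open>The symmetric spectrum makes the smallest positive eigenvalue the smallest nonzero
  modulus, and compression does not increase the norm bound \<omega>.\<close>

lemma rho_facts: "0 < \<rho>" "\<rho> \<le> \<omega>"
  and rho_compression: "(\<And>k. M *v k = 0 \<Longrightarrow> v \<bullet> k = 0) \<Longrightarrow> \<rho> * norm v \<le> norm (M *v v)"
proof -
  interpret P: proj_onto Q "{v. B *v v = 0}" by (rule proj_Q)
  let ?S = "{x. 0 < x \<and> complex_of_real x \<in> spectrum M}"
  have rho: "\<rho> = Min ?S" by (simp add: rho_min_def Let_def)
  have anti: "M *v cnjv x = - cnjv (M *v x)" for x
    unfolding M_apply by (simp add: Q_cnjv Om_cnjv vec.neg)
  have fin: "finite ?S" by (rule finite_subset[OF _ finite_real_spectrum[of M]]) auto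
  have abs: "\<bar>x\<bar> \<in> ?S" if "x \<noteq> 0" "complex_of_real x \<in> spectrum M" for x
    using that spectrum_antisymmetric[of M x, OF anti] by (cases "0 < x") auto
  have "?S \<noteq> {}"
  proof
    assume em: "?S = {}"
    have "\<zeta> = 0" if "\<zeta> \<in> spectrum M" for \<zeta>
    proof -
      have z: "\<zeta> = complex_of_real (Re \<zeta>)" by (rule hermitian_spectrum_real[OF herm_M that])
      have "complex_of_real (Re \<zeta>) \<in> spectrum M" unfolding z[symmetric] by (rule that)
      then have "Re \<zeta> = 0" using em abs[of "Re \<zeta>"] by blast
      then show ?thesis by (subst z) simp
    qed
    then have "M *v x = 0" for x by (rule hermitian_spectrum_trivial[OF herm_M])
    then show False using M_nontrivial by simp
  qed
  then have mem: "\<rho> \<in> ?S" unfolding rho using fin by (rule Min_in[rotated])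
  then show r0: "0 < \<rho>" by simp
  have le: "\<rho> \<le> x" if "x \<in> ?S" for x unfolding rho using fin that by (rule Min_le)
  show "\<rho> \<le> \<omega>"
  proof -
    have "complex_of_real \<rho> \<in> spectrum M" using mem by simp
    then obtain v where v: "v \<noteq> 0" "M *v v = complex_of_real \<rho> *s v" by (auto simp: spectrum_on_def)
    have "\<rho> * norm v = norm (M *v v)" using v(2) r0 by (simp add: norm_scaleC)
    also have "\<dots> \<le> norm (Om *v (Q *v v))" unfolding M_apply by (rule P.norm_le)
    also have "\<dots> \<le> \<omega> * norm (Q *v v)" by (rule omega_max_facts(1))
    also have "\<dots> \<le> \<omega> * norm v" using P.norm_le omega_max_pos by (intro mult_left_mono) auto
    finally show ?thesis using v(1) by simp
  qed
  show "\<rho> * norm v \<le> norm (M *v v)" if v: "\<And>k. M *v k = 0 \<Longrightarrow> v \<bullet> k = 0"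
  proof (rule selfadjoint_norm_ge[OF linear_matrix_complex _ _ _ v])
    show "(M *v x) \<bullet> y = x \<bullet> (M *v y)" for x y using herm_M by (simp add: hermitian_def)
    show "\<rho> \<le> \<bar>m\<bar>" if "v \<noteq> 0" "M *v v = m *\<^sub>R v" "m \<noteq> 0" for v m
      using le abs[OF that(3) real_eigenvalue_in_spectrum[OF that(1,2)]] by blast
    show "0 \<le> \<rho>" using r0 by simp
  qed
qed

lemma dissipative_gap_A:
  assumes "0 \<le> \<beta>" "2 * (\<omega> / b) < \<beta>" "c_inv \<alpha> \<eta> \<theta> R (\<rho> / 2) < \<beta>"
  shows "dissipative_gap Q B Om (A \<beta>) (A_inv \<beta>) \<beta> \<omega> b \<rho>"
proof (intro dissipative_gap.intro dissipative_gap_axioms.intro dissipative_A assms(1,2))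
  have "c_inv \<alpha> \<eta> \<theta> R (\<rho> / 2) * b = 2 * \<omega> + 4 * \<omega>\<^sup>2 / \<rho>"
    using b_min_facts(1) rho_facts(1) by (simp add: c_inv_def field_simps)
  moreover have "c_inv \<alpha> \<eta> \<theta> R (\<rho> / 2) * b \<le> \<beta> * b"
    using assms(3) b_min_facts(1) by (intro mult_right_mono) auto
  ultimately show "2 * \<omega> + 4 * \<omega>\<^sup>2 / \<rho> \<le> \<beta> * b" by simp
  show "\<rho> * norm v \<le> norm (Q *v (Om *v (Q *v v)))"
    if "\<And>k. Q *v (Om *v (Q *v k)) = 0 \<Longrightarrow> v \<bullet> k = 0" for v
    using rho_compression[of v] that unfolding M_apply by blast
qed (use rho_facts Om_injective in auto)

lemma mod_neg_inverse: "\<zeta> \<noteq> 0 \<Longrightarrow> cmod \<zeta> < \<mu> \<longleftrightarrow> \<omega>' < cmod (- 1 / \<zeta>)"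
  using damped_system.omega_max_pos[OF dual_system] by (simp add: omega_min_eq norm_divide field_simps)

section \<open>Dimensions and sign conditions for the damped operator\<close>

lemma root_space_swap:
  assumes "x \<in> root_space (A \<beta>) Z" "\<And>\<zeta>. \<zeta> \<in> Z \<Longrightarrow> \<zeta> \<noteq> 0 \<Longrightarrow> - 1 / \<zeta> \<in> W"
  shows "swap_blocks *v x \<in> root_space (D \<beta>) W"
proof -
  have "x \<in> root_space (A \<beta>) (Z - {0})"
    using assms(1) root_space_spectrum_cong[of Z "A \<beta>" "Z - {0}"] spectrum_A_nonzero by blast
  from root_space_dual[OF D_swap_A this] have "swap_blocks *v x \<in> root_space (D \<beta>) ((\<lambda>\<zeta>. - 1 / \<zeta>) ` (Z - {0}))"
    by simp
  then show ?thesis using root_space_mono[of "(\<lambda>\<zeta>. - 1 / \<zeta>) ` (Z - {0})" W] assms(2) by blast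
qed

lemma dim_H_hl:
  assumes "0 \<le> \<beta>" "2 * (\<omega> / b) < \<beta>"
  shows "vec.dim (root_space (A \<beta>) {\<zeta>. \<omega> < cmod \<zeta>}) = rank R"
proof -
  interpret dissipative Q B Om "A \<beta>" "A_inv \<beta>" \<beta> \<omega> b using assms by (rule dissipative_A)
  show ?thesis using dim_high_loss dim_range_B by simp
qed

text \<open>The block swap is injective in both directions between this space and the high-loss
  space of the dual operator.\<close>

lemma dim_H_ll0:
  assumes "0 \<le> \<beta>" "2 * (\<omega>' / b') < \<beta>"
  shows "vec.dim (root_space (A \<beta>) {\<zeta>. cmod \<zeta> < \<mu>}) = rank R"
proof (rule antisym)
  interpret flat: damped_system \<eta> \<alpha> \<theta> R by (rule dual_system)
  have fl: "vec.dim (root_space (D \<beta>) {\<zeta>. \<omega>' < cmod \<zeta>}) = rank R"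
    using assms by (rule flat.dim_H_hl)
  have 1: "vec.dim (root_space (A \<beta>) {\<zeta>. cmod \<zeta> < \<mu>}) \<le> vec.dim (root_space (D \<beta>) {\<zeta>. \<omega>' < cmod \<zeta>})"
  proof (rule dim_le_inj_image[OF subspace_root_space, where T = swap_blocks])
    show "v = 0" if "swap_blocks *v v = 0" for v :: "complex^('n + 'n)" using that swap_swap[of v] by simp
    show "swap_blocks *v v \<in> root_space (D \<beta>) {\<zeta>. \<omega>' < cmod \<zeta>}"
      if "v \<in> root_space (A \<beta>) {\<zeta>. cmod \<zeta> < \<mu>}" for v
      using that by (rule root_space_swap) (use mod_neg_inverse in blast)
  qed
  then show "vec.dim (root_space (A \<beta>) {\<zeta>. cmod \<zeta> < \<mu>}) \<le> rank R" using fl by simp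
  have 2: "vec.dim (root_space (D \<beta>) {\<zeta>. \<omega>' < cmod \<zeta>}) \<le> vec.dim (root_space (A \<beta>) {\<zeta>. cmod \<zeta> < \<mu>})"
  proof (rule dim_le_inj_image[OF subspace_root_space, where T = swap_blocks])
    show "v = 0" if "swap_blocks *v v = 0" for v :: "complex^('n + 'n)" using that swap_swap[of v] by simp
    show "swap_blocks *v v \<in> root_space (A \<beta>) {\<zeta>. cmod \<zeta> < \<mu>}"
      if "v \<in> root_space (D \<beta>) {\<zeta>. \<omega>' < cmod \<zeta>}" for v
      using that
    proof (rule flat.root_space_swap)
      fix \<zeta> :: complex assume z: "\<zeta> \<in> {\<zeta>. \<omega>' < cmod \<zeta>}" "\<zeta> \<noteq> 0"
      then show "- 1 / \<zeta> \<in> {\<zeta>. cmod \<zeta> < \<mu>}" using mod_neg_inverse[of "- 1 / \<zeta>"] by simp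
    qed
  qed
  then show "rank R \<le> vec.dim (root_space (A \<beta>) {\<zeta>. cmod \<zeta> < \<mu>})" using fl by simp
qed

text \<open>The square of -1/\<zeta> is a positive multiple of the conjugate of the square of
  \<zeta>; at zero both sides vanish by the convention for division.\<close>

lemma Re_square_neg_inverse: "0 < Re ((- 1 / \<zeta>)\<^sup>2) \<longleftrightarrow> 0 < Re (\<zeta>\<^sup>2)" "Re ((- 1 / \<zeta>)\<^sup>2) < 0 \<longleftrightarrow> Re (\<zeta>\<^sup>2) < 0"
proof -
  have "Re ((- 1 / \<zeta>)\<^sup>2) = Re (\<zeta>\<^sup>2) / (cmod (\<zeta>\<^sup>2))\<^sup>2"
    by (simp add: power_divide Re_divide cmod_power2)
  then show "0 < Re ((- 1 / \<zeta>)\<^sup>2) \<longleftrightarrow> 0 < Re (\<zeta>\<^sup>2)" "Re ((- 1 / \<zeta>)\<^sup>2) < 0 \<longleftrightarrow> Re (\<zeta>\<^sup>2) < 0"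
    by (cases "\<zeta> = 0"; simp add: zero_less_divide_iff divide_less_0_iff)+
qed

lemma ll0_overdamped:
  assumes "0 \<le> \<beta>" "2 * (\<omega>' / b') < \<beta>" "\<zeta> \<in> spectrum (A \<beta>)" "cmod \<zeta> < \<mu>"
  shows "Re (\<zeta>\<^sup>2) < 0"
proof -
  interpret flat: damped_system \<eta> \<alpha> \<theta> R by (rule dual_system)
  interpret d: dissipative flat.Q flat.B flat.Om "D \<beta>" "flat.A_inv \<beta>" \<beta> \<omega>' b'
    using assms(1,2) by (rule flat.dissipative_A)
  have "\<zeta> \<noteq> 0" using assms(3) spectrum_A_nonzero by blast
  then have "\<omega>' < cmod (- 1 / \<zeta>)" using mod_neg_inverse assms(4) by blast
  from d.high_loss_overdamped[OF spectrum_dual[OF assms(3)] this]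
  show ?thesis by (simp only: Re_square_neg_inverse)
qed

text \<open>The eigenvalues in \<open>|\<zeta>| < \<omega>\<^sub>m\<^sub>i\<^sub>n\<close> already exhaust the at most \<open>rank R\<close> eigenvalues in
  \<open>|\<zeta>| < \<rho> / 2\<close>, so that all other low-loss eigenvalues lie in the underdamped region.\<close>

lemma ll1_underdamped_primal:
  assumes \<beta>: "0 \<le> \<beta>" "2 * (\<omega> / b) < \<beta>" "2 * (\<omega>' / b') < \<beta>" "c_inv \<alpha> \<eta> \<theta> R (\<rho> / 2) < \<beta>"
    and \<zeta>: "\<zeta> \<in> spectrum (A \<beta>)" "\<mu> \<le> cmod \<zeta>" "cmod \<zeta> \<le> \<omega>"
  shows "0 < Re (\<zeta>\<^sup>2)"
proof -
  interpret d: dissipative_gap Q B Om "A \<beta>" "A_inv \<beta>" \<beta> \<omega> b \<rho>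
    using \<beta>(1,2,4) by (rule dissipative_gap_A)
  let ?V = "root_space (A \<beta>) {\<zeta>. cmod \<zeta> < \<mu>}" and ?W = "root_space (A \<beta>) {\<zeta>. cmod \<zeta> < \<rho> / 2}"
  have "?V \<subseteq> ?W"
  proof (rule root_space_spectrum_cong)
    show "{\<zeta>. cmod \<zeta> < \<mu>} \<inter> spectrum (A \<beta>) \<subseteq> {\<zeta>. cmod \<zeta> < \<rho> / 2}"
    proof
      fix z assume z: "z \<in> {\<zeta>. cmod \<zeta> < \<mu>} \<inter> spectrum (A \<beta>)"
      then have "Re (z\<^sup>2) < 0" using ll0_overdamped[OF \<beta>(1,3)] by blast
      moreover have "cmod z \<le> \<omega>" using z omega_min_le_max by simp
      ultimately show "z \<in> {\<zeta>. cmod \<zeta> < \<rho> / 2}" using d.low_loss_underdamped[of z] z by force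
    qed
  qed
  moreover have "vec.dim ?W \<le> vec.dim ?V"
    using d.dim_near_zero dim_H_ll0[OF \<beta>(1,3)] dim_range_B by simp
  ultimately have eq: "?V = ?W"
    using vec.subspace_dim_equal[OF subspace_root_space subspace_root_space] by blast
  have "\<rho> / 2 \<le> cmod \<zeta>"
  proof (rule ccontr)
    assume "\<not> \<rho> / 2 \<le> cmod \<zeta>"
    then have "\<zeta> \<in> spectrum_on (A \<beta>) ?W" using \<zeta>(1) by (simp add: spectrum_on_root_space)
    then have "\<zeta> \<in> spectrum_on (A \<beta>) ?V" by (simp only: eq)
    then show False using \<zeta>(2) by (simp add: spectrum_on_root_space)
  qed
  then show ?thesis using d.low_loss_underdamped \<zeta> by blast
qed

text \<open>The minimum in \<open>beta2\<close> provides one of the two thresholds. In the dual case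
  \<zeta> is replaced by -1/\<zeta>, which maps the middle annulus to the dual one and preserves the
  sign condition.\<close>

lemma ll1_underdamped:
  assumes \<beta>: "0 \<le> \<beta>" "beta2 \<alpha> \<eta> \<theta> R < \<beta>"
    and \<zeta>: "\<zeta> \<in> spectrum (A \<beta>)" "\<mu> \<le> cmod \<zeta>" "cmod \<zeta> \<le> \<omega>"
  shows "0 < Re (\<zeta>\<^sup>2)"
proof -
  interpret flat: damped_system \<eta> \<alpha> \<theta> R by (rule dual_system)
  have b: "2 * (\<omega> / b) < \<beta>" "2 * (\<omega>' / b') < \<beta>"
    and "c_inv \<alpha> \<eta> \<theta> R (\<rho> / 2) < \<beta> \<or> c_inv \<eta> \<alpha> \<theta> R (flat.\<rho> / 2) < \<beta>"
    using \<beta>(2) by (auto simp: beta2_def min_less_iff_disj)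
  then show ?thesis
  proof (elim disjE)
    assume "c_inv \<alpha> \<eta> \<theta> R (\<rho> / 2) < \<beta>"
    then show ?thesis using ll1_underdamped_primal \<beta>(1) b \<zeta> by blast
  next
    assume c: "c_inv \<eta> \<alpha> \<theta> R (flat.\<rho> / 2) < \<beta>"
    have z0: "\<zeta> \<noteq> 0" using \<zeta>(1) spectrum_A_nonzero by blast
    have "cmod (- 1 / \<zeta>) \<le> \<omega>'" using mod_neg_inverse[OF z0] \<zeta>(2) by simp
    moreover have "flat.\<mu> \<le> cmod (- 1 / \<zeta>)"
      using flat.mod_neg_inverse[of "- 1 / \<zeta>"] z0 \<zeta>(3) by simp
    ultimately have "0 < Re ((- 1 / \<zeta>)\<^sup>2)"
      using flat.ll1_underdamped_primal[OF \<beta>(1) b(2,1) c spectrum_dual[OF \<zeta>(1)]] by blast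
    then show ?thesis by (simp only: Re_square_neg_inverse)
  qed
qed

end

text \<open>The hypothesis says |Im \<zeta>| < |Re \<zeta>|. A real nonzero \<zeta> has infinite
  quality factor.\<close>

lemma quality_factor_gt_half:
  assumes "0 < Re (\<zeta>\<^sup>2)" "Im \<zeta> \<le> 0"
  shows "1 / 2 < quality_factor \<zeta>" "Re \<zeta> \<noteq> 0"
proof -
  have "(Im \<zeta>)\<^sup>2 < (Re \<zeta>)\<^sup>2" using assms(1) by (simp add: power2_eq_square)
  then have lt: "\<bar>Im \<zeta>\<bar> < \<bar>Re \<zeta>\<bar>" by (rule power2_less_imp_less[of "\<bar>Im \<zeta>\<bar>" "\<bar>Re \<zeta>\<bar>", simplified])
  then show re: "Re \<zeta> \<noteq> 0" by auto
  have half: "(1 / 2 :: ereal) = ereal (1 / 2)" by (simp add: one_ereal_def numeral_eq_ereal)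
  show "1 / 2 < quality_factor \<zeta>"
  proof (cases "Im \<zeta> = 0")
    case True
    then show ?thesis using re by (simp add: quality_factor_def half)
  next
    case False
    then have "1 < \<bar>Re \<zeta>\<bar> / (- Im \<zeta>)" using lt assms(2) by (subst pos_less_divide_eq) auto
    then have "1 / 2 < 1 / 2 * (\<bar>Re \<zeta>\<bar> / (- Im \<zeta>))" by linarith
    then show ?thesis unfolding quality_factor_def half using False by simp
  qed
qed

theorem corollary35:
  fixes \<alpha> \<eta> \<theta> R :: "real^'n^'n" and \<beta> :: real
  assumes "pos_def \<alpha>" and "pos_def \<eta>" and "transpose \<theta> = - \<theta>" and "pos_semidef R"
    and "0 < rank R" and "rank R < CARD('n)"
    and "0 \<le> \<beta>" and "\<beta> > beta2 \<alpha> \<eta> \<theta> R"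
  shows "bij_betw (\<lambda>(x, y, z). x + y + z)
           (H_hl \<alpha> \<eta> \<theta> R \<beta> \<times> H_ll0 \<alpha> \<eta> \<theta> R \<beta> \<times> H_ll1 \<alpha> \<eta> \<theta> R \<beta>)
           (UNIV :: (complex^('n + 'n)) set) \<and>
         vec.dim (H_hl \<alpha> \<eta> \<theta> R \<beta>) = rank R \<and>
         vec.dim (H_ll0 \<alpha> \<eta> \<theta> R \<beta>) = rank R \<and>
         vec.dim (H_ll1 \<alpha> \<eta> \<theta> R \<beta>) = 2 * CARD('n) - 2 * rank R \<and>
         Min (quality_factor ` spectrum_on (A_op \<alpha> \<eta> \<theta> R \<beta>) (H_ll1 \<alpha> \<eta> \<theta> R \<beta>)) > 1 / 2 \<and>
         (\<forall>\<zeta> \<in> spectrum_on (A_op \<alpha> \<eta> \<theta> R \<beta>) (H_ll1 \<alpha> \<eta> \<theta> R \<beta>). Re \<zeta> \<noteq> 0)"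
proof -
  interpret damped_system \<alpha> \<eta> \<theta> R by unfold_locales (use assms in auto)
  have b: "2 * (\<omega> / b) < \<beta>" "2 * (\<omega>' / b') < \<beta>" using assms(8) by (auto simp: beta2_def)
  interpret d: dissipative Q B Om "A \<beta>" "A_inv \<beta>" \<beta> \<omega> b using assms(7) b(1) by (rule dissipative_A)
  define Z1 Z2 Z3 where "Z1 = {\<zeta>. \<omega> < cmod \<zeta>}" and "Z2 = {\<zeta>. cmod \<zeta> < \<mu>}"
    and "Z3 = {\<zeta>. \<mu> \<le> cmod \<zeta> \<and> cmod \<zeta> \<le> \<omega>}"
  have H: "H_hl \<alpha> \<eta> \<theta> R \<beta> = root_space (A \<beta>) Z1" "H_ll0 \<alpha> \<eta> \<theta> R \<beta> = root_space (A \<beta>) Z2"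
    "H_ll1 \<alpha> \<eta> \<theta> R \<beta> = root_space (A \<beta>) Z3"
    by (simp_all add: H_hl_def H_ll0_def H_ll1_def gen_eigenspace_sum_eq_root_space Z1_def Z2_def Z3_def)
  have disj: "Z1 \<inter> (Z2 \<union> Z3) = {}" "Z2 \<inter> Z3 = {}" and un: "Z1 \<union> (Z2 \<union> Z3) = UNIV"
    and low: "Z2 \<union> Z3 = {\<zeta>. cmod \<zeta> \<le> \<omega>}"
    using omega_min_le_max by (auto simp: Z1_def Z2_def Z3_def)
  note sub = subspace_root_space[of "A \<beta>"]
  \<comment> \<open>The direct sum is stated as unique representation, obtained by splitting the
    plane first into \<open>Z1\<close> and its complement, then that complement into
    \<open>Z2\<close> and \<open>Z3\<close>.\<close>
  have bij: "bij_betw (\<lambda>(x, y, z). x + y + z)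
     (root_space (A \<beta>) Z1 \<times> root_space (A \<beta>) Z2 \<times> root_space (A \<beta>) Z3) UNIV"
    unfolding bij_betw_def
  proof
    have m: "root_space (A \<beta>) Z2 \<subseteq> root_space (A \<beta>) (Z2 \<union> Z3)"
      "root_space (A \<beta>) Z3 \<subseteq> root_space (A \<beta>) (Z2 \<union> Z3)"
      by (rule root_space_mono, simp)+
    show "inj_on (\<lambda>(x, y, z). x + y + z)
       (root_space (A \<beta>) Z1 \<times> root_space (A \<beta>) Z2 \<times> root_space (A \<beta>) Z3)"
    proof (rule inj_onI, clarsimp)
      fix x y z x' y' z'
      assume x: "x \<in> root_space (A \<beta>) Z1" "x' \<in> root_space (A \<beta>) Z1"
        and y: "y \<in> root_space (A \<beta>) Z2" "y' \<in> root_space (A \<beta>) Z2"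
        and z: "z \<in> root_space (A \<beta>) Z3" "z' \<in> root_space (A \<beta>) Z3"
        and eq: "x + y + z = x' + y' + z'"
      have "x - x' \<in> root_space (A \<beta>) Z1" using x by (rule vec.subspace_diff[OF sub])
      moreover have "x - x' = (y' - y) + (z' - z)" using eq by (simp add: algebra_simps)
      moreover have "(y' - y) + (z' - z) \<in> root_space (A \<beta>) (Z2 \<union> Z3)"
        using y z m by (intro vec.subspace_add[OF sub] vec.subspace_diff[OF sub]) auto
      ultimately have "x - x' = 0" using root_space_disjoint[OF _ _ disj(1)] by metis
      then have xx: "x = x'" by simp
      have "y - y' \<in> root_space (A \<beta>) Z2" using y by (rule vec.subspace_diff[OF sub])
      moreover have "z' - z \<in> root_space (A \<beta>) Z3" using z(2,1) by (rule vec.subspace_diff[OF sub])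
      moreover have "y - y' = z' - z" using eq xx by (simp add: algebra_simps)
      ultimately have "y - y' = 0" using root_space_disjoint[OF _ _ disj(2)] by metis
      then show "x = x' \<and> y = y' \<and> z = z'" using xx eq by simp
    qed
    show "(\<lambda>(x, y, z). x + y + z) ` (root_space (A \<beta>) Z1 \<times> root_space (A \<beta>) Z2 \<times> root_space (A \<beta>) Z3) = UNIV"
    proof (intro subset_antisym subset_UNIV subsetI)
      fix v :: "complex^('n + 'n)"
      have "v \<in> root_space (A \<beta>) (Z1 \<union> (Z2 \<union> Z3))" by (simp add: un root_space_UNIV)
      then obtain x r where x: "x \<in> root_space (A \<beta>) Z1" "r \<in> root_space (A \<beta>) (Z2 \<union> Z3)" "v = x + r"
        using disj(1) by (rule root_space_split)
      from x(2) disj(2) obtain y z where "y \<in> root_space (A \<beta>) Z2" "z \<in> root_space (A \<beta>) Z3" "r = y + z"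
        by (rule root_space_split)
      then show "v \<in> (\<lambda>(x, y, z). x + y + z) `
          (root_space (A \<beta>) Z1 \<times> root_space (A \<beta>) Z2 \<times> root_space (A \<beta>) Z3)"
        using x by (intro image_eqI[of _ _ "(x, y, z)"]) (auto simp: add.assoc)
    qed
  qed
  have d1: "vec.dim (root_space (A \<beta>) Z1) = rank R"
    unfolding Z1_def using assms(7) b(1) by (rule dim_H_hl)
  have d2: "vec.dim (root_space (A \<beta>) Z2) = rank R"
    unfolding Z2_def using assms(7) b(2) by (rule dim_H_ll0)
  have d3: "vec.dim (root_space (A \<beta>) Z3) = 2 * CARD('n) - 2 * rank R"
    using d.dim_low_loss dim_root_space_Un[OF disj(2), of "A \<beta>"] d2
    unfolding low[symmetric] dim_range_B by simp
  have sp: "spectrum_on (A \<beta>) (root_space (A \<beta>) Z3) = spectrum (A \<beta>) \<inter> Z3"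
    by (rule spectrum_on_root_space)
  have good: "1 / 2 < quality_factor \<zeta> \<and> Re \<zeta> \<noteq> 0" if "\<zeta> \<in> spectrum (A \<beta>) \<inter> Z3" for \<zeta>
  proof -
    have "0 < Re (\<zeta>\<^sup>2)" using ll1_underdamped[OF assms(7,8)] that by (simp add: Z3_def)
    moreover have "Im \<zeta> \<le> 0" using d.Im_eigenvalue_le_0 that by blast
    ultimately show ?thesis using quality_factor_gt_half by blast
  qed
  \<comment> \<open>The space has positive dimension because the rank is below N, so the minimum is
    over a nonempty set.\<close>
  have ne: "spectrum (A \<beta>) \<inter> Z3 \<noteq> {}"
  proof
    assume "spectrum (A \<beta>) \<inter> Z3 = {}"
    then have "root_space (A \<beta>) Z3 \<subseteq> {0}" using root_space_nonzero_spectrum by blast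
    then have "vec.dim (root_space (A \<beta>) Z3) = 0" by simp
    then show False using d3 assms(6) by simp
  qed
  have "Min (quality_factor ` (spectrum (A \<beta>) \<inter> Z3)) > 1 / 2"
    using ne good by (subst Min_gr_iff) auto
  then show ?thesis unfolding H sp using bij d1 d2 d3 good by blast
qed

end
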